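(* Let $\mathcal{L}_{GP}$ be the linearized Gross-Pitaevskii operator defined in the context. Then $i\mathcal{L}_{GP}$ has no eigenvalues in $(-\infty,-\frac{\sqrt{17}}{8}]\cup[\frac{\sqrt{17}}{8},\infty)$.
   Context: Let $\rho=\rho_1$ be the unique smooth solution on $(0,\infty)$ of $\frac12\rho''+\frac12\coth(r)\rho'-\frac{1}{2\sinh^2 r}\rho+\rho-\rho^3=0$ with $\lim_{r\to0}\rho(r)=0$, $\lim_{r\to\infty}\rho(r)=1$, $\rho\ge0$; it satisfies $0<\rho<1$ and $\rho'>0$. Define on the half-line $$\mathfrak{L}_0=-\tfrac12\partial_r^2+\frac{3}{8\sinh^2r}+\frac18,\quad \mathfrak{L}_1=\mathfrak{L}_0+\rho^2-1,\quad \mathfrak{L}_2=\mathfrak{L}_0+3\rho^2-1,\quad \mathcal{L}_{GP}=\begin{pmatrix}0&\mathfrak{L}_1\\-\mathfrak{L}_2&0\end{pmatrix},$$ with $\mathfrak{L}_0,\mathfrak{L}_1,\mathfrak{L}_2$ having domain $\mathcal{D}=\{f\in L^2(\mathbb{R}_+,dr):\mathfrak{L}_0f\in L^2(\mathbb{R}_+,dr)\}$ and $\mathcal{L}_{GP}$ having domain $\mathcal{D}\times\mathcal{D}\subset L^2(\mathbb{R}_+,dr)\times L^2(\mathbb{R}_+,dr)$. *)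

theory Defs
  imports "HOL-Analysis.Analysis"
begin

text \<open>For open \<open>S\<close>: the function is infinitely differentiable on \<open>S\<close>.\<close>

definition smooth_on :: "real set \<Rightarrow> (real \<Rightarrow> real) \<Rightarrow> bool" where
  "smooth_on S f \<longleftrightarrow> (\<forall>n. \<forall>x\<in>S. (deriv ^^ n) f field_differentiable at x)"

text \<open>
  The profile of the degree-one vortex. It is unique as a function on the open half-line;
  values at non-positive arguments are unconstrained and never used. The bounds
  \<open>0 < \<rho> < 1\<close> and \<open>\<rho>' > 0\<close> are consequences and are not part of the definition.
\<close>

definition vortex_profile :: "(real \<Rightarrow> real) \<Rightarrow> bool" where
  "vortex_profile \<rho> \<longleftrightarrow>
     smooth_on {0<..} \<rho> \<and>
     (\<forall>r>0. 1/2 * deriv (deriv \<rho>) r + 1/2 * (cosh r / sinh r) * deriv \<rho> r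
              - 1 / (2 * (sinh r)\<^sup>2) * \<rho> r + \<rho> r - (\<rho> r) ^ 3 = 0) \<and>
     (\<rho> \<longlongrightarrow> 0) (at_right 0) \<and>
     (\<rho> \<longlongrightarrow> 1) at_top \<and>
     (\<forall>r>0. \<rho> r \<ge> 0)"

abbreviation half_line :: "real measure" where
  "half_line \<equiv> lebesgue_on {0<..}"

text \<open>Elements of \<open>L\<^sup>2\<close> are represented by functions, identified when equal almost everywhere.\<close>

definition L2 :: "(real \<Rightarrow> complex) set" where
  "L2 = {f. f \<in> borel_measurable half_line \<and> integrable half_line (\<lambda>r. (cmod (f r))\<^sup>2)}"

definition test_fun :: "(real \<Rightarrow> real) \<Rightarrow> bool" where
  "test_fun \<phi> \<longleftrightarrow> smooth_on UNIV \<phi> \<and>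
     (\<exists>a b. 0 < a \<and> a \<le> b \<and> (\<forall>x. x \<notin> {a..b} \<longrightarrow> \<phi> x = 0))"

definition L0_expr :: "(real \<Rightarrow> real) \<Rightarrow> real \<Rightarrow> real" where
  "L0_expr \<phi> r = - (1/2) * deriv (deriv \<phi>) r + (3 / (8 * (sinh r)\<^sup>2) + 1/8) * \<phi> r"

text \<open>
  The differential expression is formally self-adjoint with real coefficients, so
  \<open>L\<^sub>0 f = g\<close> in the sense of distributions on the open half-line means that \<open>g\<close> pairs with
  test functions as \<open>f\<close> does with their images. Real test functions suffice, by linearity.
\<close>

definition L0_distrib :: "(real \<Rightarrow> complex) \<Rightarrow> (real \<Rightarrow> complex) \<Rightarrow> bool" where
  "L0_distrib f g \<longleftrightarrow> (\<forall>\<phi>. test_fun \<phi> \<longrightarrow>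
     (LINT r|half_line. f r * of_real (L0_expr \<phi> r)) = (LINT r|half_line. g r * of_real (\<phi> r)))"

definition dom_L0 :: "(real \<Rightarrow> complex) set" where
  "dom_L0 = {f \<in> L2. \<exists>g\<in>L2. L0_distrib f g}"

text \<open>
  On \<^term>\<open>dom_L0\<close> the chosen representative is determined up to null sets; off it the value is
  arbitrary.
\<close>

definition opL0 :: "(real \<Rightarrow> complex) \<Rightarrow> real \<Rightarrow> complex" where
  "opL0 f = (SOME g. g \<in> L2 \<and> L0_distrib f g)"

definition opL1 :: "(real \<Rightarrow> real) \<Rightarrow> (real \<Rightarrow> complex) \<Rightarrow> real \<Rightarrow> complex" where
  "opL1 \<rho> f r = opL0 f r + of_real ((\<rho> r)\<^sup>2 - 1) * f r"

definition opL2 :: "(real \<Rightarrow> real) \<Rightarrow> (real \<Rightarrow> complex) \<Rightarrow> real \<Rightarrow> complex" where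
  "opL2 \<rho> f r = opL0 f r + of_real (3 * (\<rho> r)\<^sup>2 - 1) * f r"

type_synonym state = "(real \<Rightarrow> complex) \<times> (real \<Rightarrow> complex)"

definition L_GP :: "(real \<Rightarrow> real) \<Rightarrow> state \<Rightarrow> state" where
  "L_GP \<rho> u = (opL1 \<rho> (snd u), \<lambda>r. - opL2 \<rho> (fst u) r)"

definition dom_L_GP :: "state set" where
  "dom_L_GP = dom_L0 \<times> dom_L0"

definition scale_state :: "complex \<Rightarrow> state \<Rightarrow> state" where
  "scale_state c u = (\<lambda>r. c * fst u r, \<lambda>r. c * snd u r)"

definition state_eq :: "state \<Rightarrow> state \<Rightarrow> bool" where
  "state_eq u v \<longleftrightarrow> (AE r in half_line. fst u r = fst v r) \<and> (AE r in half_line. snd u r = snd v r)"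

definition is_eigenvalue :: "state set \<Rightarrow> (state \<Rightarrow> state) \<Rightarrow> complex \<Rightarrow> bool" where
  "is_eigenvalue D T z \<longleftrightarrow>
     (\<exists>u\<in>D. \<not> state_eq u (\<lambda>r. 0, \<lambda>r. 0) \<and> state_eq (T u) (scale_state z u))"

end

theory Submission
  imports Defs
begin

text \<open>
  For a real eigenvalue \<open>\<lambda>\<close> the real and imaginary parts of an eigenfunction reduce the problem to
  real square integrable solutions of \<open>u'' = (V + 4\<rho>\<^sup>2) u + 2\<mu> z\<close>, \<open>z'' = V z + 2\<mu> u\<close> with
  \<open>\<mu> = \<bar>\<lambda>\<bar>\<close>, where \<open>V\<close> is twice the potential of \<open>L\<^sub>1\<close>. At infinity the system splits
  into a part with exponents \<open>\<plusminus>\<surd>(9/4 + 2\<surd>(1 + \<mu>\<^sup>2))\<close> and a part that does not decay precisely when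
  \<open>\<mu> \<ge> \<surd>17/8\<close>. As \<open>1 - \<rho>\<close> decays exponentially, an \<open>L\<^sup>2\<close> solution is dominated by its decaying
  part, for which \<open>u\<close> and \<open>z\<close> have the same sign near infinity, say positive.

  The function \<open>f\<^sub>0 = \<surd>(sinh r) \<rho>\<close> is positive and satisfies \<open>f\<^sub>0'' = V f\<^sub>0\<close>. While \<open>u, z > 0\<close>, the
  Wronskians of \<open>f\<^sub>0\<close> with \<open>u\<close> and with \<open>z\<close> are increasing, and they are negative since \<open>u\<close> and \<open>z\<close>
  tend to \<open>0\<close>; so \<open>u / f\<^sub>0\<close> and \<open>z / f\<^sub>0\<close> increase towards the origin and positivity propagates to the
  whole half-line. The Wronskian of \<open>f\<^sub>0\<close> and \<open>z\<close> thus stays below a negative constant near \<open>0\<close>, and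
  since \<open>f\<^sub>0\<close> is comparable to \<open>r\<^bsup>3/2\<^esup>\<close> there, \<open>z\<close> is at least of order \<open>r\<^bsup>-1/2\<^esup>\<close>, which is not
  square integrable.
\<close>

section \<open>Maximum principle and uniqueness\<close>

text \<open>The number \<open>sqrt 17 / 8\<close> is where 9/4 - 2 sqrt(1 + \<mu>^2) changes sign,
  because (9/8)^2 = 1 + 17/64. At that endpoint the slow part at infinity has exponent 0, so an
  estimate that divides by its frequency \<kappa> would miss it. Tail integrals of the exponentially
  small error need no division and treat all \<kappa> \<ge> 0 alike. The domain carries no boundary
  condition at the origin, so the contradiction must come from square integrability near 0. There
  the potential 3/(4 r^2) has the exponents 3/2 and -1/2, and the square of the second, 1/r, just
  fails to be integrable. Only the equation, the sign and the limits of \<rho> are available. Its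
  strict positivity, the decay of 1 - \<rho> and the order r^(3/2) of \<open>f0\<close> at 0 are all
  derived, by uniqueness and by comparison with barriers. Elements of the domain solve their
  equation only in the sense of distributions. As the coefficients are continuous on the open
  half-line, integrating the right-hand side twice yields a continuous representative, and putting
  it back into the equation yields a classical solution.\<close>

lemma interior_max_second_deriv_nonpos:
  fixes g g' :: "real \<Rightarrow> real"
  assumes d: "0 < d" and max: "\<And>y. \<bar>y - x\<bar> < d \<Longrightarrow> g y \<le> g x"
    and g: "\<And>y. \<bar>y - x\<bar> < d \<Longrightarrow> (g has_real_derivative g' y) (at y)"
    and g': "(g' has_real_derivative gdd) (at x)"
  shows "g' x = 0" "gdd \<le> 0"
proof -
  show 0: "g' x = 0"
    by (rule DERIV_local_max[OF g[of x] d]) (use d max in \<open>auto simp: abs_minus_commute\<close>)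
  show "gdd \<le> 0"
  proof (rule ccontr)
    assume "\<not> gdd \<le> 0"
    then obtain e where e: "e > 0" "\<And>h. 0 < h \<Longrightarrow> h < e \<Longrightarrow> g' x < g' (x + h)"
      using DERIV_pos_inc_right[OF g'] by auto
    define h where "h = min d e / 2"
    have h: "0 < h" "h < d" "h < e" using d e(1) by (auto simp: h_def)
    obtain z where z: "x < z" "z < x + h" "g (x + h) - g x = (x + h - x) * g' z"
      using MVT2[of x "x + h" g g'] g h by auto
    have "g' z > 0" using e(2)[of "z - x"] z h 0 by auto
    then have "g (x + h) > g x" using z(3) h by (smt (verit) mult_pos_pos)
    moreover have "g (x + h) \<le> g x" using max[of "x + h"] h by simp
    ultimately show False by simp
  qed
qed

text \<open>A positive interior maximum is a critical point with nonpositive second derivative,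
  against \<open>pos\<close>. Asking for \<open>pos\<close> only at critical points lets an
  application replace the first derivative of the unknown by that of the barrier, which handles
  equations with a first-order term.\<close>

lemma maximum_principle:
  fixes g g' gdd :: "real \<Rightarrow> real"
  assumes cont: "continuous_on {a..b} g"
    and g: "\<And>x. a < x \<Longrightarrow> x < b \<Longrightarrow> (g has_real_derivative g' x) (at x)"
    and g': "\<And>x. a < x \<Longrightarrow> x < b \<Longrightarrow> (g' has_real_derivative gdd x) (at x)"
    and pos: "\<And>x. a < x \<Longrightarrow> x < b \<Longrightarrow> g x > 0 \<Longrightarrow> g' x = 0 \<Longrightarrow> gdd x > 0"
    and x: "x \<in> {a..b}" and M: "0 \<le> M" "g a \<le> M" "g b \<le> M"
  shows "g x \<le> M"
proof (rule ccontr)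
  assume n: "\<not> g x \<le> M"
  obtain m where m: "m \<in> {a..b}" "\<And>y. y \<in> {a..b} \<Longrightarrow> g y \<le> g m"
    using continuous_attains_sup[of "{a..b}" g] cont x by force
  have gm: "g m > M" using m(2)[OF x] n by simp
  have ab: "a < m" "m < b" using m(1) gm M by (auto simp: less_le)
  define d where "d = min (m - a) (b - m)"
  have d: "0 < d" "\<And>y. \<bar>y - m\<bar> < d \<Longrightarrow> a < y \<and> y < b"
    using ab by (auto simp: d_def)
  have "g' m = 0" "gdd m \<le> 0"
    by (rule interior_max_second_deriv_nonpos[of d m g g' "gdd m"];
        use d m(2) g g' ab in force)+
  then show False using pos[OF ab] gm M by simp
qed

text \<open>The limit supplies the missing right endpoint: far out the values drop below a
  supposedly positive \<open>g x\<close>, so on a compact interval \<open>g x\<close> would exceed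
  both boundary values.\<close>

lemma maximum_principle_at_top:
  fixes g g' gdd :: "real \<Rightarrow> real"
  assumes g: "\<And>x. R \<le> x \<Longrightarrow> (g has_real_derivative g' x) (at x)"
    and g': "\<And>x. R \<le> x \<Longrightarrow> (g' has_real_derivative gdd x) (at x)"
    and pos: "\<And>x. R < x \<Longrightarrow> g x > 0 \<Longrightarrow> g' x = 0 \<Longrightarrow> gdd x > 0"
    and R: "g R \<le> 0" and lim: "(g \<longlongrightarrow> 0) at_top" and x: "R \<le> x"
  shows "g x \<le> 0"
proof (rule ccontr)
  assume n: "\<not> g x \<le> 0"
  have "eventually (\<lambda>y. g y < g x) at_top"
    using lim n by (intro order_tendstoD(2)) auto
  then obtain b0 where b0: "\<And>y. y \<ge> b0 \<Longrightarrow> g y < g x" unfolding eventually_at_top_linorder by blast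
  define b where "b = max b0 (x + 1)"
  have "continuous_on {R..b} g"
    using g by (intro DERIV_continuous_on[where D = g']) (auto intro: has_field_derivative_at_within)
  then have "g x \<le> max 0 (g b)"
    by (rule maximum_principle[where g' = g' and gdd = gdd]) (use g g' pos R x in \<open>auto simp: b_def\<close>)
  moreover have "g b < g x" using b0 by (simp add: b_def)
  ultimately show False using n by auto
qed

lemma maximum_principle_at_0:
  fixes g g' gdd :: "real \<Rightarrow> real"
  assumes g: "\<And>x. 0 < x \<Longrightarrow> (g has_real_derivative g' x) (at x)"
    and g': "\<And>x. 0 < x \<Longrightarrow> (g' has_real_derivative gdd x) (at x)"
    and pos: "\<And>x. 0 < x \<Longrightarrow> x < R \<Longrightarrow> g x > 0 \<Longrightarrow> g' x = 0 \<Longrightarrow> gdd x > 0"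
    and R: "g R \<le> 0" and lim: "(g \<longlongrightarrow> 0) (at_right 0)" and x: "0 < x" "x \<le> R"
  shows "g x \<le> 0"
proof (rule ccontr)
  assume n: "\<not> g x \<le> 0"
  have "eventually (\<lambda>y. g y < g x) (at_right 0)"
    using lim n by (intro order_tendstoD(2)) auto
  then obtain b0 where b0: "b0 > 0" "\<And>y. 0 < y \<Longrightarrow> y < b0 \<Longrightarrow> g y < g x"
    unfolding eventually_at_right_field by blast
  define b where "b = min b0 x / 2"
  have b: "0 < b" "b < b0" "b < x" using b0 x by (auto simp: b_def)
  have "continuous_on {b..R} g"
    using g b by (intro DERIV_continuous_on[where D = g']) (auto intro: has_field_derivative_at_within)
  then have "g x \<le> max 0 (g b)"
    by (rule maximum_principle[where g' = g' and gdd = gdd]) (use g g' pos R x b in auto)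
  moreover have "g b < g x" using b0 b by simp
  ultimately show False using n by auto
qed

text \<open>Gronwall's argument for the energy \<open>N\<close>. The coefficients are bounded on the
  compact interval between \<open>x0\<close> and \<open>x\<close>, so the derivative of
  \<open>N\<close> is at most \<open>L * N\<close> in absolute value. The exponential weight is then
  chosen according to the side of \<open>x0\<close> on which \<open>x\<close> lies.\<close>

lemma linear_system_unique:
  fixes y y' z z' a b c d :: "real \<Rightarrow> real"
  assumes der: "\<And>x. 0 < x \<Longrightarrow> (y has_real_derivative y' x) (at x)"
      "\<And>x. 0 < x \<Longrightarrow> (y' has_real_derivative a x * y x + b x * z x) (at x)"
      "\<And>x. 0 < x \<Longrightarrow> (z has_real_derivative z' x) (at x)"
      "\<And>x. 0 < x \<Longrightarrow> (z' has_real_derivative c x * y x + d x * z x) (at x)"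
    and cont: "continuous_on {0<..} a" "continuous_on {0<..} b" "continuous_on {0<..} c"
      "continuous_on {0<..} d"
    and x0: "0 < x0" "y x0 = 0" "y' x0 = 0" "z x0 = 0" "z' x0 = 0" and x: "0 < x"
  shows "y x = 0 \<and> z x = 0"
proof -
  define p q where "p = min x x0" and "q = max x x0"
  have pq: "0 < p" "p \<le> x" "x \<le> q" "p \<le> x0" "x0 \<le> q" using x x0 by (auto simp: p_def q_def)
  have "\<exists>B. \<forall>t\<in>{p..q}. \<bar>f t\<bar> \<le> B" if "continuous_on {0<..} f" for f :: "real \<Rightarrow> real"
  proof -
    have "continuous_on {p..q} f" using that pq by (auto elim: continuous_on_subset)
    then have "bounded (f ` {p..q})" by (intro compact_imp_bounded compact_continuous_image) auto
    then show ?thesis unfolding bounded_iff by auto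
  qed
  then obtain A B C D where bd: "\<And>t. t\<in>{p..q} \<Longrightarrow> \<bar>a t\<bar> \<le> A" "\<And>t. t\<in>{p..q} \<Longrightarrow> \<bar>b t\<bar> \<le> B"
    "\<And>t. t\<in>{p..q} \<Longrightarrow> \<bar>c t\<bar> \<le> C" "\<And>t. t\<in>{p..q} \<Longrightarrow> \<bar>d t\<bar> \<le> D"
    using cont by metis
  define N where "N t = (y t)\<^sup>2 + (y' t)\<^sup>2 + (z t)\<^sup>2 + (z' t)\<^sup>2" for t
  define N' where "N' t = 2 * y t * y' t + 2 * y' t * (a t * y t + b t * z t)
    + 2 * z t * z' t + 2 * z' t * (c t * y t + d t * z t)" for t
  define L where "L = 2 + A + B + C + D"
  have dN: "(N has_real_derivative N' t) (at t)" if "0 < t" for t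
    unfolding N_def N'_def using der[OF that]
    by (auto intro!: derivative_eq_intros simp: algebra_simps)
  have N'b: "\<bar>N' t\<bar> \<le> L * N t" if t: "t \<in> {p..q}" for t
  proof -
    have e: "\<bar>2 * u * v\<bar> \<le> N t" if "u\<^sup>2 + v\<^sup>2 \<le> N t" for u v
      using that sum_squares_bound[of u v] sum_squares_bound[of u "- v"] by auto
    have e2: "\<bar>2 * u * (k * v)\<bar> \<le> K * N t" if "u\<^sup>2 + v\<^sup>2 \<le> N t" "\<bar>k\<bar> \<le> K" for u v k K
    proof -
      have "\<bar>2 * u * (k * v)\<bar> = \<bar>k\<bar> * \<bar>2 * u * v\<bar>" by (simp add: abs_mult)
      also have "\<dots> \<le> K * N t" using e[OF that(1)] that(2) by (intro mult_mono) auto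
      finally show ?thesis .
    qed
    have "\<bar>2 * y t * y' t\<bar> \<le> N t" "\<bar>2 * z t * z' t\<bar> \<le> N t"
      by (rule e; simp add: N_def)+
    moreover have "\<bar>2 * y' t * (a t * y t)\<bar> \<le> A * N t" "\<bar>2 * y' t * (b t * z t)\<bar> \<le> B * N t"
      "\<bar>2 * z' t * (c t * y t)\<bar> \<le> C * N t" "\<bar>2 * z' t * (d t * z t)\<bar> \<le> D * N t"
      by (rule e2; use bd[OF t] in \<open>simp add: N_def\<close>)+
    moreover have "N' t = 2 * y t * y' t + 2 * z t * z' t + 2 * y' t * (a t * y t) + 2 * y' t * (b t * z t)
       + 2 * z' t * (c t * y t) + 2 * z' t * (d t * z t)"
      by (simp add: N'_def algebra_simps)
    ultimately show ?thesis unfolding L_def distrib_right by linarith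
  qed
  have N0: "N x0 = 0" using x0 by (simp add: N_def)
  have Nn: "N t \<ge> 0" for t by (simp add: N_def)
  have "N x \<le> 0"
  proof (cases "x0 \<le> x")
    case True
    have "N x * exp (- L * x) \<le> N x0 * exp (- L * x0)"
    proof (rule DERIV_nonpos_imp_nonincreasing[OF True])
      fix t assume t: "x0 \<le> t" "t \<le> x"
      have "((\<lambda>t. N t * exp (- L * t)) has_real_derivative (N' t - L * N t) * exp (- L * t)) (at t)"
        using dN[of t] t x0 by (auto intro!: derivative_eq_intros simp: algebra_simps)
      moreover have "(N' t - L * N t) * exp (- L * t) \<le> 0"
        using N'b[of t] t pq by (intro mult_nonpos_nonneg) auto
      ultimately show "\<exists>D. ((\<lambda>t. N t * exp (- L * t)) has_real_derivative D) (at t) \<and> D \<le> 0" by blast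
    qed
    then show ?thesis using N0 by (simp add: mult_le_0_iff)
  next
    case False
    then have "x \<le> x0" by simp
    then have "N x * exp (L * x) \<le> N x0 * exp (L * x0)"
    proof (rule DERIV_nonneg_imp_nondecreasing)
      fix t assume t: "x \<le> t" "t \<le> x0"
      have "((\<lambda>t. N t * exp (L * t)) has_real_derivative (N' t + L * N t) * exp (L * t)) (at t)"
        using dN[of t] t x by (auto intro!: derivative_eq_intros simp: algebra_simps)
      moreover have "0 \<le> (N' t + L * N t) * exp (L * t)"
        using N'b[of t] t pq by (intro mult_nonneg_nonneg) auto
      ultimately show "\<exists>D. ((\<lambda>t. N t * exp (L * t)) has_real_derivative D) (at t) \<and> 0 \<le> D" by blast
    qed
    then show ?thesis using N0 by (simp add: mult_le_0_iff)
  qed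
  then have "(y x)\<^sup>2 + (y' x)\<^sup>2 + (z x)\<^sup>2 + (z' x)\<^sup>2 \<le> 0" by (simp add: N_def)
  then have "(y x)\<^sup>2 = 0" "(z x)\<^sup>2 = 0"
    by (smt (verit) zero_le_power2)+
  then show ?thesis by simp
qed

section \<open>Elementary bounds for sinh and exp\<close>

lemma sinh_ge_exp: "exp r / 4 \<le> sinh r" if "r \<ge> 1" for r :: real
proof -
  have "exp (- r) \<le> 1" using that by simp
  moreover have "exp r \<ge> 1 + r" by (rule exp_ge_add_one_self)
  ultimately have "2 * exp (- r) \<le> exp r" using that by linarith
  then show ?thesis unfolding sinh_field_def by simp
qed

lemma sinh_ge_self: "r \<le> sinh r" if "r \<ge> 0" for r :: real
proof -
  have "sinh 0 - 0 \<le> sinh r - r"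
  proof (rule DERIV_nonneg_imp_nondecreasing[OF that])
    fix t :: real
    show "\<exists>y. ((\<lambda>t. sinh t - t) has_real_derivative y) (at t) \<and> 0 \<le> y"
      using cosh_real_ge_1[of t] by (intro exI[of _ "cosh t - 1"]) (auto intro!: derivative_eq_intros)
  qed
  then show ?thesis by simp
qed

lemma exp_minus_tendsto_0: "((\<lambda>r::real. C * exp (- r)) \<longlongrightarrow> 0) at_top"
proof -
  have "((\<lambda>r::real. C * exp (- r)) \<longlongrightarrow> C * 0) at_top"
    by (intro tendsto_mult tendsto_const filterlim_compose[OF exp_at_bot filterlim_uminus_at_bot_at_top])
  then show ?thesis by simp
qed

section \<open>The vortex profile\<close>

locale vortex =
  fixes \<rho> :: "real \<Rightarrow> real"
  assumes profile: "vortex_profile \<rho>"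
begin

lemma deriv_rho: "r > 0 \<Longrightarrow> (\<rho> has_real_derivative deriv \<rho> r) (at r)"
  using profile unfolding vortex_profile_def smooth_on_def
  by (metis field_differentiable_derivI funpow_0 greaterThan_iff)

lemma deriv2_rho: "r > 0 \<Longrightarrow> (deriv \<rho> has_real_derivative deriv (deriv \<rho>) r) (at r)"
proof -
  assume "r > 0"
  then have "(deriv ^^ 1) \<rho> field_differentiable at r"
    using profile unfolding vortex_profile_def smooth_on_def by blast
  then show ?thesis by (simp add: field_differentiable_derivI)
qed

lemma rho_ode:
  assumes "r > 0"
  shows "deriv (deriv \<rho>) r = - (cosh r / sinh r) * deriv \<rho> r + \<rho> r / (sinh r)\<^sup>2 - 2 * \<rho> r + 2 * \<rho> r ^ 3"
proof -
  have "1/2 * deriv (deriv \<rho>) r + 1/2 * (cosh r / sinh r) * deriv \<rho> r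
     - 1 / (2 * (sinh r)\<^sup>2) * \<rho> r + \<rho> r - (\<rho> r) ^ 3 = 0"
    using profile assms unfolding vortex_profile_def by blast
  moreover have "1 / (2 * (sinh r)\<^sup>2) * \<rho> r = (\<rho> r / (sinh r)\<^sup>2) / 2" by simp
  ultimately show ?thesis by linarith
qed

lemma rho_nonneg: "r > 0 \<Longrightarrow> \<rho> r \<ge> 0"
  and rho_at_0: "(\<rho> \<longlongrightarrow> 0) (at_right 0)"
  and rho_at_top: "(\<rho> \<longlongrightarrow> 1) at_top"
  using profile unfolding vortex_profile_def by auto

lemma rho_continuous: "continuous_on {0<..} \<rho>"
  using deriv_rho by (intro DERIV_continuous_on[where D = "deriv \<rho>"]) (auto intro: has_field_derivative_at_within)

lemma coth_gt_1: "r > 0 \<Longrightarrow> cosh r / sinh r > (1::real)"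
  by (simp add: sinh_less_cosh_real)

text \<open>The barrier b = C exp(-r) satisfies b'' + b' = 0. Hence at a critical point of the
  difference the first-order term, whose coefficient exceeds 1, leaves a positive surplus, and the
  cubic term has the favourable sign on either side of 1. The profile is not yet known to stay below
  1, so 1 - \<rho> and \<rho> - 1 are both compared with b.\<close>

lemma rho_decay:
  obtains C where "C \<ge> 0" "\<And>r. r \<ge> 1 \<Longrightarrow> \<bar>1 - \<rho> r\<bar> \<le> C * exp (- r)"
proof -
  \<comment> \<open>The 8 is for the term \<rho> / sinh^2: where 1 - \<rho> exceeds the barrier,
    \<open>1 / (sinh x)\<^sup>2\<close>, which is at most \<open>16 * exp (- x)\<close>, is
    dominated by \<open>2 * (1 - \<rho> x)\<close>. The other entry gives the boundary inequality at
    1.\<close>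
  define C where "C = max 8 (exp 1 * \<bar>1 - \<rho> 1\<bar>)"
  have C8: "C \<ge> 8" by (simp add: C_def)
  have "exp 1 * \<bar>1 - \<rho> 1\<bar> \<le> C" by (simp add: C_def)
  then have C1: "\<bar>1 - \<rho> 1\<bar> \<le> C * exp (- 1)" by (simp add: exp_minus field_simps)
  have lim: "((\<lambda>r. 1 - \<rho> r) \<longlongrightarrow> 0) at_top"
    using tendsto_diff[OF tendsto_const rho_at_top, of 1] by simp
  have up: "(1 - \<rho> r) - C * exp (- r) \<le> 0" if "r \<ge> 1" for r
  proof (rule maximum_principle_at_top[where R = 1 and g = "\<lambda>r. (1 - \<rho> r) - C * exp (- r)"
        and g' = "\<lambda>r. - deriv \<rho> r + C * exp (- r)"
        and gdd = "\<lambda>r. - deriv (deriv \<rho>) r - C * exp (- r)"])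
    fix x :: real assume x: "1 < x" and g: "(1 - \<rho> x) - C * exp (- x) > 0"
      and g': "- deriv \<rho> x + C * exp (- x) = 0"
    have x0: "x > 0" using x by simp
    define s where "s = sinh x"
    have s: "s \<ge> exp x / 4" "s > 0" using sinh_ge_exp[of x] x by (auto simp: s_def)
    have "1 / s \<le> 4 * exp (- x)" using s by (simp add: exp_minus field_simps)
    then have "(1 / s)\<^sup>2 \<le> (4 * exp (- x))\<^sup>2" using s by (intro power_mono) auto
    also have "\<dots> = 16 * (exp (- x) * exp (- x))" by (simp add: power2_eq_square)
    also have "\<dots> \<le> 16 * (1 * exp (- x))" using x by (intro mult_left_mono mult_right_mono) auto
    finally have s2: "1 / s\<^sup>2 \<le> 16 * exp (- x)" by (simp add: power_divide)
    have "8 * exp (- x) \<le> C * exp (- x)" using C8 by (intro mult_right_mono) auto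
    then have "8 * exp (- x) < 1 - \<rho> x" by (rule order_le_less_trans[of _ "C * exp (- x)"]) (use g in simp)
    then have "2 * (8 * exp (- x)) \<le> 2 * (1 - \<rho> x)" by (intro mult_left_mono less_imp_le) auto
    moreover have "1 / s\<^sup>2 \<le> 2 * (8 * exp (- x))" using s2 by simp
    ultimately have s3: "1 / s\<^sup>2 \<le> 2 * (1 - \<rho> x)" by (meson order_trans)
    have r0: "\<rho> x \<ge> 0" using rho_nonneg x by simp
    have eg: "0 \<le> 1 - \<rho> x" using g C8 by (smt (verit) exp_gt_zero mult_nonneg_nonneg)
    have "2 * (1 - \<rho> x) * 1 \<le> 2 * (1 - \<rho> x) * (1 + \<rho> x)"
      using eg r0 by (intro mult_left_mono) auto
    then have "2 * (1 - \<rho> x) \<le> 2 * (1 - \<rho> x) * (1 + \<rho> x)" by simp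
    then have "\<rho> x * (2 * (1 - \<rho> x) * (1 + \<rho> x) - 1 / s\<^sup>2) \<ge> 0"
      using s3 r0 by (intro mult_nonneg_nonneg) auto
    moreover have "C * exp (- x) * (cosh x / sinh x - 1) > 0"
      using C8 coth_gt_1[OF x0] by (intro mult_pos_pos) auto
    moreover have "deriv \<rho> x = C * exp (- x)" using g' by simp
    ultimately show "- deriv (deriv \<rho>) x - C * exp (- x) > 0"
      using rho_ode[OF x0] unfolding s_def
      by (simp add: algebra_simps power3_eq_cube power2_eq_square)
  next
    show "((\<lambda>r. 1 - \<rho> r - C * exp (- r)) \<longlongrightarrow> 0) at_top"
      using tendsto_diff[OF lim exp_minus_tendsto_0[of C]] by simp
  qed (use C1 that deriv_rho deriv2_rho in \<open>auto intro!: derivative_eq_intros\<close>)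
  have lo: "(\<rho> r - 1) - C * exp (- r) \<le> 0" if "r \<ge> 1" for r
  proof (rule maximum_principle_at_top[where R = 1 and g = "\<lambda>r. (\<rho> r - 1) - C * exp (- r)"
        and g' = "\<lambda>r. deriv \<rho> r + C * exp (- r)"
        and gdd = "\<lambda>r. deriv (deriv \<rho>) r - C * exp (- r)"])
    fix x :: real assume x: "1 < x" and g: "(\<rho> x - 1) - C * exp (- x) > 0"
      and g': "deriv \<rho> x + C * exp (- x) = 0"
    have x0: "x > 0" using x by simp
    have r1: "\<rho> x > 1" using g C8 by (smt (verit) exp_gt_zero mult_nonneg_nonneg)
    then have "2 * \<rho> x * ((\<rho> x)\<^sup>2 - 1) > 0" by (intro mult_pos_pos) (auto simp: one_less_power)
    moreover have "C * exp (- x) * (cosh x / sinh x - 1) > 0"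
      using C8 coth_gt_1[OF x0] by (intro mult_pos_pos) auto
    moreover have "\<rho> x / (sinh x)\<^sup>2 \<ge> 0" using r1 by simp
    moreover have "deriv \<rho> x = - (C * exp (- x))" using g' by simp
    ultimately show "deriv (deriv \<rho>) x - C * exp (- x) > 0"
      using rho_ode[OF x0]
      by (simp add: algebra_simps power3_eq_cube power2_eq_square)
  next
    have "((\<lambda>r. - (1 - \<rho> r) - C * exp (- r)) \<longlongrightarrow> - 0 - 0) at_top"
      by (intro tendsto_diff tendsto_minus lim exp_minus_tendsto_0)
    then show "((\<lambda>r. \<rho> r - 1 - C * exp (- r)) \<longlongrightarrow> 0) at_top" by simp
  qed (use C1 that deriv_rho deriv2_rho in \<open>auto intro!: derivative_eq_intros\<close>)
  have "\<bar>1 - \<rho> r\<bar> \<le> C * exp (- r)" if "r \<ge> 1" for r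
    using up[OF that] lo[OF that] by (simp add: abs_le_iff)
  with C8 show thesis by (intro that[of C]) auto
qed

text \<open>
  Twice the potential of \<open>L\<^sub>1\<close>; that of \<open>L\<^sub>2\<close> is \<open>V + 4\<rho>\<^sup>2\<close>. The substitution
  \<open>f\<^sub>0 = \<surd>(sinh r) \<rho>\<close> removes the first-order term of the profile equation.
\<close>

definition V :: "real \<Rightarrow> real" where
  "V r = 3 / (4 * (sinh r)\<^sup>2) - 7/4 + 2 * (\<rho> r)\<^sup>2"

definition f0 :: "real \<Rightarrow> real" where
  "f0 r = sqrt (sinh r) * \<rho> r"

definition f0' :: "real \<Rightarrow> real" where
  "f0' r = cosh r / (2 * sqrt (sinh r)) * \<rho> r + sqrt (sinh r) * deriv \<rho> r"

lemma V_continuous: "continuous_on {0<..} V"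
  unfolding V_def by (intro continuous_intros rho_continuous) auto

lemma deriv_sqrt_sinh:
  assumes "r > 0"
  shows "((\<lambda>r. sqrt (sinh r)) has_real_derivative cosh r / (2 * sqrt (sinh r))) (at r)"
  using assms by (auto intro!: derivative_eq_intros simp: field_simps)

lemma deriv_f0: "r > 0 \<Longrightarrow> (f0 has_real_derivative f0' r) (at r)"
  unfolding f0_def f0'_def
  by (rule DERIV_cong[OF DERIV_mult[OF deriv_sqrt_sinh deriv_rho]]) auto

lemma deriv_f0': 
  assumes r: "r > 0"
  shows "(f0' has_real_derivative V r * f0 r) (at r)"
proof -
  define q where "q = sqrt (sinh r)"
  have q0: "q > 0" using r by (simp add: q_def)
  have q2: "sinh r = q\<^sup>2" using r by (simp add: q_def)
  have c2: "cosh r * cosh r = 1 + q ^ 4"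
    using cosh_square_eq[of r] q2 by (simp add: power2_eq_square power4_eq_xxxx)
  let ?D = "((sinh r * (2 * q) - cosh r * (2 * (cosh r / (2 * q)))) / ((2 * q) * (2 * q))) * \<rho> r
     + cosh r / (2 * q) * deriv \<rho> r + (cosh r / (2 * q) * deriv \<rho> r + q * deriv (deriv \<rho>) r)"
  have "(f0' has_real_derivative ?D) (at r)"
    unfolding f0'_def
    by (rule derivative_eq_intros refl deriv_sqrt_sinh deriv_rho deriv2_rho r
       | (use r in \<open>simp add: q_def\<close>; fail))+
  moreover have "?D = V r * f0 r"
  proof -
    have "?D = \<rho> r * ((q\<^sup>2 * (2 * q) - cosh r * cosh r / q) / (4 * q\<^sup>2)) + (cosh r / q) * deriv \<rho> r
       + q * (- (cosh r / q\<^sup>2) * deriv \<rho> r + \<rho> r / (q\<^sup>2)\<^sup>2 - 2 * \<rho> r + 2 * \<rho> r ^ 3)"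
      unfolding rho_ode[OF r] q2 using q0 by (simp add: field_simps power2_eq_square)
    also have "\<dots> = \<rho> r * ((q\<^sup>2 * (2 * q) - (1 + q ^ 4) / q) / (4 * q\<^sup>2))
       + q * (\<rho> r / (q\<^sup>2)\<^sup>2 - 2 * \<rho> r + 2 * \<rho> r ^ 3)"
      unfolding c2 using q0 by (simp add: field_simps power2_eq_square)
    also have "\<dots> = (3 / (4 * (q\<^sup>2)\<^sup>2) - 7/4 + 2 * (\<rho> r)\<^sup>2) * (q * \<rho> r)"
      using q0 by (simp add: field_simps power2_eq_square power3_eq_cube power4_eq_xxxx)
    finally show ?thesis unfolding V_def f0_def q2 using q0 by (simp add: q_def[symmetric])
  qed
  ultimately show ?thesis by simp
qed

text \<open>A zero of the nonnegative \<open>f0\<close> is a minimum, so \<open>f0'\<close> vanishes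
  there too. Uniqueness for the linear equation, used as a system with trivial second component,
  then makes \<rho> identically zero, against its limit 1.\<close>

lemma f0_pos:
  assumes r: "r > 0"
  shows "f0 r > 0"
proof (rule ccontr)
  assume "\<not> f0 r > 0"
  moreover have nn: "f0 t \<ge> 0" if "t > 0" for t using rho_nonneg[OF that] that by (simp add: f0_def)
  ultimately have z: "f0 r = 0" using r by force
  have "f0' r = 0"
    by (rule DERIV_local_min[OF deriv_f0[OF r] r]) (use nn z in auto)
  then have "f0 x = 0 \<and> (0::real) = 0" if "x > 0" for x
    using that deriv_f0 deriv_f0' z r V_continuous
    by (intro linear_system_unique[of f0 f0' V "\<lambda>_. 0" "\<lambda>_. 0" "\<lambda>_. 0" "\<lambda>_. 0" "\<lambda>_. 0" r x]) auto
  then have "\<rho> x = 0" if "x > 0" for x using that by (fastforce simp: f0_def)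
  then have "eventually (\<lambda>x. \<rho> x = 0) at_top"
    unfolding eventually_at_top_dense by blast
  then have "(\<rho> \<longlongrightarrow> 0) at_top" by (rule tendsto_eventually)
  then show False using rho_at_top tendsto_unique[of at_top \<rho> 0 1] by simp
qed

lemma f0_at_top: "eventually (\<lambda>r. f0 r \<ge> 1/2) at_top"
proof -
  have "eventually (\<lambda>r. \<rho> r > 1/2) at_top"
    using rho_at_top by (rule order_tendstoD) simp
  moreover have "eventually (\<lambda>r. r \<ge> (1::real)) at_top" by (rule eventually_ge_at_top)
  ultimately show ?thesis
  proof eventually_elim
    case (elim r)
    have "sinh r \<ge> 1" using sinh_ge_self[of r] elim by simp
    then have "sqrt (sinh r) \<ge> 1" by simp
    then have "1 * (1/2) \<le> sqrt (sinh r) * \<rho> r" using elim by (intro mult_mono) auto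
    then show ?case by (simp add: f0_def)
  qed
qed

lemma f0_at_0: "(f0 \<longlongrightarrow> 0) (at_right 0)"
proof -
  have "((\<lambda>r. sqrt (sinh r) * \<rho> r) \<longlongrightarrow> sqrt (sinh 0) * 0) (at_right 0)"
    by (intro tendsto_intros rho_at_0)
  then show ?thesis by (simp add: f0_def[abs_def])
qed

text \<open>
  The barriers are \<open>r\<^bsup>3/2\<^esup>\<close> from below and \<open>r\<^bsup>3/2\<^esup> (1 - r)\<close> from above, a sub- and a
  supersolution because \<open>3/(4r\<^sup>2) - 5/2 \<le> V \<le> 3/(4r\<^sup>2)\<close> near \<open>0\<close>.
\<close>

lemma f0_near_0:
  obtains r0 \<alpha> A where "0 < r0" "0 < \<alpha>" "0 < A"
    "\<And>r. 0 < r \<Longrightarrow> r \<le> r0 \<Longrightarrow> \<alpha> * (r * sqrt r) \<le> f0 r"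
    "\<And>r. 0 < r \<Longrightarrow> r \<le> r0 \<Longrightarrow> f0 r \<le> A * (r * sqrt r)"
proof -
  have "eventually (\<lambda>r. \<rho> r < 1/2) (at_right 0)"
    using rho_at_0 by (rule order_tendstoD) simp
  then obtain \<delta> where \<delta>: "\<delta> > 0" "\<And>r. 0 < r \<Longrightarrow> r < \<delta> \<Longrightarrow> \<rho> r < 1/2"
    unfolding eventually_at_right_field by blast
  \<comment> \<open>Below \<delta> the term 2 \<rho>^2 is at most 1/2, less than the 7/4 subtracted
    in \<open>V\<close>. The bound 1/2 keeps both 1 - r and the lower bound \<open>k\<close> of the
    potential positive.\<close>
  define r0 where "r0 = min (\<delta> / 2) (1/2)"
  have r0: "0 < r0" "r0 < \<delta>" "r0 \<le> 1/2" using \<delta>(1) by (auto simp: r0_def)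
  \<comment> \<open>From tanh r \<le> r one gets 1/r^2 \<le> 1/sinh^2 r + 1, so replacing sinh r by
    r costs 3/4 on top of the 7/4 in \<open>V\<close>.\<close>
  have Vlo: "V r \<ge> 3 / (4 * r\<^sup>2) - 5/2" if r: "0 < r" for r
  proof -
    have "sinh r \<le> r * cosh r"
    proof -
      have "r * cosh r - sinh r \<ge> 0 * cosh 0 - sinh (0::real)"
      proof (rule DERIV_nonneg_imp_nondecreasing[of 0 r "\<lambda>r. r * cosh r - sinh r"])
        fix t :: real assume "0 \<le> t" "t \<le> r"
        then show "\<exists>y. ((\<lambda>r. r * cosh r - sinh r) has_real_derivative y) (at t) \<and> 0 \<le> y"
          by (intro exI[of _ "t * sinh t"]) (auto intro!: derivative_eq_intros)
      qed (use r in auto)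
      then show ?thesis by simp
    qed
    then have "(sinh r)\<^sup>2 \<le> (r * cosh r)\<^sup>2" using r by (intro power_mono) auto
    also have "\<dots> = r\<^sup>2 + r\<^sup>2 * (sinh r)\<^sup>2"
      by (simp add: power_mult_distrib cosh_square_eq algebra_simps)
    finally have "1 / r\<^sup>2 \<le> 1 / (sinh r)\<^sup>2 + 1" using r by (simp add: field_simps)
    then have "3/4 * (1 / r\<^sup>2) \<le> 3/4 * (1 / (sinh r)\<^sup>2 + 1)" by simp
    then have "3 / (4 * r\<^sup>2) \<le> 3 / (4 * (sinh r)\<^sup>2) + 3/4" by simp
    then show ?thesis unfolding V_def using zero_le_power2[of "\<rho> r"] by linarith
  qed
  have Vhi: "V r \<le> 3 / (4 * r\<^sup>2)" if r: "0 < r" "r \<le> r0" for r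
  proof -
    have "r\<^sup>2 \<le> (sinh r)\<^sup>2" using sinh_ge_self[of r] r by (intro power_mono) auto
    then have "3 / (4 * (sinh r)\<^sup>2) \<le> 3 / (4 * r\<^sup>2)" using r by (intro divide_left_mono) auto
    moreover have "(\<rho> r)\<^sup>2 \<le> (1/2)\<^sup>2"
      using \<delta>(2)[of r] rho_nonneg[of r] r r0 by (intro power_mono) auto
    ultimately show ?thesis unfolding V_def by (simp add: power2_eq_square)
  qed
  have d1: "((\<lambda>r. r * sqrt r) has_real_derivative 3/2 * sqrt r) (at r)" if "r > 0" for r
    using that by (auto intro!: derivative_eq_intros simp: field_simps)
  have d2: "(sqrt has_real_derivative 1 / (2 * sqrt r)) (at r)" if "r > 0" for r
    using that by (auto intro!: derivative_eq_intros simp: field_simps)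
  have l1: "((\<lambda>r. r * sqrt r) \<longlongrightarrow> 0) (at_right 0)"
    by (rule tendsto_eq_intros refl)+ simp
  define \<alpha> where "\<alpha> = f0 r0 / (r0 * sqrt r0)"
  have \<alpha>0: "\<alpha> > 0" using f0_pos[OF r0(1)] r0 by (simp add: \<alpha>_def)
  have \<alpha>R: "\<alpha> * (r0 * sqrt r0) - f0 r0 \<le> 0" using r0 by (simp add: \<alpha>_def)
  have lower: "\<alpha> * (r * sqrt r) - f0 r \<le> 0" if r: "0 < r" "r \<le> r0" for r
  proof (rule maximum_principle_at_0[where R = r0 and g = "\<lambda>r. \<alpha> * (r * sqrt r) - f0 r"
        and g' = "\<lambda>r. \<alpha> * (3/2 * sqrt r) - f0' r"
        and gdd = "\<lambda>r. \<alpha> * (3/2 * (1 / (2 * sqrt r))) - V r * f0 r"])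
    show "((\<lambda>r. \<alpha> * (r * sqrt r) - f0 r) \<longlongrightarrow> 0) (at_right 0)"
      using tendsto_diff[OF tendsto_mult[OF tendsto_const l1] f0_at_0, of \<alpha>] by simp
    fix x assume x: "0 < x" "x < r0" and g: "0 < \<alpha> * (x * sqrt x) - f0 x"
    have "V x * f0 x \<le> 3 / (4 * x\<^sup>2) * f0 x"
      using Vhi[of x] x f0_pos[of x] by (intro mult_right_mono) auto
    also have "\<dots> < 3 / (4 * x\<^sup>2) * (\<alpha> * (x * sqrt x))"
      using g x by (intro mult_strict_left_mono) auto
    also have "\<dots> = \<alpha> * (3/2 * (1 / (2 * sqrt x)))"
    proof -
      have "x = sqrt x * sqrt x" using x by simp
      then show ?thesis using x by (simp add: field_simps power2_eq_square) 
    qed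
    finally show "0 < \<alpha> * (3/2 * (1 / (2 * sqrt x))) - V x * f0 x" by simp
  next
    show "((\<lambda>r. \<alpha> * (r * sqrt r) - f0 r) has_real_derivative \<alpha> * (3/2 * sqrt x) - f0' x) (at x)"
      if "0 < x" for x
      by (intro DERIV_diff DERIV_cmult d1 deriv_f0 that)
    show "((\<lambda>r. \<alpha> * (3/2 * sqrt r) - f0' r) has_real_derivative
        \<alpha> * (3/2 * (1 / (2 * sqrt x))) - V x * f0 x) (at x)" if "0 < x" for x
      by (intro DERIV_diff DERIV_cmult d2 deriv_f0' that)
  qed (use r \<alpha>R in auto)
  \<comment> \<open>The pure power r^(3/2) is no supersolution, since \<open>V\<close> may lie below
    3/(4 r^2) by a constant and the defect is of order r^(3/2). The correction -r^(5/2) gains 3 sqrt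
    r, which outweighs it. Like \<alpha> above, \<open>A\<close> is fixed by equality at
    \<open>r0\<close>.\<close>
  define A where "A = f0 r0 / (r0 * sqrt r0 - r0 * (r0 * sqrt r0))"
  have "r0 * (r0 * sqrt r0) < 1 * (r0 * sqrt r0)"
    using r0 by (intro mult_strict_right_mono) auto
  then have den: "r0 * sqrt r0 - r0 * (r0 * sqrt r0) > 0" by simp
  then have A0: "A > 0" using f0_pos[OF r0(1)] by (simp add: A_def)
  have d3: "((\<lambda>r. r * (r * sqrt r)) has_real_derivative 5/2 * (r * sqrt r)) (at r)" if "r > 0" for r
    using that by (auto intro!: derivative_eq_intros simp: field_simps)
  have l2: "((\<lambda>r. r * (r * sqrt r)) \<longlongrightarrow> 0) (at_right 0)"
    by (rule tendsto_eq_intros refl)+ simp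
  have AR: "f0 r0 - A * (r0 * sqrt r0 - r0 * (r0 * sqrt r0)) \<le> 0" 
  proof -
    have "f0 r0 / d * d = f0 r0" if "d > 0" for d using that by simp
    from this[OF den] show ?thesis unfolding A_def by linarith
  qed
  have upper: "f0 r - A * (r * sqrt r - r * (r * sqrt r)) \<le> 0" if r: "0 < r" "r \<le> r0" for r
  proof (rule maximum_principle_at_0[where R = r0 and g = "\<lambda>r. f0 r - A * (r * sqrt r - r * (r * sqrt r))"
        and g' = "\<lambda>r. f0' r - A * (3/2 * sqrt r - 5/2 * (r * sqrt r))"
        and gdd = "\<lambda>r. V r * f0 r - A * (3/2 * (1 / (2 * sqrt r)) - 5/2 * (3/2 * sqrt r))"])
    have "((\<lambda>r. f0 r - A * (r * sqrt r - r * (r * sqrt r))) \<longlongrightarrow> 0 - A * (0 - 0)) (at_right 0)"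
      by (intro tendsto_intros f0_at_0 l1 l2)
    then show "((\<lambda>r. f0 r - A * (r * sqrt r - r * (r * sqrt r))) \<longlongrightarrow> 0) (at_right 0)" by simp
    fix x assume x: "0 < x" "x < r0" and g: "0 < f0 x - A * (x * sqrt x - x * (x * sqrt x))"
    have x12: "x < 1/2" using x r0 by simp
    have "x\<^sup>2 < (1/2)\<^sup>2" using x x12 by (intro power_strict_mono) auto
    then have x2: "x\<^sup>2 < 1/4" by (simp add: power2_eq_square)
    define k where "k = 3 / (4 * x\<^sup>2) - 5/2"
    have "k = (3 - 10 * x\<^sup>2) / (4 * x\<^sup>2)" using x by (simp add: k_def field_simps)
    also have "\<dots> > 0" using x2 x by (intro divide_pos_pos) auto
    finally have k0: "k > 0" .
    define w where "w = sqrt x"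
    have w: "w > 0" "x = w\<^sup>2" using x by (auto simp: w_def)
    have "A * (3/2 * (1 / (2 * w)) - 5/2 * (3/2 * w)) < k * (A * (x * w - x * (x * w)))"
    proof -
      have "3/2 * (1 / (2 * w)) - 5/2 * (3/2 * w) < k * (x * w - x * (x * w))"
      proof -
        have "k * (x * w - x * (x * w)) - (3/2 * (1 / (2 * w)) - 5/2 * (3/2 * w))
            = w * (3 - 5/2 * (x * (1 - x)))"
          using w by (simp add: k_def field_simps power2_eq_square)
        moreover have "x * (1 - x) \<le> 1/2 * 1" using x x12 by (intro mult_mono) auto
        then have "w * (3 - 5/2 * (x * (1 - x))) > 0" using w(1) by (intro mult_pos_pos) auto
        ultimately show ?thesis by linarith
      qed
      then have "A * (3/2 * (1 / (2 * w)) - 5/2 * (3/2 * w)) < A * (k * (x * w - x * (x * w)))"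
        using A0 by (rule mult_strict_left_mono)
      then show ?thesis by (simp add: algebra_simps)
    qed
    also have "\<dots> < k * f0 x" using g k0 by (simp add: w_def)
    also have "\<dots> \<le> V x * f0 x"
      using Vlo[OF x(1)] f0_pos[OF x(1)] by (simp add: k_def)
    finally show "0 < V x * f0 x - A * (3/2 * (1 / (2 * sqrt x)) - 5/2 * (3/2 * sqrt x))"
      by (simp add: w_def)
  next
    show "((\<lambda>r. f0 r - A * (r * sqrt r - r * (r * sqrt r))) has_real_derivative
        f0' x - A * (3/2 * sqrt x - 5/2 * (x * sqrt x))) (at x)" if "0 < x" for x
      by (intro DERIV_diff DERIV_cmult d1 d3 deriv_f0 that)
    show "((\<lambda>r. f0' r - A * (3/2 * sqrt r - 5/2 * (r * sqrt r))) has_real_derivative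
        V x * f0 x - A * (3/2 * (1 / (2 * sqrt x)) - 5/2 * (3/2 * sqrt x))) (at x)" if "0 < x" for x
      by (intro DERIV_diff DERIV_cmult d1 d2 deriv_f0' that)
  qed (use r AR in auto)
  show thesis
  proof (rule that[of r0 \<alpha> A])
    fix r assume r: "0 < r" "r \<le> r0"
    show "\<alpha> * (r * sqrt r) \<le> f0 r" using lower[OF r] by simp
    have "A * (r * sqrt r - r * (r * sqrt r)) \<le> A * (r * sqrt r)"
      using r A0 by (intro mult_left_mono) auto
    then show "f0 r \<le> A * (r * sqrt r)" using upper[OF r] by simp
  qed (use r0 \<alpha>0 A0 in auto)
qed

end

section \<open>Asymptotics at infinity\<close>

text \<open>A function vanishing at infinity is minus the tail integral of its derivative. To avoid
  improper integrals, \<open>C * exp (- s)\<close> is subtracted from f and from -f: both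
  differences are nondecreasing with limit 0, hence nonpositive.\<close>

lemma tendsto_0_bound_exp:
  fixes f f' :: "real \<Rightarrow> real"
  assumes f: "\<And>s. t \<le> s \<Longrightarrow> (f has_real_derivative f' s) (at s)"
    and b: "\<And>s. t \<le> s \<Longrightarrow> \<bar>f' s\<bar> \<le> C * exp (- s)"
    and lim: "(f \<longlongrightarrow> 0) at_top"
  shows "\<bar>f t\<bar> \<le> C * exp (- t)"
proof -
  have le: "g t \<le> 0" if "\<And>s. t \<le> s \<Longrightarrow> (g has_real_derivative g' s) (at s)" 
    "\<And>s. t \<le> s \<Longrightarrow> g' s \<ge> 0" "(g \<longlongrightarrow> 0) at_top" for g g' :: "real \<Rightarrow> real"
  proof (rule tendsto_lowerbound[OF that(3)])
    have "g t \<le> g s" if "t \<le> s" for s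
      by (rule DERIV_nonneg_imp_nondecreasing[OF that]) (use \<open>\<And>s. t \<le> s \<Longrightarrow> (g has_real_derivative g' s) (at s)\<close> \<open>\<And>s. t \<le> s \<Longrightarrow> g' s \<ge> 0\<close> in blast)
    then show "\<forall>\<^sub>F s in at_top. g t \<le> g s" by (rule eventually_at_top_linorderI)
  qed simp
  have e: "((\<lambda>r::real. C * exp (- r)) \<longlongrightarrow> 0) at_top"
    by (rule exp_minus_tendsto_0)
  have "f t - C * exp (- t) \<le> 0"
  proof (rule le[of "\<lambda>s. f s - C * exp (- s)" "\<lambda>s. f' s + C * exp (- s)"])
    fix s assume "t \<le> s"
    then show "((\<lambda>s. f s - C * exp (- s)) has_real_derivative f' s + C * exp (- s)) (at s)"
      using f by (auto intro!: derivative_eq_intros)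
    show "0 \<le> f' s + C * exp (- s)" using b[OF \<open>t \<le> s\<close>] by linarith
  qed (use tendsto_diff[OF lim e] in simp)
  moreover have "- f t - C * exp (- t) \<le> 0"
  proof (rule le[of "\<lambda>s. - f s - C * exp (- s)" "\<lambda>s. - f' s + C * exp (- s)"])
    fix s assume "t \<le> s"
    then show "((\<lambda>s. - f s - C * exp (- s)) has_real_derivative - f' s + C * exp (- s)) (at s)"
      using f by (auto intro!: derivative_eq_intros)
    show "0 \<le> - f' s + C * exp (- s)" using b[OF \<open>t \<le> s\<close>] by linarith
  qed (use tendsto_diff[OF tendsto_minus[OF lim] e] in simp)
  ultimately show ?thesis by linarith
qed

lemma attains_max_at_top:
  fixes f :: "real \<Rightarrow> real"
  assumes cont: "continuous_on {r..} f" and lim: "(f \<longlongrightarrow> 0) at_top"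
  obtains s where "r \<le> s" "\<And>t. r \<le> t \<Longrightarrow> \<bar>f t\<bar> \<le> \<bar>f s\<bar>"
proof (cases "\<forall>t\<ge>r. f t = 0")
  case True
  then show thesis using that[of r] by simp
next
  case False
  then obtain x where x: "x \<ge> r" "f x \<noteq> 0" by blast
  have "((\<lambda>t. \<bar>f t\<bar>) \<longlongrightarrow> 0) at_top" using lim by (rule tendsto_rabs_zero)
  then have "eventually (\<lambda>y. \<bar>f y\<bar> < \<bar>f x\<bar>) at_top"
    using x by (intro order_tendstoD(2)) auto
  then obtain b where b: "\<And>y. y \<ge> b \<Longrightarrow> \<bar>f y\<bar> < \<bar>f x\<bar>" unfolding eventually_at_top_linorder by blast
  have "continuous_on {r..max b x} (\<lambda>t. \<bar>f t\<bar>)"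
    by (intro continuous_on_rabs continuous_on_subset[OF cont]) auto
  then obtain s where s: "s \<in> {r..max b x}" "\<And>t. t \<in> {r..max b x} \<Longrightarrow> \<bar>f t\<bar> \<le> \<bar>f s\<bar>"
    using continuous_attains_sup[of "{r..max b x}" "\<lambda>t. \<bar>f t\<bar>"] x by fastforce
  have "\<bar>f t\<bar> \<le> \<bar>f s\<bar>" if "r \<le> t" for t
  proof (cases "t \<le> max b x")
    case True
    then show ?thesis using s(2) that by simp
  next
    case False
    then have "\<bar>f t\<bar> < \<bar>f x\<bar>" using b[of t] by simp
    also have "\<bar>f x\<bar> \<le> \<bar>f s\<bar>" using s(2)[of x] x by simp
    finally show ?thesis by simp
  qed
  then show thesis using that s by auto
qed

text \<open>On each tail {r..} the suprema of |p| and |q| are attained. Integrating the error twice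
  from infinity bounds sup |q| by a small multiple of sup |p| + sup |q|, and absorbing the second
  term makes q small against p. Then p^2 cannot have a nonzero maximum past r, where the growth term
  m p beats the error, so sup |p| is attained at r. Consequently a zero of p past \<open>R\<close>
  forces both functions to vanish from there on.\<close>

lemma split_system_asymptotics:
  fixes p p' q q' e1 e2 :: "real \<Rightarrow> real"
  assumes der: "\<And>x. 0 < x \<Longrightarrow> (p has_real_derivative p' x) (at x)"
      "\<And>x. 0 < x \<Longrightarrow> (p' has_real_derivative m * p x + e1 x) (at x)"
      "\<And>x. 0 < x \<Longrightarrow> (q has_real_derivative q' x) (at x)"
      "\<And>x. 0 < x \<Longrightarrow> (q' has_real_derivative - \<kappa>\<^sup>2 * q x + e2 x) (at x)"
    and m: "m > 0" and \<kappa>: "\<kappa> \<ge> 0" and K: "K \<ge> 0"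
    and e1: "\<And>x. 1 \<le> x \<Longrightarrow> \<bar>e1 x\<bar> \<le> K * exp (- x) * (\<bar>p x\<bar> + \<bar>q x\<bar>)"
    and e2: "\<And>x. 1 \<le> x \<Longrightarrow> \<bar>e2 x\<bar> \<le> K * exp (- x) * (\<bar>p x\<bar> + \<bar>q x\<bar>)"
    and lim: "(p \<longlongrightarrow> 0) at_top" "(q \<longlongrightarrow> 0) at_top" "(q' \<longlongrightarrow> 0) at_top"
    and \<eta>: "0 < \<eta>" "\<eta> \<le> 1"
  obtains R where "R \<ge> 1"
    "\<And>x s. R \<le> x \<Longrightarrow> x \<le> s \<Longrightarrow> \<bar>p s\<bar> \<le> \<bar>p x\<bar> \<and> \<bar>q s\<bar> \<le> \<eta> * \<bar>p x\<bar>"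
proof -
  have "((\<lambda>r::real. K * exp (- r)) \<longlongrightarrow> 0) at_top" by (rule exp_minus_tendsto_0)
  \<comment> \<open>Below \<eta> / 2 at most half of sup |q| appears on the right and can be
    absorbed. Below m / 4, together with |q| \<le> |p| at the maximum, the error \<open>e1\<close>
    stays under half of m |p|.\<close>
  then have "eventually (\<lambda>r. K * exp (- r) < min (\<eta> / 2) (m / 4)) at_top"
    using \<eta> m by (intro order_tendstoD(2)) auto
  then obtain R0 where R0: "\<And>r. r \<ge> R0 \<Longrightarrow> K * exp (- r) < min (\<eta> / 2) (m / 4)"
    unfolding eventually_at_top_linorder by blast
  define R where "R = max R0 1"
  have main: "\<bar>p s\<bar> \<le> \<bar>p r\<bar> \<and> \<bar>q s\<bar> \<le> \<eta> * \<bar>p r\<bar>" if r: "R \<le> r" and s: "r \<le> s" for r s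
  proof -
    have r1: "r \<ge> 1" "r \<ge> R0" using r by (auto simp: R_def)
    have pc: "continuous_on {r..} p"
      by (rule DERIV_continuous_on[where D = p'])
        (use der(1) r1 in \<open>auto intro: has_field_derivative_at_within\<close>)
    have qc: "continuous_on {r..} q"
      by (rule DERIV_continuous_on[where D = q'])
        (use der(3) r1 in \<open>auto intro: has_field_derivative_at_within\<close>)
    obtain s0 where s0: "r \<le> s0" "\<And>t. r \<le> t \<Longrightarrow> \<bar>p t\<bar> \<le> \<bar>p s0\<bar>"
      using attains_max_at_top[OF pc lim(1)] by blast
    obtain s1 where s1: "r \<le> s1" "\<And>t. r \<le> t \<Longrightarrow> \<bar>q t\<bar> \<le> \<bar>q s1\<bar>"
      using attains_max_at_top[OF qc lim(2)] by blast
    define C where "C = K * (\<bar>p s0\<bar> + \<bar>q s1\<bar>)"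
    have e2C: "\<bar>e2 t\<bar> \<le> C * exp (- t)" if "r \<le> t" for t
    proof -
      have "\<bar>e2 t\<bar> \<le> K * exp (- t) * (\<bar>p t\<bar> + \<bar>q t\<bar>)" using e2[of t] that r1 by simp
      also have "\<dots> \<le> K * exp (- t) * (\<bar>p s0\<bar> + \<bar>q s1\<bar>)"
        using s0(2)[OF that] s1(2)[OF that] K by (intro mult_left_mono) auto
      finally show ?thesis by (simp add: C_def mult_ac)
    qed
    have q'C: "\<bar>q' t\<bar> \<le> C * exp (- t)" if t: "r \<le> t" for t
    proof -
      \<comment> \<open>Variation of constants: \<open>A(t) = q'(t)\<close>, and the oscillation cancels in \<open>A'\<close>.\<close>
      define A where "A s = q' s * cos (\<kappa> * (s - t)) + \<kappa> * q s * sin (\<kappa> * (s - t))" for s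
      have "\<bar>A t\<bar> \<le> C * exp (- t)"
      proof (rule tendsto_0_bound_exp[where f' = "\<lambda>s. e2 s * cos (\<kappa> * (s - t))"])
        fix s assume s: "t \<le> s"
        then have s0: "s > 0" using t r1 by simp
        show "(A has_real_derivative e2 s * cos (\<kappa> * (s - t))) (at s)"
          unfolding A_def using der(3,4)[OF s0]
          by (auto intro!: derivative_eq_intros simp: algebra_simps power2_eq_square)
        have "\<bar>e2 s * cos (\<kappa> * (s - t))\<bar> \<le> \<bar>e2 s\<bar> * 1"
          unfolding abs_mult by (intro mult_left_mono) auto
        then show "\<bar>e2 s * cos (\<kappa> * (s - t))\<bar> \<le> C * exp (- s)" using e2C[of s] t s by simp
      next
        have l: "((\<lambda>s. \<bar>q' s\<bar> + \<kappa> * \<bar>q s\<bar>) \<longlongrightarrow> 0) at_top"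
          using tendsto_add[OF tendsto_rabs_zero[OF lim(3)]
              tendsto_mult[OF tendsto_const tendsto_rabs_zero[OF lim(2)], of \<kappa>]] by simp
        show "(A \<longlongrightarrow> 0) at_top"
        proof (rule tendsto_0_le[OF l, where K = 1], rule always_eventually, rule allI)
          fix s
          have "\<bar>q' s * cos (\<kappa> * (s - t))\<bar> \<le> \<bar>q' s\<bar> * 1"
            unfolding abs_mult by (intro mult_left_mono) auto
          moreover have "\<bar>\<kappa> * q s * sin (\<kappa> * (s - t))\<bar> \<le> \<bar>\<kappa> * q s\<bar> * 1"
            unfolding abs_mult by (intro mult_left_mono) auto
          moreover have "\<bar>\<kappa> * q s\<bar> = \<kappa> * \<bar>q s\<bar>" using \<kappa> by (simp add: abs_mult)
          ultimately show "norm (A s) \<le> norm (\<bar>q' s\<bar> + \<kappa> * \<bar>q s\<bar>) * 1"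
            unfolding A_def by simp
        qed
      qed
      then show ?thesis by (simp add: A_def)
    qed
    \<comment> \<open>A second tail integration, from q' to q, reproduces the same bound. No factor
      1/\<kappa> enters, so \<kappa> = 0 is covered.\<close>
    have "\<bar>q s1\<bar> \<le> C * exp (- s1)"
    proof (rule tendsto_0_bound_exp[where f' = q'])
      show "(q has_real_derivative q' t) (at t)" if "s1 \<le> t" for t
        using der(3) that s1 r1 by simp
      show "\<bar>q' t\<bar> \<le> C * exp (- t)" if "s1 \<le> t" for t using q'C that s1 by simp
    qed (rule lim)
    also have "\<dots> = K * exp (- s1) * (\<bar>p s0\<bar> + \<bar>q s1\<bar>)" by (simp add: C_def)
    also have "\<dots> \<le> (\<eta> / 2) * (\<bar>p s0\<bar> + \<bar>q s1\<bar>)"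
      using R0[of s1] s1 r1 by (intro mult_right_mono) auto
    also have "\<dots> \<le> (\<eta> / 2) * \<bar>p s0\<bar> + (1 / 2) * \<bar>q s1\<bar>"
      using \<eta> unfolding distrib_left by (intro add_left_mono mult_right_mono) auto
    finally have qs1: "\<bar>q s1\<bar> \<le> \<eta> * \<bar>p s0\<bar>" by simp
    have qb: "\<bar>q t\<bar> \<le> \<eta> * \<bar>p s0\<bar>" if "r \<le> t" for t using s1(2)[OF that] qs1 by simp
    have "\<bar>p s0\<bar> \<le> \<bar>p r\<bar>"
    proof (rule ccontr)
      assume n: "\<not> \<bar>p s0\<bar> \<le> \<bar>p r\<bar>"
      then have s0r: "r < s0" using s0(1) by (cases "s0 = r") auto
      have p0: "\<bar>p s0\<bar> > 0" using n by linarith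
      have s00: "s0 > 0" using s0r r1 by simp
      \<comment> \<open>p^2 is differentiable also at zeros of p. Its second derivative at
        \<open>s0\<close> is at least 2 p p'', so a maximum requires p p'' \<le> 0, which the
        smallness of \<open>e1\<close> excludes.\<close>
      have d2: "((\<lambda>t. 2 * p t * p' t) has_real_derivative
          2 * (p' s0)\<^sup>2 + 2 * p s0 * (m * p s0 + e1 s0)) (at s0)"
        using der(1,2)[OF s00] by (auto intro!: derivative_eq_intros simp: algebra_simps power2_eq_square)
      have "2 * (p' s0)\<^sup>2 + 2 * p s0 * (m * p s0 + e1 s0) \<le> 0"
      proof (rule interior_max_second_deriv_nonpos(2)[OF _ _ _ d2, of "s0 - r" "\<lambda>t. (p t)\<^sup>2"])
        show "0 < s0 - r" using s0r by simp
        fix y assume y: "\<bar>y - s0\<bar> < s0 - r"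
        then have yr: "r \<le> y" "0 < y" using r1 by auto
        show "(p y)\<^sup>2 \<le> (p s0)\<^sup>2" using s0(2)[OF yr(1)] by (simp add: abs_le_square_iff)
        show "((\<lambda>t. (p t)\<^sup>2) has_real_derivative 2 * p y * p' y) (at y)"
          using der(1)[OF yr(2)] by (auto intro!: derivative_eq_intros)
      qed
      then have neg: "p s0 * (m * p s0 + e1 s0) \<le> 0"
        using zero_le_power2[of "p' s0"] by linarith
      have "\<bar>e1 s0\<bar> \<le> K * exp (- s0) * (\<bar>p s0\<bar> + \<bar>q s0\<bar>)" using e1[of s0] s0 r1 by simp
      also have "\<dots> \<le> K * exp (- s0) * (2 * \<bar>p s0\<bar>)"
      proof -
        have "\<bar>q s0\<bar> \<le> 1 * \<bar>p s0\<bar>"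
          using qb[OF s0(1)] mult_right_mono[OF \<eta>(2), of "\<bar>p s0\<bar>"] by simp
        then show ?thesis using K by (intro mult_left_mono) auto
      qed
      also have "\<dots> \<le> (m / 4) * (2 * \<bar>p s0\<bar>)"
        using R0[of s0] s0 r1 by (intro mult_right_mono) auto
      finally have "\<bar>e1 s0\<bar> \<le> (m / 2) * \<bar>p s0\<bar>" by simp
      then have "\<bar>p s0\<bar> * \<bar>e1 s0\<bar> \<le> \<bar>p s0\<bar> * ((m / 2) * \<bar>p s0\<bar>)" by (intro mult_left_mono) auto
      also have "\<dots> = (m / 2) * (p s0)\<^sup>2" by (simp add: power2_eq_square mult_ac)
      finally have "\<bar>p s0 * e1 s0\<bar> \<le> (m / 2) * (p s0)\<^sup>2" by (simp add: abs_mult)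
      moreover have "(p s0)\<^sup>2 > 0" using p0 by simp
      then have "(m / 2) * (p s0)\<^sup>2 > 0" using m by simp
      moreover have "p s0 * (m * p s0 + e1 s0) = m * (p s0)\<^sup>2 + p s0 * e1 s0"
        by (simp add: algebra_simps power2_eq_square)
      ultimately show False using neg by linarith
    qed
    then have eq: "\<bar>p s0\<bar> = \<bar>p r\<bar>" using s0(2)[of r] by simp
    show ?thesis using s0(2)[OF s] qb[OF s] unfolding eq by simp
  qed
  show thesis by (rule that[of R]) (use main in \<open>auto simp: R_def\<close>)
qed

section \<open>Pointwise decay from square integrability\<close>

lemma square_integrable_window_tendsto_0:
  fixes h :: "real \<Rightarrow> real"
  assumes cont: "continuous_on {1..} h" and int: "(\<lambda>x. (h x)\<^sup>2) integrable_on {1..}"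
  shows "((\<lambda>x. integral {x..x+1} (\<lambda>t. \<bar>h t\<bar>)) \<longlongrightarrow> 0) at_top"
proof -
  have c: "continuous_on {x..y} h" if "1 \<le> x" for x y
    by (rule continuous_on_subset[OF cont]) (use that in auto)
  have i2: "(\<lambda>t. (h t)\<^sup>2) integrable_on {x..y}" if "1 \<le> x" for x y
    by (intro integrable_continuous_real continuous_intros c that)
  have i1: "(\<lambda>t. \<bar>h t\<bar>) integrable_on {x..y}" if "1 \<le> x" for x y
    by (intro integrable_continuous_real continuous_on_rabs c that)
  \<comment> \<open>\<open>F\<close> is nondecreasing and bounded, so its increments over unit
    windows, the local integrals of \<open>h\<close> squared, tend to 0.\<close>
  define F where "F x = integral {1..x} (\<lambda>t. (h t)\<^sup>2)" for x
  have Fle: "F x \<le> integral {1..} (\<lambda>t. (h t)\<^sup>2)" for x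
    unfolding F_def by (intro integral_subset_le i2 int) auto
  have bdd: "bdd_above (range F)" using Fle by (auto intro!: bdd_aboveI2)
  have Fdiff: "F (x + 1) - F x = integral {x..x+1} (\<lambda>t. (h t)\<^sup>2)" if "1 \<le> x" for x
    unfolding F_def using Henstock_Kurzweil_Integration.integral_combine[OF that _ i2, of "x + 1"] by simp
  have Fmono: "F x \<le> F y" if "x \<le> y" for x y
    unfolding F_def by (intro integral_subset_le i2) (use that in auto)
  show ?thesis
  proof (rule tendstoI)
    fix e :: real assume e: "e > 0"
    define d where "d = e / 3"
    have d: "d > 0" using e by (simp add: d_def)
    obtain x0 where x0: "Sup (range F) - d * d < F x0"
      using less_cSupD[of "range F" "Sup (range F) - d * d"] d by auto
    have "dist (integral {x..x+1} (\<lambda>t. \<bar>h t\<bar>)) 0 < e" if x: "x \<ge> max x0 1" for x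
    proof -
      have x1: "x \<ge> 1" using x by simp
      have "integral {x..x+1} (\<lambda>t. (h t)\<^sup>2) = F (x + 1) - F x" using Fdiff[OF x1] by simp
      also have "\<dots> \<le> Sup (range F) - F x0"
        using Fmono[of x0 x] x by (intro diff_mono cSup_upper bdd) auto
      also have "\<dots> \<le> d * d" using x0 by simp
      finally have I: "integral {x..x+1} (\<lambda>t. (h t)\<^sup>2) \<le> d * d" .
      \<comment> \<open>Pointwise |h| \<le> d + h^2 / d stands in for the Cauchy-Schwarz inequality.
        Each of the two terms contributes at most d, so d = e / 3 leaves room.\<close>
      have "integral {x..x+1} (\<lambda>t. \<bar>h t\<bar>) \<le> integral {x..x+1} (\<lambda>t. d + (h t)\<^sup>2 / d)"
      proof (rule integral_le)
        show "(\<lambda>t. d + (h t)\<^sup>2 / d) integrable_on {x..x+1}"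
          by (intro integrable_continuous_real continuous_intros c x1) (use d in auto)
        fix t
        have "2 * (d * \<bar>h t\<bar>) \<le> d\<^sup>2 + (h t)\<^sup>2"
          using sum_squares_bound[of d "\<bar>h t\<bar>"] by simp
        moreover have "0 \<le> d * \<bar>h t\<bar>" using d by simp
        ultimately have "d * \<bar>h t\<bar> \<le> d\<^sup>2 + (h t)\<^sup>2" by linarith
        then show "\<bar>h t\<bar> \<le> d + (h t)\<^sup>2 / d" using d by (simp add: field_simps power2_eq_square)
      qed (rule i1[OF x1])
      also have "\<dots> = d + integral {x..x+1} (\<lambda>t. (h t)\<^sup>2) / d"
        by (subst integral_add) (auto intro!: integrable_on_divide i2 x1 simp: integral_divide)
      also have "\<dots> \<le> d + d" using I d by (simp add: divide_le_eq)
      finally have "integral {x..x+1} (\<lambda>t. \<bar>h t\<bar>) < e" using e by (simp add: d_def)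
      moreover have "0 \<le> integral {x..x+1} (\<lambda>t. \<bar>h t\<bar>)" by (intro integral_nonneg i1 x1) auto
      ultimately show ?thesis by simp
    qed
    then show "\<forall>\<^sub>F x in at_top. dist (integral {x..x+1} (\<lambda>t. \<bar>h t\<bar>)) 0 < e"
      by (rule eventually_at_top_linorderI)
  qed
qed

lemma ode_window_bounds:
  fixes y y' y'' :: "real \<Rightarrow> real"
  assumes der: "\<And>t. 1 \<le> t \<Longrightarrow> (y has_real_derivative y' t) (at t)"
      "\<And>t. 1 \<le> t \<Longrightarrow> (y' has_real_derivative y'' t) (at t)"
    and cont: "continuous_on {1..} h"
    and b: "\<And>t. 1 \<le> t \<Longrightarrow> \<bar>y t\<bar> + \<bar>y'' t\<bar> \<le> h t" and x: "1 \<le> x"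
  shows "\<bar>y x\<bar> \<le> 10 * integral {x..x+1} (\<lambda>t. \<bar>h t\<bar>)"
    and "\<bar>y' x\<bar> \<le> 10 * integral {x..x+1} (\<lambda>t. \<bar>h t\<bar>)"
proof -
  \<comment> \<open>Integrate \<open>(\<phi> y' - \<phi>' y)'\<close> against cubic cutoffs \<open>\<phi>\<close> vanishing to second order at \<open>x + 1\<close>.\<close>
  have key: "\<bar>c0 * y' x - c1 * y x\<bar> \<le> 10 * integral {x..x+1} (\<lambda>t. \<bar>h t\<bar>)"
    if \<phi>: "\<And>t. (\<phi> has_real_derivative \<phi>' t) (at t)" "\<And>t. (\<phi>' has_real_derivative \<phi>'' t) (at t)"
      "\<phi> x = c0" "\<phi>' x = c1" "\<phi> (x + 1) = 0" "\<phi>' (x + 1) = 0"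
      "\<And>t. t \<in> {x..x+1} \<Longrightarrow> \<bar>\<phi> t\<bar> \<le> 10" "\<And>t. t \<in> {x..x+1} \<Longrightarrow> \<bar>\<phi>'' t\<bar> \<le> 10"
    for \<phi> \<phi>' \<phi>'' :: "real \<Rightarrow> real" and c0 c1
  proof -
    have "((\<lambda>t. \<phi> t * y'' t - \<phi>'' t * y t) has_integral
        (\<phi> (x+1) * y' (x+1) - \<phi>' (x+1) * y (x+1)) - (\<phi> x * y' x - \<phi>' x * y x)) {x..x+1}"
    proof (rule fundamental_theorem_of_calculus)
      fix t assume t: "t \<in> {x..x+1}"
      then have "t \<ge> 1" using x by simp
      then have "((\<lambda>t. \<phi> t * y' t - \<phi>' t * y t) has_real_derivative \<phi> t * y'' t - \<phi>'' t * y t) (at t)"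
        using der \<phi>(1,2) by (auto intro!: derivative_eq_intros)
      then show "((\<lambda>t. \<phi> t * y' t - \<phi>' t * y t) has_vector_derivative \<phi> t * y'' t - \<phi>'' t * y t) (at t within {x..x+1})"
        by (simp add: has_real_derivative_iff_has_vector_derivative has_vector_derivative_at_within)
    qed simp
    then have I: "((\<lambda>t. \<phi> t * y'' t - \<phi>'' t * y t) has_integral - (c0 * y' x - c1 * y x)) {x..x+1}"
      using \<phi> by simp
    have hi: "(\<lambda>t. 10 * \<bar>h t\<bar>) integrable_on {x..x+1}"
      by (intro integrable_continuous_real continuous_on_mult continuous_on_const continuous_on_rabs
          continuous_on_subset[OF cont]) (use x in auto)
    have "norm (integral {x..x+1} (\<lambda>t. \<phi> t * y'' t - \<phi>'' t * y t)) \<le> integral {x..x+1} (\<lambda>t. 10 * \<bar>h t\<bar>)"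
    proof (rule integral_norm_bound_integral[OF has_integral_integrable[OF I] hi])
      fix t assume t: "t \<in> {x..x+1}"
      have "\<bar>\<phi> t * y'' t\<bar> \<le> 10 * \<bar>y'' t\<bar>" "\<bar>\<phi>'' t * y t\<bar> \<le> 10 * \<bar>y t\<bar>"
        unfolding abs_mult using \<phi>(7,8)[OF t] by (intro mult_right_mono; simp)+
      then show "norm (\<phi> t * y'' t - \<phi>'' t * y t) \<le> 10 * \<bar>h t\<bar>"
        using b[of t] t x by auto
    qed
    then show ?thesis unfolding integral_unique[OF I] by (simp add: abs_minus_commute)
  qed
  \<comment> \<open>The cutoffs are the Hermite cubics s (1 - s)^2 and (1 - s)^2 (1 + 2 s) in s = t
    - x. The first has value 0 and slope 1 at s = 0 and extracts \<open>y x\<close>; the second has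
    value 1 and slope 0 and extracts \<open>y' x\<close>. The 10 is a crude common bound for both
    and for their second derivatives.\<close>
  have v1: "\<bar>a\<bar> \<le> 10" "\<bar>b\<bar> \<le> 10" if "a = s * (1 - s) * (1 - s)" "b = 6 * s - 4" "s \<in> {0..1}" for a b s :: real
  proof -
    have "s * ((1 - s) * (1 - s)) \<le> 1 * (1 * 1)" using that by (intro mult_mono) auto
    moreover have "0 \<le> s * ((1 - s) * (1 - s))" using that by auto
    ultimately show "\<bar>a\<bar> \<le> 10" unfolding that(1) by (simp add: mult.assoc)
  qed (use that in auto)
  have v2: "\<bar>a\<bar> \<le> 10" "\<bar>b\<bar> \<le> 10" if "a = (1 - s) * (1 - s) * (1 + 2 * s)" "b = 12 * s - 6" "s \<in> {0..1}" for a b s :: real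
  proof -
    have "(1 - s) * (1 - s) * (1 + 2 * s) \<le> 1 * 1 * 3" using that by (intro mult_mono) auto
    moreover have "0 \<le> (1 - s) * (1 - s) * (1 + 2 * s)" using that by auto
    ultimately show "\<bar>a\<bar> \<le> 10" unfolding that(1) by simp
  qed (use that in auto)
  have "\<bar>0 * y' x - 1 * y x\<bar> \<le> 10 * integral {x..x+1} (\<lambda>t. \<bar>h t\<bar>)"
  proof (rule key[of "\<lambda>t. (t - x) * (1 - (t - x)) * (1 - (t - x))"
          "\<lambda>t. 1 - 4 * (t - x) + 3 * (t - x) * (t - x)" "\<lambda>t. 6 * (t - x) - 4"])
    fix t assume "t \<in> {x..x+1}"
    then have s: "t - x \<in> {0..1}" by auto
    show "\<bar>(t - x) * (1 - (t - x)) * (1 - (t - x))\<bar> \<le> 10" "\<bar>6 * (t - x) - 4\<bar> \<le> 10"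
      by (rule v1[OF refl refl s])+
  qed (auto intro!: derivative_eq_intros simp: algebra_simps)
  then show "\<bar>y x\<bar> \<le> 10 * integral {x..x+1} (\<lambda>t. \<bar>h t\<bar>)" by simp
  have "\<bar>1 * y' x - 0 * y x\<bar> \<le> 10 * integral {x..x+1} (\<lambda>t. \<bar>h t\<bar>)"
  proof (rule key[of "\<lambda>t. (1 - (t - x)) * (1 - (t - x)) * (1 + 2 * (t - x))"
          "\<lambda>t. - 6 * (t - x) + 6 * (t - x) * (t - x)" "\<lambda>t. 12 * (t - x) - 6"])
    fix t assume "t \<in> {x..x+1}"
    then have s: "t - x \<in> {0..1}" by auto
    show "\<bar>(1 - (t - x)) * (1 - (t - x)) * (1 + 2 * (t - x))\<bar> \<le> 10" "\<bar>12 * (t - x) - 6\<bar> \<le> 10"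
      by (rule v2[OF refl refl s])+
  qed (auto intro!: derivative_eq_intros simp: algebra_simps)
  then show "\<bar>y' x\<bar> \<le> 10 * integral {x..x+1} (\<lambda>t. \<bar>h t\<bar>)" by simp
qed

context vortex
begin

text \<open>With \<rho> replaced by its limit 1 and the sinh term dropped, the two potentials become
  2 - 7/4 and 6 - 7/4, the diagonal entries of the limiting matrix at infinity.\<close>

lemma V_decay:
  obtains K where "K \<ge> 0" "\<And>r. r \<ge> 1 \<Longrightarrow> \<bar>V r - 1/4\<bar> \<le> K * exp (- r)"
    "\<And>r. r \<ge> 1 \<Longrightarrow> \<bar>V r + 4 * (\<rho> r)\<^sup>2 - 17/4\<bar> \<le> K * exp (- r)"
proof -
  obtain C where C: "C \<ge> 0" "\<And>r. r \<ge> 1 \<Longrightarrow> \<bar>1 - \<rho> r\<bar> \<le> C * exp (- r)" using rho_decay by blast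
  define B where "B = C * (2 + C)"
  have B0: "B \<ge> 0" using C by (simp add: B_def)
  have sq: "\<bar>(\<rho> r)\<^sup>2 - 1\<bar> \<le> B * exp (- r)" if r: "r \<ge> 1" for r
  proof -
    have "C * exp (- r) \<le> C * 1" using C r by (intro mult_left_mono) auto
    then have "\<bar>1 + \<rho> r\<bar> \<le> 2 + C" using C(2)[OF r] by linarith
    then have "\<bar>1 - \<rho> r\<bar> * \<bar>1 + \<rho> r\<bar> \<le> (C * exp (- r)) * (2 + C)"
      using C r by (intro mult_mono) auto
    moreover have "\<bar>(\<rho> r)\<^sup>2 - 1\<bar> = \<bar>1 - \<rho> r\<bar> * \<bar>1 + \<rho> r\<bar>"
      unfolding abs_mult[symmetric] by (simp add: algebra_simps power2_eq_square abs_minus_commute)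
    ultimately show ?thesis by (simp add: B_def mult_ac)
  qed
  have sh: "\<bar>3 / (4 * (sinh r)\<^sup>2)\<bar> \<le> 12 * exp (- r)" if r: "r \<ge> 1" for r :: real
  proof -
    have s: "exp r / 4 \<le> sinh r" "sinh r > 0" using sinh_ge_exp[OF r] r by auto
    have "(exp r / 4) * (1 / 4) \<le> (exp r / 4) * (exp r / 4)" using r by (intro mult_left_mono) auto
    also have "\<dots> \<le> sinh r * sinh r" using s by (intro mult_mono) auto
    finally have "exp r / 16 \<le> (sinh r)\<^sup>2" by (simp add: power2_eq_square)
    then have "3 / (4 * (sinh r)\<^sup>2) \<le> 3 / (4 * (exp r / 16))"
      using s by (intro divide_left_mono mult_left_mono mult_pos_pos) auto
    then show ?thesis by (simp add: exp_minus field_simps)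
  qed
  show thesis
  proof (rule that[of "12 + 6 * B"])
    fix r :: real assume r: "r \<ge> 1"
    have e: "(12 + 6 * B) * exp (- r) = 12 * exp (- r) + 6 * (B * exp (- r))"
      by (simp add: algebra_simps)
    have V: "V r - 1/4 = 3 / (4 * (sinh r)\<^sup>2) + 2 * ((\<rho> r)\<^sup>2 - 1)"
      "V r + 4 * (\<rho> r)\<^sup>2 - 17/4 = 3 / (4 * (sinh r)\<^sup>2) + 6 * ((\<rho> r)\<^sup>2 - 1)"
      by (simp_all add: V_def)
    define X Y E F where "X = 3 / (4 * (sinh r)\<^sup>2)" and "Y = (\<rho> r)\<^sup>2 - 1" and "E = 12 * exp (- r)" and "F = B * exp (- r)"
    have "\<bar>X\<bar> \<le> E" "\<bar>Y\<bar> \<le> F" using sh[OF r] sq[OF r] by (auto simp: X_def Y_def E_def F_def)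
    then have "\<bar>X + 2 * Y\<bar> \<le> E + 6 * F" "\<bar>X + 6 * Y\<bar> \<le> E + 6 * F" by linarith+
    then show "\<bar>V r - 1/4\<bar> \<le> (12 + 6 * B) * exp (- r)"
      "\<bar>V r + 4 * (\<rho> r)\<^sup>2 - 17/4\<bar> \<le> (12 + 6 * B) * exp (- r)"
      unfolding V e X_def Y_def E_def F_def by simp_all
  qed (use B0 in simp)
qed

text \<open>Positivity is assumed strictly to the right of \<open>c\<close> and obtained at
  \<open>c\<close> itself, which is what allows it to be continued to the left. The Wronskian has
  derivative \<open>f0 * b\<close>, and y / \<open>f0\<close> has derivative W /
  \<open>f0\<close>^2. If W were nonnegative somewhere, it would be positive afterwards and y /
  \<open>f0\<close> could not decrease; as \<open>f0\<close> is eventually at least 1/2, y could not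
  tend to 0.\<close>

lemma wronskian_neg:
  fixes y y' b :: "real \<Rightarrow> real"
  assumes c: "0 < c"
    and y: "\<And>x. 0 < x \<Longrightarrow> (y has_real_derivative y' x) (at x)"
    and y': "\<And>x. 0 < x \<Longrightarrow> (y' has_real_derivative V x * y x + b x) (at x)"
    and pos: "\<And>x. c < x \<Longrightarrow> y x > 0" and b: "\<And>x. c < x \<Longrightarrow> b x > 0"
    and lim: "(y \<longlongrightarrow> 0) at_top"
  defines "W \<equiv> \<lambda>x. f0 x * y' x - f0' x * y x"
  shows "\<And>x s. c \<le> x \<Longrightarrow> x < s \<Longrightarrow> W x < W s" "\<And>x. c \<le> x \<Longrightarrow> W x < 0" "y c > 0"
proof -
  have dW: "(W has_real_derivative f0 x * b x) (at x)" if "x > 0" for x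
    unfolding W_def using deriv_f0[OF that] deriv_f0'[OF that] y[OF that] y'[OF that]
    by (auto intro!: derivative_eq_intros simp: algebra_simps)
  show mono: "W x < W s" if xs: "c \<le> x" "x < s" for x s
  proof (rule DERIV_pos_imp_increasing_open[OF xs(2)])
    show "\<exists>D. (W has_real_derivative D) (at t) \<and> 0 < D" if "x < t" "t < s" for t
      using dW[of t] f0_pos[of t] b[of t] xs c that by (intro exI[of _ "f0 t * b t"]) auto
    show "continuous_on {x..s} W"
      using dW xs c by (intro DERIV_continuous_on[where D = "\<lambda>x. f0 x * b x"])
        (auto intro: has_field_derivative_at_within)
  qed
  define \<phi> where "\<phi> x = y x / f0 x" for x
  have d\<phi>: "(\<phi> has_real_derivative W x / (f0 x)\<^sup>2) (at x)" if "x > 0" for x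
    unfolding \<phi>_def W_def using deriv_f0[OF that] y[OF that] f0_pos[OF that]
    by (auto intro!: derivative_eq_intros simp: field_simps power2_eq_square)
  show neg: "W x < 0" if x: "c \<le> x" for x
  proof (rule ccontr)
    assume n: "\<not> W x < 0"
    have inc: "\<phi> (x + 1) \<le> \<phi> s" if s: "x + 1 \<le> s" for s
    proof (rule DERIV_nonneg_imp_nondecreasing[OF s])
      fix t assume t: "x + 1 \<le> t" "t \<le> s"
      have "W t > 0" using mono[OF x, of t] n t by auto
      then show "\<exists>D. (\<phi> has_real_derivative D) (at t) \<and> 0 \<le> D"
        using d\<phi>[of t] t x c by (intro exI[of _ "W t / (f0 t)\<^sup>2"]) auto
    qed
    have p: "\<phi> (x + 1) > 0" unfolding \<phi>_def using pos[of "x+1"] f0_pos[of "x+1"] x c by auto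
    have "eventually (\<lambda>s. y s < \<phi> (x + 1) / 2) at_top"
      using lim p by (intro order_tendstoD(2)) auto
    moreover have "eventually (\<lambda>s. s \<ge> x + 1) at_top" by (rule eventually_ge_at_top)
    ultimately have ev: "eventually (\<lambda>s. y s < \<phi> (x + 1) / 2 \<and> x + 1 \<le> s \<and> 1/2 \<le> f0 s) at_top"
      using f0_at_top by eventually_elim auto
    then obtain s where s: "y s < \<phi> (x + 1) / 2" "x + 1 \<le> s" "1/2 \<le> f0 s"
      using eventually_happens'[OF trivial_limit_at_top_linorder ev] by blast
    have "s > 0" using s x c by simp
    then have "y s = \<phi> s * f0 s" using f0_pos[of s] by (simp add: \<phi>_def)
    also have "\<dots> \<ge> \<phi> (x + 1) * (1/2)"
      using inc[OF s(2)] s(3) p by (intro mult_mono) auto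
    finally show False using s(1) by linarith
  qed
  have "\<phi> (c + 1) < \<phi> c"
  proof (rule DERIV_neg_imp_decreasing[where f = \<phi> and a = c])
    fix t assume t: "c \<le> t" "t \<le> c + 1"
    then have "W t / (f0 t)\<^sup>2 < 0" using neg[OF t(1)] f0_pos[of t] c by (intro divide_neg_pos) auto
    then show "\<exists>D. (\<phi> has_real_derivative D) (at t) \<and> D < 0" using d\<phi>[of t] t c by auto
  qed simp
  moreover have "\<phi> (c + 1) > 0" unfolding \<phi>_def using pos[of "c+1"] f0_pos[of "c+1"] c by auto
  ultimately have "\<phi> c > 0" by simp
  then show "y c > 0" using f0_pos[OF c] by (simp add: \<phi>_def zero_less_divide_iff)
qed

end

section \<open>Real eigenmodes\<close>

text \<open>
  \<open>z\<close> is the second component of the eigenfunction up to a factor \<open>\<plusminus>\<i>\<close>, chosen so that both coupling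
  coefficients are positive.
\<close>

locale gp_mode = vortex +
  fixes \<mu> :: real and u u' z z' :: "real \<Rightarrow> real"
  assumes \<mu>: "sqrt 17 / 8 \<le> \<mu>"
    and u: "\<And>x. 0 < x \<Longrightarrow> (u has_real_derivative u' x) (at x)"
    and u': "\<And>x. 0 < x \<Longrightarrow> (u' has_real_derivative (V x + 4 * (\<rho> x)\<^sup>2) * u x + 2 * \<mu> * z x) (at x)"
    and z: "\<And>x. 0 < x \<Longrightarrow> (z has_real_derivative z' x) (at x)"
    and z': "\<And>x. 0 < x \<Longrightarrow> (z' has_real_derivative 2 * \<mu> * u x + V x * z x) (at x)"
    and int_u: "(\<lambda>x. (u x)\<^sup>2) absolutely_integrable_on {0<..}"
    and int_z: "(\<lambda>x. (z x)\<^sup>2) absolutely_integrable_on {0<..}"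
begin

lemma \<mu>_pos: "\<mu> > 0"
  using \<mu> by (rule less_le_trans[rotated]) simp

lemma u_continuous: "continuous_on {0<..} u"
  by (rule DERIV_continuous_on[where D = u']) (auto intro: has_field_derivative_at_within u)

lemma z_continuous: "continuous_on {0<..} z"
  by (rule DERIV_continuous_on[where D = z']) (auto intro: has_field_derivative_at_within z)

text \<open>Beyond 1 the potentials are bounded, so each component together with its second
  derivative is dominated by one square integrable \<open>h\<close>. The window estimates then give
  decay of the functions and of their first derivatives.\<close>

lemma tendsto_0:
  "(u \<longlongrightarrow> 0) at_top" "(u' \<longlongrightarrow> 0) at_top" "(z \<longlongrightarrow> 0) at_top" "(z' \<longlongrightarrow> 0) at_top"
proof -
  obtain K where K: "K \<ge> 0" "\<And>r. r \<ge> 1 \<Longrightarrow> \<bar>V r - 1/4\<bar> \<le> K * exp (- r)"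
    "\<And>r. r \<ge> 1 \<Longrightarrow> \<bar>V r + 4 * (\<rho> r)\<^sup>2 - 17/4\<bar> \<le> K * exp (- r)" using V_decay by blast
  \<comment> \<open>The weight consists of 1 for the function itself, 5 + K for a potential (at most
    17/4 + K) and 2 \<mu> for the coupling.\<close>
  define B where "B = 6 + K + 2 * \<mu>"
  define h where "h x = B * (\<bar>u x\<bar> + \<bar>z x\<bar>)" for x
  have B0: "B \<ge> 0" using K \<mu>_pos by (simp add: B_def)
  have Vb: "\<bar>V r\<bar> \<le> 5 + K" "\<bar>V r + 4 * (\<rho> r)\<^sup>2\<bar> \<le> 5 + K" if r: "r \<ge> 1" for r
  proof -
    have "K * exp (- r) \<le> K * 1" using K r by (intro mult_left_mono) auto
    then show "\<bar>V r\<bar> \<le> 5 + K" "\<bar>V r + 4 * (\<rho> r)\<^sup>2\<bar> \<le> 5 + K" using K(2,3)[OF r] by linarith+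
  qed
  have hc: "continuous_on {1..} h"
    unfolding h_def
    by (intro continuous_intros continuous_on_subset[OF u_continuous] continuous_on_subset[OF z_continuous]) auto
  have hi: "(\<lambda>x. (h x)\<^sup>2) integrable_on {1..}"
  proof (rule measurable_bounded_by_integrable_imp_integrable)
    show "(\<lambda>x. (h x)\<^sup>2) \<in> borel_measurable (lebesgue_on {1..})"
      by (intro continuous_imp_measurable_on_sets_lebesgue continuous_intros hc) auto
    have "(\<lambda>x. 2 * B\<^sup>2 * ((u x)\<^sup>2 + (z x)\<^sup>2)) absolutely_integrable_on {1..}"
      by (intro set_integrable_mult_right set_integral_add set_integrable_subset[OF int_u]
          set_integrable_subset[OF int_z]) auto
    then show "(\<lambda>x. 2 * B\<^sup>2 * ((u x)\<^sup>2 + (z x)\<^sup>2)) integrable_on {1..}"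
      by (rule set_lebesgue_integral_eq_integral(1))
    fix x :: real
    have "(\<bar>u x\<bar> + \<bar>z x\<bar>)\<^sup>2 \<le> 2 * ((u x)\<^sup>2 + (z x)\<^sup>2)"
      using sum_squares_bound[of "\<bar>u x\<bar>" "\<bar>z x\<bar>"] by (simp add: power2_sum)
    then have "B\<^sup>2 * (\<bar>u x\<bar> + \<bar>z x\<bar>)\<^sup>2 \<le> B\<^sup>2 * (2 * ((u x)\<^sup>2 + (z x)\<^sup>2))"
      by (intro mult_left_mono) auto
    then have "(h x)\<^sup>2 \<le> B\<^sup>2 * (2 * ((u x)\<^sup>2 + (z x)\<^sup>2))"
      unfolding h_def power_mult_distrib .
    then show "norm ((h x)\<^sup>2) \<le> 2 * B\<^sup>2 * ((u x)\<^sup>2 + (z x)\<^sup>2)"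
      unfolding real_norm_def abs_power2 by (simp only: mult.assoc mult.left_commute)
  qed auto
  have bu: "\<bar>u t\<bar> + \<bar>(V t + 4 * (\<rho> t)\<^sup>2) * u t + 2 * \<mu> * z t\<bar> \<le> h t"
    and bz: "\<bar>z t\<bar> + \<bar>2 * \<mu> * u t + V t * z t\<bar> \<le> h t" if t: "1 \<le> t" for t
  proof -
    have a: "\<bar>(V t + 4 * (\<rho> t)\<^sup>2) * u t\<bar> \<le> (5 + K) * \<bar>u t\<bar>" "\<bar>V t * z t\<bar> \<le> (5 + K) * \<bar>z t\<bar>"
      unfolding abs_mult using Vb[OF t] by (intro mult_right_mono; simp)+
    have m: "\<bar>2 * \<mu> * z t\<bar> = 2 * \<mu> * \<bar>z t\<bar>" "\<bar>2 * \<mu> * u t\<bar> = 2 * \<mu> * \<bar>u t\<bar>"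
      using \<mu>_pos by (auto simp: abs_mult)
    have n: "0 \<le> (6 + K) * \<bar>z t\<bar>" "0 \<le> (6 + K) * \<bar>u t\<bar>" "0 \<le> 2 * \<mu> * \<bar>u t\<bar>" "0 \<le> 2 * \<mu> * \<bar>z t\<bar>"
      using K \<mu>_pos by auto
    have h: "h t = \<bar>u t\<bar> + (5 + K) * \<bar>u t\<bar> + 2 * \<mu> * \<bar>u t\<bar> + ((6 + K) * \<bar>z t\<bar> + 2 * \<mu> * \<bar>z t\<bar>)"
      "h t = \<bar>z t\<bar> + (5 + K) * \<bar>z t\<bar> + 2 * \<mu> * \<bar>z t\<bar> + ((6 + K) * \<bar>u t\<bar> + 2 * \<mu> * \<bar>u t\<bar>)"
      by (simp_all add: h_def B_def algebra_simps)
    show "\<bar>u t\<bar> + \<bar>(V t + 4 * (\<rho> t)\<^sup>2) * u t + 2 * \<mu> * z t\<bar> \<le> h t"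
      using a(1) m(1) n h(1) abs_triangle_ineq[of "(V t + 4 * (\<rho> t)\<^sup>2) * u t" "2 * \<mu> * z t"] by linarith
    show "\<bar>z t\<bar> + \<bar>2 * \<mu> * u t + V t * z t\<bar> \<le> h t"
      using a(2) m(2) n h(2) abs_triangle_ineq[of "2 * \<mu> * u t" "V t * z t"] by linarith
  qed
  have "((\<lambda>x. 10 * integral {x..x+1} (\<lambda>t. \<bar>h t\<bar>)) \<longlongrightarrow> 10 * 0) at_top"
    by (intro tendsto_mult tendsto_const square_integrable_window_tendsto_0 hc hi)
  then have l: "((\<lambda>x. 10 * integral {x..x+1} (\<lambda>t. \<bar>h t\<bar>)) \<longlongrightarrow> 0) at_top" by simp
  have to0: "(f \<longlongrightarrow> 0) at_top" if "\<And>x. 1 \<le> x \<Longrightarrow> \<bar>f x\<bar> \<le> 10 * integral {x..x+1} (\<lambda>t. \<bar>h t\<bar>)" for f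
  proof (rule tendsto_0_le[OF l, where K = 1], rule eventually_at_top_linorderI)
    fix x :: real assume "1 \<le> x"
    from that[OF this] show "norm (f x) \<le> norm (10 * integral {x..x+1} (\<lambda>t. \<bar>h t\<bar>)) * 1" by simp
  qed
  have du: "(u has_real_derivative u' t) (at t)" "(z has_real_derivative z' t) (at t)"
    "(u' has_real_derivative (V t + 4 * (\<rho> t)\<^sup>2) * u t + 2 * \<mu> * z t) (at t)"
    "(z' has_real_derivative 2 * \<mu> * u t + V t * z t) (at t)" if "1 \<le> t" for t
    using u[of t] z[of t] u'[of t] z'[of t] that by auto
  note U = ode_window_bounds[OF du(1,3) hc bu] and Z = ode_window_bounds[OF du(2,4) hc bz]
  show "(u \<longlongrightarrow> 0) at_top" by (rule to0[OF U(1)])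
  show "(u' \<longlongrightarrow> 0) at_top" by (rule to0[OF U(2)])
  show "(z \<longlongrightarrow> 0) at_top" by (rule to0[OF Z(1)])
  show "(z' \<longlongrightarrow> 0) at_top" by (rule to0[OF Z(2)])
qed

lemma eventually_zero_imp_zero:
  assumes c: "c > 0" "\<And>s. c \<le> s \<Longrightarrow> u s = 0 \<and> z s = 0" and x: "x > 0"
  shows "u x = 0 \<and> z x = 0"
proof -
  \<comment> \<open>The point c + 1 is interior to the region where \<open>u\<close> and
    \<open>z\<close> vanish, so the two-sided derivatives vanish there as well and provide Cauchy
    data for uniqueness.\<close>
  have d0: "d = 0" if "(f has_real_derivative d) (at (c + 1))" "\<And>s. c \<le> s \<Longrightarrow> f s = 0" for f d
  proof -
    have "((\<lambda>_. 0) has_real_derivative d) (at (c + 1))"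
      by (rule has_field_derivative_transform_within_open[OF that(1), of "{c<..}"]) (use that(2) in auto)
    then show ?thesis using DERIV_unique DERIV_const by blast
  qed
  show ?thesis
  proof (rule linear_system_unique[of u u' "\<lambda>x. V x + 4 * (\<rho> x)\<^sup>2" "\<lambda>_. 2 * \<mu>" z z' "\<lambda>_. 2 * \<mu>" V "c + 1"])
    show "continuous_on {0<..} (\<lambda>x. V x + 4 * (\<rho> x)\<^sup>2)"
      by (intro continuous_intros V_continuous rho_continuous)
    show "u' (c + 1) = 0" by (rule d0[OF u]) (use c in auto)
    show "z' (c + 1) = 0" by (rule d0[OF z]) (use c in auto)
  qed (use c x u u' z z' V_continuous in auto)
qed

text \<open>The eigenvector (S + 1, \<mu>) of the growing eigenvalue has positive entries, so once q
  is small against p both \<open>u\<close> and \<open>z\<close> follow the sign of p. A zero of p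
  far out would annihilate the whole mode, hence p keeps its sign.\<close>

lemma same_sign_at_top:
  assumes nz: "x1 > 0" "\<not> (u x1 = 0 \<and> z x1 = 0)"
  obtains R where "R \<ge> 1" "(\<forall>x\<ge>R. u x > 0 \<and> z x > 0) \<or> (\<forall>x\<ge>R. u x < 0 \<and> z x < 0)"
proof -
  define S where "S = sqrt (1 + \<mu>\<^sup>2)"
  have S2: "S\<^sup>2 = 1 + \<mu>\<^sup>2" by (simp add: S_def)
  have \<mu>2: "\<mu>\<^sup>2 \<ge> 17/64"
  proof -
    have "(sqrt 17 / 8)\<^sup>2 \<le> \<mu>\<^sup>2" using \<mu> by (intro power_mono) auto
    then show ?thesis by (simp add: power_divide)
  qed
  have S98: "S \<ge> 9/8"
    unfolding S_def by (rule real_le_rsqrt) (use \<mu>2 in \<open>simp add: power2_eq_square\<close>)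
  have \<mu>S: "\<mu> \<le> S" unfolding S_def using \<mu>_pos by (intro real_le_rsqrt) simp
  \<comment> \<open>\<open>p\<close> and \<open>q\<close> diagonalise the limiting matrix with rows \<open>(17/4, 2\<mu>)\<close> and \<open>(2\<mu>, 1/4)\<close>,
    whose eigenvalues are \<open>9/4 \<plusminus> 2S\<close>; the bound on \<open>\<mu>\<close> makes the smaller one non-positive.\<close>
  define p p' q q' where "p x = (S + 1) * u x + \<mu> * z x" and "p' x = (S + 1) * u' x + \<mu> * z' x"
    and "q x = \<mu> * u x - (S + 1) * z x" and "q' x = \<mu> * u' x - (S + 1) * z' x" for x
  define d1 d2 where "d1 x = V x - 1/4" and "d2 x = V x + 4 * (\<rho> x)\<^sup>2 - 17/4" for x
  define e1 e2 where "e1 x = (S + 1) * (d2 x * u x) + \<mu> * (d1 x * z x)"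
    and "e2 x = \<mu> * (d2 x * u x) - (S + 1) * (d1 x * z x)" for x
  define m where "m = 9/4 + 2 * S"
  define \<kappa> where "\<kappa> = sqrt (2 * S - 9/4)"
  have \<kappa>2: "\<kappa>\<^sup>2 = 2 * S - 9/4" using S98 by (simp add: \<kappa>_def)
  \<comment> \<open>The matrix with rows (S + 1, \<mu>) and (\<mu>, -(S + 1)) is symmetric and
    squares to D times the identity, so up to this factor it is its own inverse.\<close>
  define D where "D = (S + 1)\<^sup>2 + \<mu>\<^sup>2"
  have uD: "D * u x = (S + 1) * p x + \<mu> * q x" and zD: "D * z x = \<mu> * p x - (S + 1) * q x" for x
    by (simp_all add: D_def p_def q_def algebra_simps power2_eq_square)
  have "S + 1 \<le> (S + 1)\<^sup>2" using S98 by (intro self_le_power) auto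
  then have DS: "S + 1 \<le> D" unfolding D_def by (intro add_increasing2) auto
  have D0: "D > 0" using DS S98 by simp
  have bound: "\<bar>w\<bar> \<le> \<bar>a\<bar> + \<bar>b\<bar>" if "D * w = c * a + d * b" "\<bar>c\<bar> \<le> D" "\<bar>d\<bar> \<le> D" for w a b c d
  proof -
    have "D * \<bar>w\<bar> = \<bar>D * w\<bar>" using D0 by (simp add: abs_mult)
    also have "\<dots> \<le> \<bar>c\<bar> * \<bar>a\<bar> + \<bar>d\<bar> * \<bar>b\<bar>"
      unfolding that(1) using abs_triangle_ineq[of "c * a" "d * b"] by (simp add: abs_mult)
    also have "\<dots> \<le> D * \<bar>a\<bar> + D * \<bar>b\<bar>"
      using that by (intro add_mono mult_right_mono) auto
    finally have "D * \<bar>w\<bar> \<le> D * (\<bar>a\<bar> + \<bar>b\<bar>)" by (simp add: algebra_simps)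
    then show ?thesis using D0 by simp
  qed
  have ub: "\<bar>u x\<bar> \<le> \<bar>p x\<bar> + \<bar>q x\<bar>" for x
    by (rule bound[OF uD]) (use DS S98 \<mu>S \<mu>_pos in auto)
  have zb: "\<bar>z x\<bar> \<le> \<bar>p x\<bar> + \<bar>q x\<bar>" for x
  proof (rule bound)
    show "D * z x = \<mu> * p x + (- (S + 1)) * q x" using zD[of x] by (simp add: algebra_simps)
  qed (use DS S98 \<mu>S \<mu>_pos in auto)
  obtain K where K: "K \<ge> 0" "\<And>r. r \<ge> 1 \<Longrightarrow> \<bar>d1 r\<bar> \<le> K * exp (- r)"
    "\<And>r. r \<ge> 1 \<Longrightarrow> \<bar>d2 r\<bar> \<le> K * exp (- r)" using V_decay unfolding d1_def d2_def by blast
  have eb: "\<bar>c * (d2 x * u x) + d * (d1 x * z x)\<bar> \<le> (2 * (S + 1) * K) * exp (- x) * (\<bar>p x\<bar> + \<bar>q x\<bar>)"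
    if x: "1 \<le> x" and cd: "\<bar>c\<bar> \<le> S + 1" "\<bar>d\<bar> \<le> S + 1" for x c d
  proof -
    have one: "\<bar>c * (d2 x * u x)\<bar> \<le> (S + 1) * (K * exp (- x) * (\<bar>p x\<bar> + \<bar>q x\<bar>))"
      unfolding abs_mult using K(1) K(3)[OF x] ub[of x] cd S98 by (intro mult_mono) auto
    have two: "\<bar>d * (d1 x * z x)\<bar> \<le> (S + 1) * (K * exp (- x) * (\<bar>p x\<bar> + \<bar>q x\<bar>))"
      unfolding abs_mult using K(1) K(2)[OF x] zb[of x] cd S98 by (intro mult_mono) auto
    have "(2 * (S + 1) * K) * exp (- x) * (\<bar>p x\<bar> + \<bar>q x\<bar>)
        = 2 * ((S + 1) * (K * exp (- x) * (\<bar>p x\<bar> + \<bar>q x\<bar>)))" by (simp only: mult.assoc)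
    then show ?thesis
      using one two abs_triangle_ineq[of "c * (d2 x * u x)" "d * (d1 x * z x)"] by linarith
  qed
  have dp': "(p' has_real_derivative m * p x + e1 x) (at x)" if "0 < x" for x
  proof -
    have "(p' has_real_derivative (S + 1) * ((V x + 4 * (\<rho> x)\<^sup>2) * u x + 2 * \<mu> * z x)
        + \<mu> * (2 * \<mu> * u x + V x * z x)) (at x)"
      unfolding p'_def by (intro DERIV_add DERIV_cmult u' z' that)
    \<comment> \<open>The eigenvector condition: the remaining multiple of \<open>u\<close> carries
      the factor \<mu>^2 + 1 - S^2, which is zero.\<close>
    moreover have "(S + 1) * ((V x + 4 * (\<rho> x)\<^sup>2) * u x + 2 * \<mu> * z x)
        + \<mu> * (2 * \<mu> * u x + V x * z x) = m * p x + e1 x + 2 * (\<mu>\<^sup>2 + 1 - S\<^sup>2) * u x"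
      by (simp add: m_def p_def e1_def d1_def d2_def field_simps power2_eq_square)
    ultimately show ?thesis by (simp add: S2)
  qed
  have dq': "(q' has_real_derivative - \<kappa>\<^sup>2 * q x + e2 x) (at x)" if "0 < x" for x
  proof -
    have "(q' has_real_derivative \<mu> * ((V x + 4 * (\<rho> x)\<^sup>2) * u x + 2 * \<mu> * z x)
        - (S + 1) * (2 * \<mu> * u x + V x * z x)) (at x)"
      unfolding q'_def by (intro DERIV_diff DERIV_cmult u' z' that)
    moreover have "\<mu> * ((V x + 4 * (\<rho> x)\<^sup>2) * u x + 2 * \<mu> * z x)
        - (S + 1) * (2 * \<mu> * u x + V x * z x) = - \<kappa>\<^sup>2 * q x + e2 x + 2 * (\<mu>\<^sup>2 + 1 - S\<^sup>2) * z x"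
      unfolding \<kappa>2 by (simp add: q_def e2_def d1_def d2_def field_simps power2_eq_square)
    ultimately show ?thesis by (simp add: S2)
  qed
  have lims: "(p \<longlongrightarrow> 0) at_top" "(q \<longlongrightarrow> 0) at_top" "(q' \<longlongrightarrow> 0) at_top"
  proof -
    have "((\<lambda>x. (S + 1) * u x + \<mu> * z x) \<longlongrightarrow> (S + 1) * 0 + \<mu> * 0) at_top"
      by (intro tendsto_intros tendsto_0)
    then show "(p \<longlongrightarrow> 0) at_top" by (simp add: p_def[abs_def])
    have "((\<lambda>x. \<mu> * u x - (S + 1) * z x) \<longlongrightarrow> \<mu> * 0 - (S + 1) * 0) at_top"
      by (intro tendsto_intros tendsto_0)
    then show "(q \<longlongrightarrow> 0) at_top" by (simp add: q_def[abs_def])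
    have "((\<lambda>x. \<mu> * u' x - (S + 1) * z' x) \<longlongrightarrow> \<mu> * 0 - (S + 1) * 0) at_top"
      by (intro tendsto_intros tendsto_0)
    then show "(q' \<longlongrightarrow> 0) at_top" by (simp add: q'_def[abs_def])
  qed
  have dp: "(p has_real_derivative p' x) (at x)" if "0 < x" for x
    unfolding p_def p'_def by (intro DERIV_add DERIV_cmult u z that)
  have dq: "(q has_real_derivative q' x) (at x)" if "0 < x" for x
    unfolding q_def q'_def by (intro DERIV_diff DERIV_cmult u z that)
  \<comment> \<open>The binding case is \<open>z\<close>, where \<mu> p must beat (S + 1) q; this
    \<eta> leaves a margin of one half. For \<open>u\<close> it suffices that \<mu> \<eta> < S +
    1.\<close>
  define \<eta> where "\<eta> = \<mu> / (2 * (S + 1))"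
  have \<eta>: "0 < \<eta>" "\<eta> \<le> 1" using \<mu>_pos \<mu>S S98 by (auto simp: \<eta>_def)
  have \<eta>S: "(S + 1) * \<eta> = \<mu> / 2" using S98 by (simp add: \<eta>_def field_simps)
  have "e1 = (\<lambda>x. (S + 1) * (d2 x * u x) + \<mu> * (d1 x * z x))"
    "e2 = (\<lambda>x. \<mu> * (d2 x * u x) + (- (S + 1)) * (d1 x * z x))" by (auto simp: e1_def e2_def algebra_simps)
  then have e: "\<bar>e1 x\<bar> \<le> (2 * (S + 1) * K) * exp (- x) * (\<bar>p x\<bar> + \<bar>q x\<bar>)"
    "\<bar>e2 x\<bar> \<le> (2 * (S + 1) * K) * exp (- x) * (\<bar>p x\<bar> + \<bar>q x\<bar>)" if "1 \<le> x" for x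
    using eb[OF that, of "S + 1" \<mu>] eb[OF that, of \<mu> "- (S + 1)"] S98 \<mu>S \<mu>_pos by auto
  obtain R where R: "R \<ge> 1"
    "\<And>x s. R \<le> x \<Longrightarrow> x \<le> s \<Longrightarrow> \<bar>p s\<bar> \<le> \<bar>p x\<bar> \<and> \<bar>q s\<bar> \<le> \<eta> * \<bar>p x\<bar>"
  proof (rule split_system_asymptotics[OF dp dp' dq dq' _ _ _ e lims \<eta>])
    show "0 < m" using S98 by (simp add: m_def)
    show "0 \<le> \<kappa>" using S98 by (simp add: \<kappa>_def)
    show "0 \<le> 2 * (S + 1) * K" using K S98 by simp
  qed blast+
  have pnz: "p x \<noteq> 0" if x: "R \<le> x" for x
  proof
    assume px: "p x = 0"
    have "u s = 0 \<and> z s = 0" if "x \<le> s" for s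
      using R(2)[OF x that] px ub[of s] zb[of s] by auto
    then show False using eventually_zero_imp_zero[of x x1] nz x R by auto
  qed
  have pc: "continuous_on {R..} p"
    using dp R by (intro DERIV_continuous_on[where D = p']) (auto intro: has_field_derivative_at_within)
  have \<mu>S1: "\<mu> * \<eta> < S + 1"
  proof -
    have "\<mu> * \<eta> \<le> \<mu> * 1" using \<eta> \<mu>_pos by (intro mult_left_mono) auto
    then show ?thesis using \<mu>S by simp
  qed
  have pos: "\<sigma> * u x > 0 \<and> \<sigma> * z x > 0" if x: "R \<le> x" and \<sigma>: "\<bar>\<sigma>\<bar> = 1" "\<sigma> * p x > 0" for x \<sigma>
  proof -
    have ap: "\<bar>p x\<bar> = \<sigma> * p x" using \<sigma> by (metis abs_mult abs_of_pos mult_1)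
    have q1: "\<bar>\<sigma> * q x\<bar> \<le> \<eta> * (\<sigma> * p x)" using R(2)[OF x, of x] \<sigma>(1) ap by (simp add: abs_mult)
    have "\<bar>\<mu> * (\<sigma> * q x)\<bar> \<le> \<mu> * (\<eta> * (\<sigma> * p x))"
      unfolding abs_mult[of \<mu>] using q1 \<mu>_pos by (simp add: mult_left_mono)
    also have "\<dots> < (S + 1) * (\<sigma> * p x)" using mult_strict_right_mono[OF \<mu>S1 \<sigma>(2)] by (simp only: mult.assoc)
    finally have "(S + 1) * (\<sigma> * p x) + \<mu> * (\<sigma> * q x) > 0" by linarith
    moreover have "D * (\<sigma> * u x) = (S + 1) * (\<sigma> * p x) + \<mu> * (\<sigma> * q x)"
      using arg_cong[OF uD[of x], of "\<lambda>t. \<sigma> * t"] by (simp add: algebra_simps)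
    ultimately have 1: "\<sigma> * u x > 0" using D0 by (metis zero_less_mult_pos)
    have "\<bar>(S + 1) * (\<sigma> * q x)\<bar> \<le> (S + 1) * (\<eta> * (\<sigma> * p x))"
      unfolding abs_mult[of "S + 1"] using q1 S98 by (simp add: mult_left_mono)
    also have "\<dots> = (\<mu> / 2) * (\<sigma> * p x)" using \<eta>S by (simp flip: mult.assoc)
    also have "\<dots> < \<mu> * (\<sigma> * p x)" using \<mu>_pos \<sigma>(2) by (intro mult_strict_right_mono) auto
    finally have "\<mu> * (\<sigma> * p x) - (S + 1) * (\<sigma> * q x) > 0" by linarith
    moreover have "D * (\<sigma> * z x) = \<mu> * (\<sigma> * p x) - (S + 1) * (\<sigma> * q x)"
      using arg_cong[OF zD[of x], of "\<lambda>t. \<sigma> * t"] by (simp add: algebra_simps)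
    ultimately have 2: "\<sigma> * z x > 0" using D0 by (metis zero_less_mult_pos)
    from 1 2 show ?thesis ..
  qed
  have same: "p R * p x > 0" if x: "R \<le> x" for x
  proof (rule ccontr)
    assume n: "\<not> p R * p x > 0"
    have c: "continuous_on {R..x} p" by (rule continuous_on_subset[OF pc]) auto
    have "\<exists>t\<ge>R. t \<le> x \<and> p t = 0"
    proof (cases "p R \<le> 0")
      case True
      then have "p x \<ge> 0" using n pnz[of R] by (smt (verit) mult_neg_neg order_refl)
      then show ?thesis using IVT'[of p R 0 x] True x c by auto
    next
      case False
      then have "p x \<le> 0" using n by (simp add: zero_less_mult_iff not_less)
      then show ?thesis using IVT2'[of p x 0 R] False x c by auto
    qed
    then show False using pnz by blast
  qed
  show thesis
  proof (cases "p R > 0")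
    case True
    have "\<forall>x\<ge>R. u x > 0 \<and> z x > 0"
    proof (intro allI impI)
      fix x assume x: "R \<le> x"
      have "p x > 0" using same[OF x] True by (simp add: zero_less_mult_iff)
      then show "u x > 0 \<and> z x > 0" using pos[OF x, of 1] by simp
    qed
    then show ?thesis using that R by blast
  next
    case False
    have "\<forall>x\<ge>R. u x < 0 \<and> z x < 0"
    proof (intro allI impI)
      fix x assume x: "R \<le> x"
      have "p x < 0" using same[OF x] False by (simp add: zero_less_mult_iff)
      then show "u x < 0 \<and> z x < 0" using pos[OF x, of "-1"] by simp
    qed
    then show ?thesis using that R by blast
  qed
qed

lemma not_pos_at_top:
  assumes R: "R > 0" "\<And>x. R \<le> x \<Longrightarrow> u x > 0 \<and> z x > 0"
  shows False
proof -
  \<comment> \<open>The positive term 4 \<rho>^2 u joins the coupling in the forcing. Both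
    components then have the same operator y'' - V y as \<open>f0\<close>, with forcing that is
    positive wherever \<open>u\<close> and \<open>z\<close> are.\<close>
  define bu bz where "bu x = 4 * (\<rho> x)\<^sup>2 * u x + 2 * \<mu> * z x" and "bz x = 2 * \<mu> * u x" for x
  have du': "(u' has_real_derivative V x * u x + bu x) (at x)" if "0 < x" for x
    using u'[OF that] by (simp add: bu_def algebra_simps)
  have dz': "(z' has_real_derivative V x * z x + bz x) (at x)" if "0 < x" for x
    using z'[OF that] by (simp add: bz_def algebra_simps)
  have bpos: "bu x > 0 \<and> bz x > 0" if "u x > 0 \<and> z x > 0" for x
    using that \<mu>_pos unfolding bu_def bz_def by (auto intro!: add_nonneg_pos)
  have pos: "u x > 0 \<and> z x > 0" if x: "x > 0" for x
  proof (rule ccontr)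
    assume n: "\<not> (u x > 0 \<and> z x > 0)"
    have xR: "x < R" using n R(2)[of x] by (cases "x < R") auto
    \<comment> \<open>The maximum \<open>c\<close> of this compact set is the last point where
      positivity fails. Everything to its right is positive, so the Wronskian argument makes
      \<open>u\<close> and \<open>z\<close> positive at \<open>c\<close> too.\<close>
    define T where "T = {t \<in> {x..R}. min (u t) (z t) \<le> 0}"
    have sub: "{x..R} \<subseteq> {0<..}" using x by auto
    have "closed T"
      unfolding T_def
      by (intro continuous_on_closed_Collect_le continuous_on_min continuous_on_const
          continuous_on_subset[OF u_continuous sub] continuous_on_subset[OF z_continuous sub]
          closed_atLeastAtMost)
    moreover have "bounded T" by (rule bounded_subset[OF bounded_closed_interval[of x R]]) (auto simp: T_def)
    ultimately have "compact T" by (simp add: compact_eq_bounded_closed)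
    moreover have "T \<noteq> {}" using n x xR by (auto simp: T_def intro!: exI[of _ x])
    ultimately obtain c where c: "c \<in> T" "\<And>t. t \<in> T \<Longrightarrow> t \<le> c"
      using compact_attains_sup[of T] by blast
    have c0: "c > 0" using c(1) x by (auto simp: T_def)
    have above: "u t > 0 \<and> z t > 0" if "c < t" for t
    proof (cases "t \<le> R")
      case True
      have "t \<notin> T" using c(2)[of t] that by force
      moreover have "t \<in> {x..R}" using True that c(1) by (auto simp: T_def)
      ultimately show ?thesis unfolding T_def min_le_iff_disj mem_Collect_eq by linarith
    qed (use R(2)[of t] in auto)
    have "u c > 0"
      by (rule wronskian_neg(3)[OF c0 u du']) (use above bpos tendsto_0 in auto)
    moreover have "z c > 0"
      by (rule wronskian_neg(3)[OF c0 z dz']) (use above bpos tendsto_0 in auto)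
    ultimately show False using c(1) by (auto simp: T_def)
  qed
  define W where "W x = f0 x * z' x - f0' x * z x" for x
  have Wmono: "W x < W s" if "0 < x" "x < s" for x s
    unfolding W_def by (rule wronskian_neg(1)[OF that(1) z dz']) (use that pos bpos tendsto_0 in auto)
  have Wneg: "W x < 0" if "0 < x" for x
    unfolding W_def by (rule wronskian_neg(2)[OF that z dz']) (use that pos bpos tendsto_0 in auto)
  obtain r0 \<alpha> A where r0: "0 < r0" "0 < \<alpha>" "0 < A"
    and lo: "\<And>r. 0 < r \<Longrightarrow> r \<le> r0 \<Longrightarrow> \<alpha> * (r * sqrt r) \<le> f0 r"
    and hi: "\<And>r. 0 < r \<Longrightarrow> r \<le> r0 \<Longrightarrow> f0 r \<le> A * (r * sqrt r)" using f0_near_0 by metis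
  define w where "w = - W r0"
  have w: "w > 0" using Wneg[OF r0(1)] by (simp add: w_def)
  have Ww: "W x \<le> - w" if "0 < x" "x \<le> r0" for x
    using Wmono[of x r0] that by (cases "x = r0") (auto simp: w_def)
  define \<phi> where "\<phi> x = z x / f0 x" for x
  have d\<phi>: "(\<phi> has_real_derivative W x / (f0 x)\<^sup>2) (at x)" if "x > 0" for x
    unfolding \<phi>_def W_def using deriv_f0[OF that] z[OF that] f0_pos[OF that]
    by (auto intro!: derivative_eq_intros simp: field_simps power2_eq_square)
  \<comment> \<open>Since \<open>f0\<close>^2 \<le> A^2 t^3 and W \<le> -w near 0, the derivative of
    \<phi> is at most -w / (A^2 t^3), which for this \<open>k\<close> is the derivative of k / t^2.
    So \<phi> exceeds k / x^2 up to a constant, and z = \<phi> \<open>f0\<close> is at least of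
    order x^(-1/2).\<close>
  define k where "k = w / (2 * A\<^sup>2)"
  have k: "k > 0" using w r0 by (simp add: k_def)
  have "\<phi> x - k / x\<^sup>2 \<ge> \<phi> r0 - k / r0\<^sup>2" if x: "0 < x" "x \<le> r0" for x
  proof (rule DERIV_nonpos_imp_nonincreasing[OF x(2), where f = "\<lambda>x. \<phi> x - k / x\<^sup>2"])
    fix t assume t: "x \<le> t" "t \<le> r0"
    then have t0: "t > 0" using x by simp
    have "((\<lambda>x. k / x\<^sup>2) has_real_derivative - (2 * k / t ^ 3)) (at t)"
      using t0 by (auto intro!: derivative_eq_intros simp: field_simps power2_eq_square power3_eq_cube)
    then have D: "((\<lambda>x. \<phi> x - k / x\<^sup>2) has_real_derivative W t / (f0 t)\<^sup>2 - (- (2 * k / t ^ 3))) (at t)"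
      by (intro DERIV_diff d\<phi> t0)
    have f2: "(f0 t)\<^sup>2 \<le> A\<^sup>2 * t ^ 3"
    proof -
      have "(f0 t)\<^sup>2 \<le> (A * (t * sqrt t))\<^sup>2" using hi[OF t0 t(2)] f0_pos[OF t0] by (intro power_mono) auto
      also have "\<dots> = A\<^sup>2 * t ^ 3" using t0 by (simp add: power_mult_distrib power3_eq_cube power2_eq_square)
      finally show ?thesis .
    qed
    have "w / (A\<^sup>2 * t ^ 3) \<le> w / (f0 t)\<^sup>2"
      using f0_pos[OF t0] w r0 t0 by (intro divide_left_mono f2 mult_pos_pos zero_less_power) auto
    then have wf: "(- w) / (f0 t)\<^sup>2 \<le> (- w) / (A\<^sup>2 * t ^ 3)" by simp
    have "W t / (f0 t)\<^sup>2 \<le> (- w) / (f0 t)\<^sup>2" using Ww[OF t0 t(2)] by (intro divide_right_mono) auto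
    also have "\<dots> \<le> (- w) / (A\<^sup>2 * t ^ 3)" by (rule wf)
    also have "\<dots> = - (2 * k / t ^ 3)" using r0 t0 by (simp add: k_def field_simps)
    finally have "W t / (f0 t)\<^sup>2 - (- (2 * k / t ^ 3)) \<le> 0" by simp
    with D show "\<exists>y. ((\<lambda>x. \<phi> x - k / x\<^sup>2) has_real_derivative y) (at t) \<and> y \<le> 0" by blast
  qed
  moreover have "\<phi> r0 > 0" using pos[OF r0(1)] f0_pos[OF r0(1)] by (simp add: \<phi>_def)
  ultimately have \<phi>lo: "\<phi> x \<ge> k / x\<^sup>2 - k / r0\<^sup>2" if "0 < x" "x \<le> r0" for x using that by fastforce
  \<comment> \<open>For x below half of \<open>r0\<close> the constant k / r0^2 is at most a quarter
    of k / x^2, so at least half of the main term survives the subtraction.\<close>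
  define r1 where "r1 = r0 / 2"
  have r1: "0 < r1" "r1 \<le> r0" using r0 by (auto simp: r1_def)
  define c where "c = ((1/2) * k * \<alpha>)\<^sup>2"
  have c: "c > 0" using k r0 by (simp add: c_def)
  have zlo: "c / x \<le> (z x)\<^sup>2" if x: "0 < x" "x \<le> r1" for x
  proof -
    have xr0: "x \<le> r0" using x r1 by simp
    have "(2 * x)\<^sup>2 \<le> r0\<^sup>2" using x by (intro power_mono) (auto simp: r1_def)
    then have "k / r0\<^sup>2 \<le> k / (2 * x)\<^sup>2" using k x r0 by (intro divide_left_mono) auto
    also have "\<dots> \<le> (1/2) * (k / x\<^sup>2)" using k x by (simp add: power_mult_distrib field_simps)
    finally have "\<phi> x \<ge> (1/2) * (k / x\<^sup>2)" using \<phi>lo[OF x(1) xr0] by linarith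
    moreover have "\<phi> x \<ge> 0" using pos[OF x(1)] f0_pos[OF x(1)] by (simp add: \<phi>_def)
    ultimately have "(1/2) * (k / x\<^sup>2) * (\<alpha> * (x * sqrt x)) \<le> \<phi> x * f0 x"
      using lo[OF x(1) xr0] k x r0 f0_pos[OF x(1)] by (intro mult_mono) auto
    also have "\<dots> = z x" using f0_pos[OF x(1)] by (simp add: \<phi>_def)
    finally have "((1/2) * (k / x\<^sup>2) * (\<alpha> * (x * sqrt x)))\<^sup>2 \<le> (z x)\<^sup>2"
      using k x r0 by (intro power_mono) auto
    moreover have "((1/2) * (k / x\<^sup>2) * (\<alpha> * (x * sqrt x)))\<^sup>2 = c / x"
      using x by (simp add: c_def power_mult_distrib power_divide field_simps power2_eq_square)
    ultimately show ?thesis by simp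
  qed
  have zi: "(\<lambda>x. (z x)\<^sup>2) integrable_on {a..b}" if "0 < a" for a b
    by (intro integrable_continuous_real continuous_intros continuous_on_subset[OF z_continuous])
      (use that in auto)
  define I where "I = integral {0<..} (\<lambda>x. (z x)\<^sup>2)"
  have lnb: "c * t \<le> I" if t: "t \<ge> 0" for t
  proof -
    \<comment> \<open>With this lower limit the integral of c / x up to \<open>r1\<close> is exactly
      c t, which is unbounded in t.\<close>
    define a where "a = r1 * exp (- t)"
    have a: "0 < a" "a \<le> r1" using r1 t by (auto simp: a_def mult_le_cancel_left1)
    have "((\<lambda>x. c / x) has_integral (c * ln r1 - c * ln a)) {a..r1}"
    proof (rule fundamental_theorem_of_calculus[OF a(2)])
      fix x assume "x \<in> {a..r1}"
      then have "((\<lambda>x. c * ln x) has_real_derivative c / x) (at x within {a..r1})"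
        using a by (auto intro!: derivative_eq_intros)
      then show "((\<lambda>x. c * ln x) has_vector_derivative c / x) (at x within {a..r1})"
        by (simp add: has_real_derivative_iff_has_vector_derivative)
    qed
    moreover have "c * ln r1 - c * ln a = c * t"
      using r1 by (simp add: a_def ln_mult algebra_simps)
    ultimately have h: "((\<lambda>x. c / x) has_integral c * t) {a..r1}" by simp
    have "c * t = integral {a..r1} (\<lambda>x. c / x)" using h by (simp add: integral_unique)
    also have "\<dots> \<le> integral {a..r1} (\<lambda>x. (z x)\<^sup>2)"
      using h a zlo by (intro integral_le zi) (auto simp: integrable_on_def)
    also have "\<dots> \<le> I" unfolding I_def
      by (intro integral_subset_le zi a set_lebesgue_integral_eq_integral(1)[OF int_z]) (use a in auto)
    finally show ?thesis .
  qed
  have I0: "I \<ge> 0" using lnb[of 0] by simp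
  have "c * ((I + 1) / c) \<le> I" using I0 c by (intro lnb) auto
  then show False using c by simp
qed

end

theorem (in gp_mode) mode_eq_0:
  assumes "x > 0"
  shows "u x = 0 \<and> z x = 0"
proof (rule ccontr)
  assume n: "\<not> (u x = 0 \<and> z x = 0)"
  from same_sign_at_top[OF assms n] obtain R where R: "R \<ge> 1"
    "(\<forall>x\<ge>R. u x > 0 \<and> z x > 0) \<or> (\<forall>x\<ge>R. u x < 0 \<and> z x < 0)" by blast
  \<comment> \<open>The system is linear and homogeneous, so the negated functions form a mode too,
    and the case of negative signs reduces to the positive one.\<close>
  interpret neg: gp_mode \<rho> \<mu> "\<lambda>x. - u x" "\<lambda>x. - u' x" "\<lambda>x. - z x" "\<lambda>x. - z' x"
  proof unfold_locales
    fix x :: real assume x: "0 < x"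
    show "((\<lambda>x. - u x) has_real_derivative - u' x) (at x)" "((\<lambda>x. - z x) has_real_derivative - z' x) (at x)"
      by (intro DERIV_minus u z x)+
    show "((\<lambda>x. - u' x) has_real_derivative (V x + 4 * (\<rho> x)\<^sup>2) * - u x + 2 * \<mu> * - z x) (at x)"
      using DERIV_minus[OF u'[OF x]] by simp
    show "((\<lambda>x. - z' x) has_real_derivative 2 * \<mu> * - u x + V x * - z x) (at x)"
      using DERIV_minus[OF z'[OF x]] by simp
  qed (use \<mu> int_u int_z in auto)
  show False using R(2)
  proof
    assume "\<forall>x\<ge>R. u x > 0 \<and> z x > 0"
    then show False using not_pos_at_top[of R] R(1) by auto
  next
    assume "\<forall>x\<ge>R. u x < 0 \<and> z x < 0"
    then show False using neg.not_pos_at_top[of R] R(1) by auto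
  qed
qed

section \<open>Test functions\<close>

text \<open>Iterates of \<open>deriv\<close> are awkward for products and quotients. Counting
  derivatives with an existential witness makes the closure properties plain inductions, and
  quantifying over all n recovers \<open>smooth_on UNIV\<close>.\<close>

primrec differentiable_upto :: "nat \<Rightarrow> (real \<Rightarrow> real) \<Rightarrow> bool" where
  "differentiable_upto 0 f \<longleftrightarrow> True"
| "differentiable_upto (Suc n) f \<longleftrightarrow> (\<exists>f'. (\<forall>x. (f has_real_derivative f' x) (at x)) \<and> differentiable_upto n f')"

lemma differentiable_upto_SucI: "(\<And>x. (f has_real_derivative f' x) (at x)) \<Longrightarrow> differentiable_upto n f' \<Longrightarrow> differentiable_upto (Suc n) f"
  by auto

lemma differentiable_upto_Suc_imp: "differentiable_upto (Suc n) f \<Longrightarrow> differentiable_upto n f"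
proof (induction n arbitrary: f)
  case (Suc n)
  then show ?case by (metis differentiable_upto.simps(2))
qed simp

lemma differentiable_upto_const: "differentiable_upto n (\<lambda>x. c)"
proof (induction n arbitrary: c)
  case (Suc n)
  show ?case by (rule differentiable_upto_SucI[where f' = "\<lambda>_. 0"]) (auto simp: Suc)
qed simp

lemma differentiable_upto_add: "differentiable_upto n f \<Longrightarrow> differentiable_upto n g \<Longrightarrow> differentiable_upto n (\<lambda>x. f x + g x)"
proof (induction n arbitrary: f g)
  case (Suc n)
  obtain f' g' where "\<And>x. (f has_real_derivative f' x) (at x)" "differentiable_upto n f'"
    "\<And>x. (g has_real_derivative g' x) (at x)" "differentiable_upto n g'"
    using Suc.prems by auto
  then show ?case
    by (intro differentiable_upto_SucI[where f' = "\<lambda>x. f' x + g' x"] Suc.IH) (auto intro!: derivative_intros)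
qed simp

lemma differentiable_upto_mult: "differentiable_upto n f \<Longrightarrow> differentiable_upto n g \<Longrightarrow> differentiable_upto n (\<lambda>x. f x * g x)"
proof (induction n arbitrary: f g)
  case (Suc n)
  obtain f' g' where d: "\<And>x. (f has_real_derivative f' x) (at x)" "differentiable_upto n f'"
    "\<And>x. (g has_real_derivative g' x) (at x)" "differentiable_upto n g'"
    using Suc.prems by auto
  have "differentiable_upto n f" "differentiable_upto n g" using Suc.prems differentiable_upto_Suc_imp by blast+
  then have "differentiable_upto n (\<lambda>x. f' x * g x + f x * g' x)"
    using d Suc.IH by (intro differentiable_upto_add) auto
  then show ?case
    by (intro differentiable_upto_SucI[where f' = "\<lambda>x. f' x * g x + f x * g' x"])
      (auto intro!: derivative_eq_intros d)
qed simp

lemma differentiable_upto_affine: "differentiable_upto n f \<Longrightarrow> differentiable_upto n (\<lambda>x. f (a * x + b))"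
proof (induction n arbitrary: f)
  case (Suc n)
  obtain f' where d: "\<And>x. (f has_real_derivative f' x) (at x)" "differentiable_upto n f'"
    using Suc.prems by auto
  have "((\<lambda>x. f (a * x + b)) has_real_derivative f' (a * x + b) * a) (at x)" for x
    by (rule DERIV_chain'[of "\<lambda>x. a * x + b"]) (auto intro!: derivative_eq_intros d)
  then show ?case
    by (intro differentiable_upto_SucI[where f' = "\<lambda>x. f' (a * x + b) * a"] differentiable_upto_mult differentiable_upto_const Suc.IH d) 
qed simp

lemma smooth_on_UNIV_iff: "smooth_on UNIV f \<longleftrightarrow> (\<forall>n. differentiable_upto n f)"
proof
  assume s: "smooth_on UNIV f"
  have "differentiable_upto n ((deriv ^^ k) f)" for n k
  proof (induction n arbitrary: k)
    case (Suc n)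
    have "((deriv ^^ k) f has_real_derivative (deriv ^^ (Suc k)) f x) (at x)" for x
      using s unfolding smooth_on_def by (simp add: field_differentiable_derivI)
    then show ?case using Suc by (intro differentiable_upto_SucI)
  qed simp
  from this[of _ 0] show "\<forall>n. differentiable_upto n f" by simp
next
  assume c: "\<forall>n. differentiable_upto n f"
  have "\<forall>n. differentiable_upto n ((deriv ^^ k) f)" for k
  proof (induction k)
    case (Suc k)
    show ?case
    proof
      fix n
      obtain f' where "\<And>x. ((deriv ^^ k) f has_real_derivative f' x) (at x)" "differentiable_upto n f'"
        using Suc[rule_format, of "Suc n"] by auto
      moreover from this have "(deriv ^^ Suc k) f = f'"
        by (auto intro!: ext DERIV_imp_deriv)
      ultimately show "differentiable_upto n ((deriv ^^ Suc k) f)" by simp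
    qed
  qed (use c in simp)
  then have "differentiable_upto (Suc 0) ((deriv ^^ k) f)" for k by blast
  then show "smooth_on UNIV f"
    unfolding smooth_on_def field_differentiable_def by auto
qed

text \<open>The powers in the denominator make the family closed under differentiation, so that
  smoothness of the standard function exp(-1/x) follows by induction over all k at once.\<close>

definition flat :: "nat \<Rightarrow> real \<Rightarrow> real" where
  "flat k x = (if x > 0 then exp (- (1 / x)) / x ^ k else 0)"

lemma flat_tendsto_0: "(flat k \<longlongrightarrow> 0) (at 0)"
proof -
  have "((\<lambda>y::real. y ^ k / exp y) \<longlongrightarrow> 0) at_top"
    by (rule tendsto_power_div_exp_0)
  then have "((\<lambda>x::real. (inverse x) ^ k / exp (inverse x)) \<longlongrightarrow> 0) (at_right 0)"
    by (rule filterlim_compose[OF _ filterlim_inverse_at_top_right])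
  moreover have "eventually (\<lambda>x::real. (inverse x) ^ k / exp (inverse x) = flat k x) (at_right 0)"
    unfolding eventually_at_right_field
    by (intro exI[of _ 1]) (auto simp: flat_def exp_minus field_simps)
  ultimately have "(flat k \<longlongrightarrow> 0) (at_right 0)"
    using tendsto_cong by fastforce
  moreover have "(flat k \<longlongrightarrow> 0) (at_left 0)"
  proof -
    have "eventually (\<lambda>x. flat k x = 0) (at_left (0::real))"
      unfolding eventually_at_left_field by (intro exI[of _ "-1"]) (auto simp: flat_def)
    then show ?thesis by (rule tendsto_eventually)
  qed
  ultimately show ?thesis by (simp add: filterlim_split_at)
qed

lemma flat_has_derivative:
  "(flat k has_real_derivative flat (k + 2) x - real k * flat (k + 1) x) (at x)"
proof -
  consider "x > 0" | "x < 0" | "x = 0" by linarith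
  then show ?thesis
  proof cases
    case 1
    have "((\<lambda>x. exp (- (1 / x)) / x ^ k) has_real_derivative
        flat (k + 2) x - real k * flat (k + 1) x) (at x)"
    proof (cases k)
      case (Suc j)
      show ?thesis
        using 1 unfolding Suc
        by (auto intro!: derivative_eq_intros simp: flat_def divide_simps power2_eq_square)
          (cases j; simp add: algebra_simps)
    qed (use 1 in \<open>auto intro!: derivative_eq_intros simp: flat_def field_simps power2_eq_square\<close>)
    then show ?thesis
      by (rule has_field_derivative_transform_within_open[where S = "{0<..}"])
         (use 1 in \<open>auto simp: flat_def\<close>)
  next
    case 2
    have "((\<lambda>x. 0::real) has_real_derivative flat (k + 2) x - real k * flat (k + 1) x) (at x)"
      using 2 by (auto simp: flat_def)
    then show ?thesis
      by (rule has_field_derivative_transform_within_open[where S = "{..<0}"])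
         (use 2 in \<open>auto simp: flat_def\<close>)
  next
    case 3
    \<comment> \<open>At the origin the difference quotient of \<open>flat k\<close> is
      \<open>flat (Suc k)\<close>, again a member of the family.\<close>
    have "((\<lambda>y. (flat k y - flat k 0) / (y - 0)) \<longlongrightarrow> 0) (at 0)"
      using flat_tendsto_0[of "Suc k"]
      by (rule Lim_transform_within[where d = 1]) (auto simp: flat_def field_simps)
    then show ?thesis using 3 by (simp add: has_field_derivative_iff flat_def)
  qed
qed

lemma differentiable_upto_flat: "differentiable_upto n (flat k)"
proof (induction n arbitrary: k)
  case (Suc n)
  have "differentiable_upto n (\<lambda>x. flat (k + 2) x + (- real k) * flat (k + 1) x)"
    by (intro differentiable_upto_add differentiable_upto_mult differentiable_upto_const Suc)
  then show ?case
    by (intro differentiable_upto_SucI[where f' = "\<lambda>x. flat (k + 2) x - real k * flat (k + 1) x"]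
      flat_has_derivative) simp
qed simp

definition test_on :: "real \<Rightarrow> real \<Rightarrow> (real \<Rightarrow> real) \<Rightarrow> bool" where
  "test_on a b \<phi> \<longleftrightarrow> (\<forall>n. differentiable_upto n \<phi>) \<and> (\<forall>x. x \<notin> {a..b} \<longrightarrow> \<phi> x = 0)"

lemma test_on_test_fun: "test_on a b \<phi> \<Longrightarrow> 0 < a \<Longrightarrow> a \<le> b \<Longrightarrow> test_fun \<phi>"
  unfolding test_on_def test_fun_def smooth_on_UNIV_iff by blast

lemma smooth_continuous: "\<forall>n. differentiable_upto n f \<Longrightarrow> continuous_on S f"
  by (metis differentiable_upto.simps(2) DERIV_continuous_on has_field_derivative_at_within)

lemma smooth_deriv:
  assumes "\<forall>n. differentiable_upto n f"
  shows "(f has_real_derivative deriv f x) (at x)" "differentiable_upto n (deriv f)"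
proof -
  have s: "smooth_on UNIV f" using assms smooth_on_UNIV_iff by blast
  then show 1: "(f has_real_derivative deriv f x) (at x)" for x
    unfolding smooth_on_def by (metis UNIV_I field_differentiable_derivI funpow_0)
  obtain f' where f': "\<forall>x. (f has_real_derivative f' x) (at x)" "differentiable_upto n f'"
    using assms differentiable_upto.simps(2) by blast
  then have "f' = deriv f" by (intro ext) (metis DERIV_imp_deriv)
  then show "differentiable_upto n (deriv f)" using f' by simp
qed

lemma zero_outside_deriv:
  fixes \<phi> :: "real \<Rightarrow> real"
  assumes "\<forall>x. x \<notin> {a..b} \<longrightarrow> \<phi> x = 0" "x \<notin> {a..b}"
  shows "deriv \<phi> x = 0"
proof -
  have "((\<lambda>x. 0) has_real_derivative 0) (at x)" by simp
  then have "(\<phi> has_real_derivative 0) (at x)"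
    by (rule has_field_derivative_transform_within_open[where S = "- {a..b}"])
       (use assms in auto)
  then show ?thesis by (rule DERIV_imp_deriv)
qed

lemma test_on_deriv: "test_on a b \<phi> \<Longrightarrow> test_on a b (deriv \<phi>)"
  using smooth_deriv zero_outside_deriv unfolding test_on_def by meson

lemma test_on_lincomb: 
  "test_on a b \<phi> \<Longrightarrow> test_on a b \<psi> \<Longrightarrow> test_on a b (\<lambda>x. \<phi> x + c * \<psi> x)"
  unfolding test_on_def by (auto intro!: differentiable_upto_add differentiable_upto_mult differentiable_upto_const)

lemma test_on_mono: "test_on a b \<phi> \<Longrightarrow> a' \<le> a \<Longrightarrow> b \<le> b' \<Longrightarrow> test_on a' b' \<phi>"
  unfolding test_on_def by auto

text \<open>The zero mean is what makes the antiderivative vanish again to the right of the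
  support.\<close>

lemma test_on_antiderivative:
  assumes \<psi>: "test_on a b \<psi>" and ab: "a \<le> b" and z: "integral {a..b} \<psi> = 0"
  obtains \<Psi> where "test_on a b \<Psi>" "\<And>x. (\<Psi> has_real_derivative \<psi> x) (at x)"
proof -
  have c: "continuous_on S \<psi>" for S using \<psi> smooth_continuous unfolding test_on_def by blast
  define \<Psi> where "\<Psi> x = (if x < a then 0 else integral {a..x} \<psi>)" for x
  \<comment> \<open>As \<psi> vanishes to the left of a, the lower limit can be moved as far left as
    desired. Every x then lies inside an interval of integration, and the fundamental theorem
    applies also at and below a.\<close>
  have E: "\<Psi> x = integral {a - 1 - d..x} \<psi>" if "d \<ge> 0" "x \<ge> a - 1 - d" for x d
  proof (cases "x < a")
    case True
    have "integral {a - 1 - d..x} \<psi> = integral {a - 1 - d..x} (\<lambda>x. 0)"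
      by (rule integral_cong) (use \<psi> True in \<open>auto simp: test_on_def\<close>)
    then show ?thesis using True by (simp add: \<Psi>_def)
  next
    case False
    have "integral {a - 1 - d..x} \<psi> = integral {a - 1 - d..a} \<psi> + integral {a..x} \<psi>"
      by (rule Henstock_Kurzweil_Integration.integral_combine[symmetric])
         (use False that c in \<open>auto intro: integrable_continuous_real\<close>)
    moreover have "integral {a - 1 - d..a} \<psi> = integral {a - 1 - d..a} (\<lambda>x. 0)"
      by (rule integral_spike[where S = "{a}"]) (use \<psi> in \<open>auto simp: test_on_def\<close>)
    ultimately show ?thesis using False by (simp add: \<Psi>_def)
  qed
  have d: "(\<Psi> has_real_derivative \<psi> x) (at x)" for x
  proof -
    define d where "d = \<bar>x\<bar> + \<bar>a\<bar> + 1"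
    have "((\<lambda>u. integral {a - 1 - d..u} \<psi>) has_real_derivative \<psi> x) (at x within {a - 1 - d..x+1})"
      by (rule integral_has_real_derivative) (use c in \<open>auto simp: d_def\<close>)
    then have "((\<lambda>u. integral {a - 1 - d..u} \<psi>) has_real_derivative \<psi> x) (at x)"
      by (simp add: at_within_Icc_at d_def)
    then show ?thesis
      by (rule has_field_derivative_transform_within_open[where S = "{a - 1 - d<..}"])
        (use E[of d] in \<open>auto simp: d_def\<close>)
  qed
  have "differentiable_upto n \<Psi>" for n
    using d \<psi> by (cases n) (auto simp: test_on_def)
  moreover have "\<Psi> x = 0" if "x \<notin> {a..b}" for x
  proof (cases "x < a")
    case True then show ?thesis by (simp add: \<Psi>_def)
  next
    case False
    then have "x > b" using that by auto
    have "integral {a..x} \<psi> = integral {a..b} \<psi> + integral {b..x} \<psi>"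
      by (rule Henstock_Kurzweil_Integration.integral_combine[symmetric])
         (use \<open>x > b\<close> ab c in \<open>auto intro: integrable_continuous_real\<close>)
    moreover have "integral {b..x} \<psi> = integral {b..x} (\<lambda>x. 0)"
      by (rule integral_spike[where S = "{b}"]) (use \<psi> in \<open>auto simp: test_on_def\<close>)
    ultimately show ?thesis using False z by (simp add: \<Psi>_def)
  qed
  ultimately show thesis using that[of \<Psi>] d by (auto simp: test_on_def)
qed

lemma bump_exists:
  fixes a b :: real
  assumes "a < b"
  obtains \<eta> where "test_on a b \<eta>" "\<And>x. \<eta> x \<ge> 0" "integral {a..b} \<eta> = 1"
proof -
  define g where "g x = flat 0 (1 * x + (- a)) * flat 0 ((-1) * x + b)" for x
  have C: "differentiable_upto n g" for n unfolding g_def by (intro differentiable_upto_mult differentiable_upto_affine differentiable_upto_flat)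
  then have cont: "continuous_on S g" for S using smooth_continuous by blast
  have nn: "g x \<ge> 0" for x by (simp add: g_def flat_def)
  have sup: "g x = 0" if "x \<notin> {a..b}" for x using that by (auto simp: g_def flat_def)
  have "g ((a+b)/2) > 0" using assms by (auto simp: g_def flat_def field_simps)
  then have "integral {a..b} g \<noteq> 0"
    using integral_eq_0_iff[of a b g] cont nn assms
    by (metis atLeastAtMost_iff dual_order.order_iff_strict field_sum_of_halves le_cases less_divide_eq_numeral1(1) linorder_not_less mult_2_right add_less_cancel_left add_less_cancel_right gt_half_sum less_half_sum)
  moreover have "integral {a..b} g \<ge> 0"
    by (rule integral_nonneg) (use cont nn in \<open>auto intro: integrable_continuous_real\<close>)
  ultimately have p: "integral {a..b} g > 0" by simp
  define I where "I = integral {a..b} g"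
  show thesis
  proof
    show "test_on a b (\<lambda>x. (1 / I) * g x)"
      unfolding test_on_def by (intro conjI allI impI differentiable_upto_mult differentiable_upto_const C) (simp add: sup)
    show "(1 / I) * g x \<ge> 0" for x using p nn by (simp add: I_def)
    show "integral {a..b} (\<lambda>x. (1 / I) * g x) = 1"
      using p by (subst integral_mult_right) (simp add: I_def)
  qed
qed

lemma smooth_step_exists:
  obtains \<theta> :: "real \<Rightarrow> real" where "\<And>n. differentiable_upto n \<theta>" "\<And>x. x \<le> 0 \<Longrightarrow> \<theta> x = 0" "\<And>x. x \<ge> 1 \<Longrightarrow> \<theta> x = 1"
    "\<And>x. 0 \<le> \<theta> x" "\<And>x. \<theta> x \<le> 1"
proof -
  define D where "D x = flat 0 x + flat 0 ((-1) * x + 1)" for x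
  have D: "D x > 0" for x by (auto simp: D_def flat_def add_pos_pos)
  have Dc: "differentiable_upto n D" for n unfolding D_def by (intro differentiable_upto_add differentiable_upto_affine differentiable_upto_flat)
  have "differentiable_upto n (\<lambda>x. 1 / D x)" for n
  proof (induction n)
    case (Suc n)
    obtain D' where D': "\<And>x. (D has_real_derivative D' x) (at x)" "differentiable_upto n D'"
      using Dc[of "Suc n"] by auto
    have "((\<lambda>x. 1 / D x) has_real_derivative (-1) * D' x * ((1 / D x) * (1 / D x))) (at x)" for x
      using D[of x] by (auto intro!: derivative_eq_intros D' simp: field_simps)
    then show ?case
      by (intro differentiable_upto_SucI[where f' = "\<lambda>x. (-1) * D' x * ((1 / D x) * (1 / D x))"]
          differentiable_upto_mult differentiable_upto_const D' Suc)
  qed simp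
  then have "differentiable_upto n (\<lambda>x. flat 0 x * (1 / D x))" for n by (intro differentiable_upto_mult differentiable_upto_flat)
  moreover have "flat 0 x \<ge> 0" "flat 0 x \<le> D x" for x by (auto simp: flat_def D_def)
  ultimately show thesis
    by (intro that[of "\<lambda>x. flat 0 x * (1 / D x)"])
      (auto simp: flat_def D_def field_simps add_pos_pos)
qed

section \<open>Weak derivatives\<close>

lemma test_funE:
  assumes "test_fun \<phi>"
  obtains a b where "0 < a" "a \<le> b" "test_on a b \<phi>"
  using assms unfolding test_fun_def test_on_def smooth_on_UNIV_iff by blast

lemma test_fun_deriv: "test_fun \<phi> \<Longrightarrow> test_fun (deriv \<phi>)"
  by (meson test_funE test_on_deriv test_on_test_fun)

lemma test_fun_has_deriv: "test_fun \<phi> \<Longrightarrow> (\<phi> has_real_derivative deriv \<phi> x) (at x)"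
  unfolding test_fun_def smooth_on_UNIV_iff using smooth_deriv(1) by blast

lemma test_fun_continuous: "test_fun \<phi> \<Longrightarrow> continuous_on S \<phi>"
  unfolding test_fun_def smooth_on_UNIV_iff using smooth_continuous by blast

lemma test_fun_lincomb:
  assumes "test_fun \<phi>" "test_fun \<psi>"
  shows "test_fun (\<lambda>x. \<phi> x + c * \<psi> x)"
proof -
  obtain a b where 1: "0 < a" "a \<le> b" "test_on a b \<phi>" using assms(1) test_funE by blast
  obtain a' b' where 2: "0 < a'" "a' \<le> b'" "test_on a' b' \<psi>" using assms(2) test_funE by blast
  have "test_on (min a a') (max b b') (\<lambda>x. \<phi> x + c * \<psi> x)"
    by (intro test_on_lincomb test_on_mono[OF 1(3)] test_on_mono[OF 2(3)]) auto
  then show ?thesis by (rule test_on_test_fun) (use 1 2 in auto)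
qed

section \<open>Local integrability and pairings with test functions\<close>

definition loc_int :: "(real \<Rightarrow> real) \<Rightarrow> bool" where
  "loc_int f \<longleftrightarrow> (\<forall>a b. 0 < a \<longrightarrow> f absolutely_integrable_on {a..b})"

lemma loc_intD: "loc_int f \<Longrightarrow> 0 < a \<Longrightarrow> f absolutely_integrable_on {a..b}"
  by (auto simp: loc_int_def)

lemma loc_int_integrable: "loc_int f \<Longrightarrow> 0 < a \<Longrightarrow> f integrable_on {a..b}"
  by (simp add: loc_intD set_lebesgue_integral_eq_integral(1))

lemma loc_int_continuous: "continuous_on {0<..} f \<Longrightarrow> loc_int f"
  unfolding loc_int_def
  by (auto intro!: absolutely_integrable_continuous_real elim: continuous_on_subset)

lemma loc_int_add: "loc_int f \<Longrightarrow> loc_int g \<Longrightarrow> loc_int (\<lambda>x. f x + g x)"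
  by (auto simp: loc_int_def intro!: set_integral_add)

lemma loc_int_diff: "loc_int f \<Longrightarrow> loc_int g \<Longrightarrow> loc_int (\<lambda>x. f x - g x)"
  by (auto simp: loc_int_def intro!: set_integral_diff)

lemma loc_int_mult_continuous:
  assumes "continuous_on {0<..} c" "loc_int f"
  shows "loc_int (\<lambda>x. c x * f x)"
  unfolding loc_int_def
proof (intro allI impI)
  fix a b :: real assume "0 < a"
  have c: "continuous_on {a..b} c"
    by (rule continuous_on_subset[OF assms(1)]) (use \<open>0 < a\<close> in auto)
  show "(\<lambda>x. c x * f x) absolutely_integrable_on {a..b}"
  proof (rule absolutely_integrable_bounded_measurable_product_real)
    show "c \<in> borel_measurable (lebesgue_on {a..b})"
      using c by (rule continuous_imp_measurable_on_sets_lebesgue) auto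
    show "bounded (c ` {a..b})"
      using c by (intro compact_imp_bounded compact_continuous_image) auto
  qed (use assms(2) \<open>0 < a\<close> in \<open>auto simp: loc_int_def\<close>)
qed

lemma loc_int_spike:
  assumes "loc_int f" "negligible {x. x > 0 \<and> f x \<noteq> g x}"
  shows "loc_int g"
  unfolding loc_int_def
proof (intro allI impI)
  fix a b :: real assume "0 < a"
  show "g absolutely_integrable_on {a..b}"
    by (rule absolutely_integrable_spike[OF loc_intD[OF assms(1) \<open>0 < a\<close>] assms(2)])
       (use \<open>0 < a\<close> in auto)
qed

lemma pairing_UNIV_eq:
  fixes f \<phi> :: "real \<Rightarrow> real"
  assumes "\<And>x. x \<notin> S \<Longrightarrow> \<phi> x = 0"
  shows "integral UNIV (\<lambda>x. f x * \<phi> x) = integral S (\<lambda>x. f x * \<phi> x)"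
proof -
  have "(\<lambda>x. f x * \<phi> x) = (\<lambda>x. if x \<in> S then f x * \<phi> x else 0)" using assms by auto
  then show ?thesis using integral_restrict_UNIV[of S "\<lambda>x. f x * \<phi> x"] by simp
qed

lemma pairing_integrable:
  assumes "loc_int f" "test_fun \<phi>"
  shows "(\<lambda>x. f x * \<phi> x) absolutely_integrable_on UNIV"
proof -
  obtain a b where ab: "0 < a" "a \<le> b" "test_on a b \<phi>" using assms test_funE by blast
  have "loc_int (\<lambda>x. \<phi> x * f x)"
    using assms by (intro loc_int_mult_continuous test_fun_continuous)
  then have "(\<lambda>x. f x * \<phi> x) absolutely_integrable_on {a..b}"
    using ab by (simp add: loc_int_def mult.commute)
  then have "(\<lambda>x. if x \<in> {a..b} then f x * \<phi> x else 0) absolutely_integrable_on UNIV"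
    by (rule absolutely_integrable_restrict_UNIV[THEN iffD2])
  moreover have "(\<lambda>x. f x * \<phi> x) = (\<lambda>x. if x \<in> {a..b} then f x * \<phi> x else 0)"
    using ab by (auto simp: test_on_def)
  ultimately show ?thesis by simp
qed

lemma pairing_integrable': 
  "loc_int f \<Longrightarrow> test_fun \<phi> \<Longrightarrow> (\<lambda>x. f x * \<phi> x) integrable_on UNIV"
  by (rule set_lebesgue_integral_eq_integral(1)[OF pairing_integrable])

lemma pairing_spike:
  fixes f g \<phi> :: "real \<Rightarrow> real"
  assumes "test_fun \<phi>" "negligible {x. x > 0 \<and> f x \<noteq> g x}"
  shows "integral UNIV (\<lambda>x. f x * \<phi> x) = integral UNIV (\<lambda>x. g x * \<phi> x)"
proof (rule integral_spike[OF assms(2)])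
  fix x assume "x \<in> UNIV - {x. x > 0 \<and> f x \<noteq> g x}"
  moreover have "\<phi> x = 0" if "x \<le> 0"
    using assms(1) that by (auto simp: test_fun_def)
  ultimately show "g x * \<phi> x = f x * \<phi> x" by (cases "x > 0") auto
qed

lemma test_fun_antiderivative:
  assumes "test_fun \<psi>" "integral UNIV \<psi> = 0"
  obtains \<Psi> where "test_fun \<Psi>" "deriv \<Psi> = \<psi>"
proof -
  obtain a b where ab: "0 < a" "a \<le> b" "test_on a b \<psi>" using assms test_funE by blast
  have "integral {a..b} \<psi> = 0"
    using pairing_UNIV_eq[of "{a..b}" \<psi> "\<lambda>_. 1"] ab assms by (simp add: test_on_def)
  from test_on_antiderivative[OF ab(3,2) this]
  obtain \<Psi> where "test_on a b \<Psi>" "\<And>x. (\<Psi> has_real_derivative \<psi> x) (at x)" by blast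
  moreover from this have "deriv \<Psi> = \<psi>" by (intro ext DERIV_imp_deriv)
  ultimately show thesis using that ab test_on_test_fun by blast
qed

text \<open>Lebesgue differentiation: at almost every point the value is the limit of averages over
  shrinking intervals, and these all vanish. \<open>F\<close> is cut off below c > 0, because it is
  controlled only away from the origin, and c then runs through 1/(n + 1).\<close>

lemma zero_integrals_imp_negligible:
  assumes F: "loc_int F" and z: "\<And>a b. 0 < a \<Longrightarrow> a < b \<Longrightarrow> integral {a..b} F = 0"
  shows "negligible {x. x > 0 \<and> F x \<noteq> 0}"
proof -
  have *: "negligible {x. x \<ge> c \<and> F x \<noteq> 0}" if "c > 0" for c
  proof -
    define G where "G x = (if x \<in> {c..} then F x else 0)" for x
    have G0: "(G has_integral 0) {a..b}" for a b
    proof -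
      have "(F has_integral 0) {max a c..b}"
      proof (cases "max a c < b")
        case True
        then show ?thesis
          using z[of "max a c" b] loc_int_integrable[OF F, of "max a c" b] \<open>c > 0\<close>
          by (metis has_integral_integral less_max_iff_disj)
      next
        case False
        then show ?thesis by (intro has_integral_null_real) auto
      qed
      moreover have "{max a c..b} = {c..} \<inter> {a..b}" by auto
      ultimately show ?thesis unfolding G_def using has_integral_restrict_Int by metis
    qed
    have "G integrable_on cbox a b" for a b using G0 by auto
    from integrable_ccontinuous_explicit[OF this] obtain N where N: "negligible N"
      "\<And>x e. \<lbrakk>x \<notin> N; 0 < e\<rbrakk> \<Longrightarrow> \<exists>d>0. \<forall>h. 0 < h \<and> h < d \<longrightarrow>
          norm (integral (cbox x (x + h *\<^sub>R One)) G /\<^sub>R h ^ DIM(real) - G x) < e"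
      by metis
    have "G x = 0" if nx: "x \<notin> N" for x
    proof (rule ccontr)
      assume "G x \<noteq> 0"
      then obtain d where d: "d > 0" "\<forall>h. 0 < h \<and> h < d \<longrightarrow>
          norm (integral (cbox x (x + h *\<^sub>R One)) G /\<^sub>R h ^ DIM(real) - G x) < \<bar>G x\<bar>"
        using N(2)[OF nx, of "\<bar>G x\<bar>"] by auto
      have "integral (cbox x (x + (d/2) *\<^sub>R One)) G = 0"
        using G0[of x "x + d/2"] by (simp add: integral_unique)
      then show False using d(2)[rule_format, of "d/2"] d(1) by simp
    qed
    then have "{x. x \<ge> c \<and> F x \<noteq> 0} \<subseteq> N" by (smt (verit) G_def atLeast_iff mem_Collect_eq subsetI)
    then show ?thesis using N(1) negligible_subset by blast
  qed
  have "{x. x > 0 \<and> F x \<noteq> 0} = (\<Union>n. {x. x \<ge> 1 / real (Suc n) \<and> F x \<noteq> 0})"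
  proof (intro set_eqI iffI)
    fix x assume "x \<in> {x. x > 0 \<and> F x \<noteq> 0}"
    moreover from this obtain n where "1 / real (Suc n) < x" using nat_approx_posE by blast
    ultimately show "x \<in> (\<Union>n. {x. x \<ge> 1 / real (Suc n) \<and> F x \<noteq> 0})"
      by (auto intro!: exI[of _ n])
  next
    fix x assume "x \<in> (\<Union>n. {x. x \<ge> 1 / real (Suc n) \<and> F x \<noteq> 0})"
    then obtain n where "x \<ge> 1 / real (Suc n)" "F x \<noteq> 0" by blast
    moreover have "1 / real (Suc n) > 0" by simp
    ultimately show "x \<in> {x. x > 0 \<and> F x \<noteq> 0}" by (smt (verit) mem_Collect_eq)
  qed
  then show ?thesis using * by (auto intro!: negligible_countable_Union)
qed

lemma zero_pairing_imp_negligible: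
  assumes G: "loc_int G" and z: "\<And>\<psi>. test_fun \<psi> \<Longrightarrow> integral UNIV (\<lambda>x. G x * \<psi> x) = 0"
  shows "negligible {x. x > 0 \<and> G x \<noteq> 0}"
proof (rule zero_integrals_imp_negligible[OF G])
  fix a b :: real assume ab: "0 < a" "a < b"
  obtain \<theta> :: "real \<Rightarrow> real" where \<theta>: "\<And>n. differentiable_upto n \<theta>" "\<And>x. x \<le> 0 \<Longrightarrow> \<theta> x = 0"
    "\<And>x. x \<ge> 1 \<Longrightarrow> \<theta> x = 1" "\<And>x. 0 \<le> \<theta> x" "\<And>x. \<theta> x \<le> 1"
    using smooth_step_exists by blast
  \<comment> \<open>Two steps that rise within 1 / (n + 1) to the right of a and of b. All supports
    thus lie in {a..b+1}, and since \<theta> vanishes at 0 and below, the pointwise limit is the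
    indicator of {a<..b}.\<close>
  define \<psi> where "\<psi> n x = \<theta> (real (Suc n) * x + (- real (Suc n) * a))
    + (-1) * \<theta> (real (Suc n) * x + (- real (Suc n) * b))" for n x
  have \<psi>_eq: "\<psi> n x = \<theta> (real (Suc n) * (x - a)) - \<theta> (real (Suc n) * (x - b))" for n x
    by (simp add: \<psi>_def algebra_simps)
  have ge1: "1 \<le> real (Suc n) * t" if "t \<ge> 1" for n t
    using mult_mono[of 1 "real (Suc n)" 1 t] that by simp
  have le0: "real (Suc n) * t \<le> 0" if "t \<le> 0" for n t
    using that by (simp add: mult_nonneg_nonpos)
  have sup: "\<psi> n x = 0" if "x \<notin> {a..b + 1}" for n x
  proof (cases "x < a")
    case True
    then show ?thesis unfolding \<psi>_eq using ab by (subst (1 2) \<theta>(2)) (auto intro!: le0 simp del: of_nat_Suc)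
  next
    case False
    then have "x > b + 1" using that by auto
    then show ?thesis unfolding \<psi>_eq using ab by (subst (1 2) \<theta>(3)) (auto intro!: ge1 simp del: of_nat_Suc)
  qed
  have t: "test_on a (b + 1) (\<psi> n)" for n
    unfolding test_on_def
  proof (intro conjI allI impI)
    show "differentiable_upto k (\<psi> n)" for k
      unfolding \<psi>_def by (intro differentiable_upto_add differentiable_upto_mult differentiable_upto_const differentiable_upto_affine \<theta>)
  qed (use sup in auto)
  then have tf: "test_fun (\<psi> n)" for n using ab by (intro test_on_test_fun) auto
  have 0: "integral {a..b+1} (\<lambda>x. G x * \<psi> n x) = 0" for n
    using z[OF tf] pairing_UNIV_eq[of "{a..b+1}" "\<psi> n" G] sup by simp
  have "(\<lambda>n. integral {a..b+1} (\<lambda>x. G x * \<psi> n x)) \<longlonglongrightarrow>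
     integral {a..b+1} (\<lambda>x. if x \<in> {a<..b} then G x else 0)"
  proof (rule dominated_convergence(2)[where h = "\<lambda>x. \<bar>G x\<bar>"])
    show "(\<lambda>x. G x * \<psi> k x) integrable_on {a..b + 1}" for k
      using pairing_integrable'[OF G tf] by (rule integrable_on_subinterval) auto
    show "(\<lambda>x. \<bar>G x\<bar>) integrable_on {a..b+1}"
      using loc_intD[OF G ab(1), of "b + 1"] unfolding absolutely_integrable_on_def by simp
    show "norm (G x * \<psi> k x) \<le> \<bar>G x\<bar>" for k x
    proof -
      have "\<bar>\<psi> k x\<bar> \<le> 1" unfolding \<psi>_eq using \<theta>(4,5) by (smt (verit))
      then show ?thesis by (simp add: abs_mult mult_left_le)
    qed
    show "(\<lambda>k. G x * \<psi> k x) \<longlonglongrightarrow> (if x \<in> {a<..b} then G x else 0)" for x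
    proof -
      have ev1: "eventually (\<lambda>k. \<theta> (real (Suc k) * t) = 1) sequentially" if "t > 0" for t
      proof -
        obtain N :: nat where N: "1 / t < real N" using reals_Archimedean2 by blast
        have "\<theta> (real (Suc k) * t) = 1" if "k \<ge> N" for k
        proof (rule \<theta>(3))
          have "1 / t \<le> real (Suc k)" using N that by simp
          then show "1 \<le> real (Suc k) * t" using \<open>t > 0\<close> by (simp add: field_simps)
        qed
        then show ?thesis using eventually_sequentially by blast
      qed
      have ev0: "\<theta> (real (Suc k) * t) = 0" if "t \<le> 0" for t k
        using that by (intro \<theta>(2) le0)
      have "eventually (\<lambda>k. G x * \<psi> k x = (if x \<in> {a<..b} then G x else 0)) sequentially"
      proof -
        consider "x \<le> a" | "a < x" "x \<le> b" | "b < x" by linarith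
        then show ?thesis
        proof cases
          case 1
          then show ?thesis using ab ev0[of "x - a"] ev0[of "x - b"] unfolding \<psi>_eq by simp
        next
          case 2
          then show ?thesis using ev1[of "x - a"] ev0[of "x - b"] unfolding \<psi>_eq
            by (auto elim!: eventually_mono)
        next
          case 3
          then have "x - a > 0" "x - b > 0" using ab by auto
          from ev1[OF this(1)] ev1[OF this(2)] show ?thesis unfolding \<psi>_eq
          proof eventually_elim
            case (elim k)
            then show ?case using 3 by auto
          qed
        qed
      qed
      then show ?thesis by (rule tendsto_eventually)
    qed
  qed
  then have "integral {a..b+1} (\<lambda>x. if x \<in> {a<..b} then G x else 0) = 0"
    unfolding 0 by (rule LIMSEQ_unique[OF _ tendsto_const])
  moreover have "integral {a..b+1} (\<lambda>x. if x \<in> {a<..b} then G x else 0)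
      = integral {a<..b} G"
  proof -
    have "{a<..b} \<inter> {a..b+1} = {a<..b}" by auto
    with integral_restrict_Int[of "{a..b+1}" "{a<..b}" G] show ?thesis by (simp only:)
  qed
  moreover have "integral {a<..b} G = integral {a..b} G"
    by (rule integral_spike_set; rule negligible_subset[of "{a}"]) auto
  ultimately show "integral {a..b} G = 0" by simp
qed

lemma bump_fun_exists:
  obtains \<eta> where "test_fun \<eta>" "integral UNIV \<eta> = 1"
proof -
  obtain \<eta> where e: "test_on 1 2 \<eta>" "integral {1..2} \<eta> = (1::real)"
    using bump_exists[of 1 2] by auto
  have "integral UNIV \<eta> = 1"
    using pairing_UNIV_eq[of "{1..2}" \<eta> "\<lambda>_. 1"] e by (simp add: test_on_def)
  then show thesis using that e test_on_test_fun[of 1 2] by auto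
qed

lemma loc_int_const: "loc_int (\<lambda>x. c)"
  by (rule loc_int_continuous) auto

lemma test_fun_integrable: "test_fun \<phi> \<Longrightarrow> \<phi> integrable_on UNIV"
  using pairing_integrable'[OF loc_int_const[of 1]] by simp

text \<open>The argument of du Bois-Reymond: a test function minus its integral times the normalized
  bump \<eta> has zero mean, hence is the derivative of a test function. The constant is read off by
  pairing with \<eta>.\<close>

lemma weak_deriv_zero_imp_const:
  assumes G: "loc_int G" and z: "\<And>\<psi>. test_fun \<psi> \<Longrightarrow> integral UNIV (\<lambda>x. G x * deriv \<psi> x) = 0"
  obtains d where "negligible {x. x > 0 \<and> G x \<noteq> d}"
proof -
  obtain \<eta> where \<eta>: "test_fun \<eta>" "integral UNIV \<eta> = 1" using bump_fun_exists .
  define d where "d = integral UNIV (\<lambda>x. G x * \<eta> x)"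
  have "negligible {x. x > 0 \<and> G x - d \<noteq> 0}"
  proof (rule zero_pairing_imp_negligible)
    show "loc_int (\<lambda>x. G x - d)" by (intro loc_int_diff G loc_int_const)
    fix \<psi> assume \<psi>: "test_fun \<psi>"
    define I where "I = integral UNIV \<psi>"
    have "integral UNIV (\<lambda>x. \<psi> x + (- I) * \<eta> x) = I + (- I) * 1"
      using integral_add[OF test_fun_integrable[OF \<psi>]
          integrable_on_mult_right[OF test_fun_integrable[OF \<eta>(1)], of "- I"]] \<eta>(2)
      by (simp add: I_def)
    then have I0: "integral UNIV (\<lambda>x. \<psi> x + (- I) * \<eta> x) = 0" by simp
    obtain \<Psi> where "test_fun \<Psi>" and d: "deriv \<Psi> = (\<lambda>x. \<psi> x + (- I) * \<eta> x)"
      by (rule test_fun_antiderivative[OF test_fun_lincomb[OF \<psi> \<eta>(1)] I0])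
    then have "0 = integral UNIV (\<lambda>x. G x * (\<psi> x + (- I) * \<eta> x))" using z[of \<Psi>] by simp
    also have "\<dots> = integral UNIV (\<lambda>x. G x * \<psi> x + (- I) * (G x * \<eta> x))"
      by (simp add: algebra_simps)
    also have "\<dots> = integral UNIV (\<lambda>x. G x * \<psi> x) + (- I) * d"
      using integral_add[OF pairing_integrable'[OF G \<psi>]
          integrable_on_mult_right[OF pairing_integrable'[OF G \<eta>(1)], of "- I"]]
      by (simp add: d_def)
    also have "\<dots> = integral UNIV (\<lambda>x. G x * \<psi> x) - integral UNIV (\<lambda>x. d * \<psi> x)"
      by (simp add: I_def)
    also have "\<dots> = integral UNIV (\<lambda>x. (G x - d) * \<psi> x)"
      using integral_diff[OF pairing_integrable'[OF G \<psi>] pairing_integrable'[OF loc_int_const \<psi>], of d]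
      by (simp add: left_diff_distrib)
    finally show "integral UNIV (\<lambda>x. (G x - d) * \<psi> x) = 0" by simp
  qed
  then show thesis by (intro that[of d]) simp
qed

section \<open>Integration by parts for primitives and regularity of weak solutions\<close>

lemma real_integral_bound:
  fixes f g :: "real \<Rightarrow> real"
  assumes "f integrable_on S" "g integrable_on S" "\<And>x. x \<in> S \<Longrightarrow> \<bar>f x\<bar> \<le> g x"
  shows "\<bar>integral S f\<bar> \<le> integral S g"
  by (rule integral_norm_bound_integral[OF assms(1,2), unfolded real_norm_def]) (rule assms(3))

text \<open>
  As \<open>h\<close> is merely integrable, \<open>K\<close> need not be differentiable. Instead, the defect \<open>Q\<close> of the
  integration by parts up to \<open>x\<close> has increments \<open>O((y - x) (A y - A x))\<close> with \<open>A\<close> continuous,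
  hence derivative \<open>0\<close>.
\<close>

lemma primitive_by_parts:
  assumes h: "loc_int h" and K: "\<And>a b. 0 < a \<Longrightarrow> a \<le> b \<Longrightarrow> K b - K a = integral {a..b} h"
    and \<phi>: "test_fun \<phi>"
  shows "integral UNIV (\<lambda>x. K x * deriv \<phi> x) = - integral UNIV (\<lambda>x. h x * \<phi> x)"
proof -
  obtain a0 b0 where ab0: "0 < a0" "a0 \<le> b0" "test_on a0 b0 \<phi>" using \<phi> test_funE by blast
  \<comment> \<open>Widening the support interval makes \<phi> zero at both endpoints, so the
    boundary terms of \<open>Q\<close> drop out.\<close>
  define a b where "a = a0 / 2" and "b = b0 + 1"
  have ab: "0 < a" "a < b" using ab0 by (auto simp: a_def b_def)
  have t: "test_on a b \<phi>" using ab0 by (intro test_on_mono[OF ab0(3)]) (auto simp: a_def b_def)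
  have \<phi>0: "\<phi> a = 0" "\<phi> b = 0" using ab0 by (auto simp: test_on_def a_def b_def)
  have hi: "h integrable_on {x..y}" "(\<lambda>x. \<bar>h x\<bar>) integrable_on {x..y}" if "0 < x" for x y
    using loc_intD[OF h that] unfolding absolutely_integrable_on_def by auto
  have Kc: "continuous_on {a..b} K"
  proof -
    have "continuous_on {a..b} (\<lambda>x. K a + integral {a..x} h)"
      by (intro continuous_intros indefinite_integral_continuous_1 hi ab)
    moreover have "K a + integral {a..x} h = K x" if "x \<in> {a..b}" for x
      using K[of a x] that ab by simp
    ultimately show ?thesis by (rule continuous_on_eq)
  qed
  have dc: "continuous_on S (deriv \<phi>)" for S
    using \<phi> by (intro test_fun_continuous test_fun_deriv)
  have "bounded (deriv \<phi> ` {a..b})"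
    by (intro compact_imp_bounded compact_continuous_image dc) auto
  then obtain L where L0: "L > 0" and L: "\<And>x. x \<in> {a..b} \<Longrightarrow> \<bar>deriv \<phi> x\<bar> \<le> L"
    unfolding bounded_pos by auto
  have hp: "(\<lambda>s. h s * \<phi> s) integrable_on {x..y}" for x y
    using pairing_integrable'[OF h \<phi>] by (rule integrable_on_subinterval) auto
  have Kp: "(\<lambda>s. K s * deriv \<phi> s) integrable_on {x..y}" if "a \<le> x" "y \<le> b" for x y
    by (intro integrable_continuous_real continuous_on_mult dc continuous_on_subset[OF Kc])
      (use that in auto)
  define A where "A x = integral {a..x} (\<lambda>s. \<bar>h s\<bar>)" for x
  have Ac: "continuous_on {a..b} A"
    unfolding A_def by (intro indefinite_integral_continuous_1 hi ab)
  define Q where "Q x = integral {a..x} (\<lambda>s. h s * \<phi> s) - K x * \<phi> x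
      + integral {a..x} (\<lambda>s. K s * deriv \<phi> s)" for x
  have comb: "integral {a..y} f - integral {a..x} f = integral {x..y} f"
    if "a \<le> x" "x \<le> y" "f integrable_on {a..y}" for x y and f :: "real \<Rightarrow> real"
    using Henstock_Kurzweil_Integration.integral_combine[OF that] by simp
  have Qb: "\<bar>Q y - Q x\<bar> \<le> 2 * L * (y - x) * (A y - A x)" if xy: "a \<le> x" "x \<le> y" "y \<le> b" for x y
  proof -
    have x0: "0 < x" using ab xy by simp
    have AA: "A y - A x = integral {x..y} (\<lambda>s. \<bar>h s\<bar>)"
      unfolding A_def by (intro comb hi xy ab)
    have Kxy: "K y - K x = integral {x..y} h" using K[OF x0 xy(2)] .
    have Pxy: "integral {x..y} (deriv \<phi>) = \<phi> y - \<phi> x"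
      by (rule integral_unique, rule fundamental_theorem_of_calculus)
        (use xy test_fun_has_deriv[OF \<phi>] in \<open>auto simp: has_real_derivative_iff_has_vector_derivative intro: has_vector_derivative_at_within\<close>)
    have Pl: "\<bar>\<phi> s - \<phi> y\<bar> \<le> L * (y - x)" if "s \<in> {x..y}" for s
    proof -
      have "norm (\<phi> s - \<phi> y) \<le> L * norm (s - y)"
        by (rule field_differentiable_bound[where S = "{x..y}" and f' = "deriv \<phi>"])
          (use that xy L test_fun_has_deriv[OF \<phi>] in \<open>auto intro: has_field_derivative_at_within\<close>)
      also have "\<dots> \<le> L * (y - x)" using that L0 by (auto intro!: mult_left_mono)
      finally show ?thesis by simp
    qed
    have Kl: "\<bar>K s - K x\<bar> \<le> A y - A x" if "s \<in> {x..y}" for s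
    proof -
      have "K s - K x = integral {x..s} h" using K[of x s] x0 that by auto
      also have "\<bar>\<dots>\<bar> \<le> integral {x..s} (\<lambda>s. \<bar>h s\<bar>)"
        using integral_norm_bound_integral[of h "{x..s}" "\<lambda>s. \<bar>h s\<bar>"] hi[OF x0] by simp
      also have "\<dots> \<le> integral {x..y} (\<lambda>s. \<bar>h s\<bar>)"
        using that by (intro integral_subset_le hi x0) auto
      finally show ?thesis using AA by simp
    qed
    have 1: "integral {x..y} (\<lambda>s. h s * (\<phi> s - \<phi> y)) = integral {x..y} (\<lambda>s. h s * \<phi> s) - \<phi> y * (K y - K x)"
    proof -
      have "(\<lambda>s. h s * \<phi> y) integrable_on {x..y}" by (intro integrable_on_mult_left hi x0)
      from integral_diff[OF hp[of x y] this] show ?thesis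
        unfolding Kxy right_diff_distrib by (simp only: integral_mult_left mult.commute[of "\<phi> y" "integral {x..y} h"])
    qed
    have 2: "integral {x..y} (\<lambda>s. (K s - K x) * deriv \<phi> s)
      = integral {x..y} (\<lambda>s. K s * deriv \<phi> s) - K x * (\<phi> y - \<phi> x)"
    proof -
      have "(\<lambda>s. K x * deriv \<phi> s) integrable_on {x..y}"
        by (intro integrable_on_mult_right integrable_continuous_real dc)
      from integral_diff[OF Kp[OF xy(1,3)] this] show ?thesis
        unfolding Pxy[symmetric] left_diff_distrib by (simp only: integral_mult_right)
    qed
    have "Q y - Q x = integral {x..y} (\<lambda>s. h s * \<phi> s) + integral {x..y} (\<lambda>s. K s * deriv \<phi> s)
        - (K y * \<phi> y - K x * \<phi> x)"
      using comb[OF xy(1,2) hp] comb[OF xy(1,2) Kp[OF _ xy(3)]] by (simp add: Q_def)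
    \<comment> \<open>With \<phi> recentred at y and \<open>K\<close> at x the boundary terms cancel
      exactly. Each remaining integral is controlled by the product of an increment of order y - x
      and an increment of \<open>A\<close>.\<close>
    then have Qe: "Q y - Q x = integral {x..y} (\<lambda>s. h s * (\<phi> s - \<phi> y)) + integral {x..y} (\<lambda>s. (K s - K x) * deriv \<phi> s)"
      unfolding 1 2 by (simp add: algebra_simps)
    have i1: "(\<lambda>s. h s * (\<phi> s - \<phi> y)) integrable_on {x..y}"
      unfolding right_diff_distrib by (intro integrable_diff hp integrable_on_mult_left hi x0)
    have i2: "(\<lambda>s. (K s - K x) * deriv \<phi> s) integrable_on {x..y}"
      by (intro integrable_continuous_real continuous_intros dc continuous_on_subset[OF Kc])
        (use xy in auto)
    have "\<bar>integral {x..y} (\<lambda>s. h s * (\<phi> s - \<phi> y))\<bar> \<le> integral {x..y} (\<lambda>s. \<bar>h s\<bar> * (L * (y - x)))"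
      using i1 by (rule real_integral_bound)
        (auto intro!: integrable_on_mult_left hi x0 mult_left_mono Pl simp: abs_mult)
    then have e1: "\<bar>integral {x..y} (\<lambda>s. h s * (\<phi> s - \<phi> y))\<bar> \<le> L * (y - x) * (A y - A x)"
      by (simp add: AA mult.commute)
    have "\<bar>integral {x..y} (\<lambda>s. (K s - K x) * deriv \<phi> s)\<bar> \<le> integral {x..y} (\<lambda>s. (A y - A x) * L)"
      using i2
    proof (rule real_integral_bound)
      fix s assume s: "s \<in> {x..y}"
      have "\<bar>K s - K x\<bar> * \<bar>deriv \<phi> s\<bar> \<le> (A y - A x) * L"
        by (rule mult_mono) (use Kl[OF s] L[of s] s xy in auto)
      then show "\<bar>(K s - K x) * deriv \<phi> s\<bar> \<le> (A y - A x) * L" by (simp add: abs_mult)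
    qed auto
    then have e2: "\<bar>integral {x..y} (\<lambda>s. (K s - K x) * deriv \<phi> s)\<bar> \<le> L * (y - x) * (A y - A x)"
      using xy by (simp add: algebra_simps)
    show ?thesis using e1 e2 Qe by linarith
  qed
  have Qb': "\<bar>Q y - Q x\<bar> \<le> 2 * L * \<bar>y - x\<bar> * \<bar>A y - A x\<bar>" if "x \<in> {a..b}" "y \<in> {a..b}" for x y
  proof (cases "x \<le> y")
    case True
    have "\<bar>Q y - Q x\<bar> \<le> 2 * L * (y - x) * (A y - A x)" using Qb[of x y] that True by simp
    also have "\<dots> \<le> 2 * L * (y - x) * \<bar>A y - A x\<bar>" using True L0 by (intro mult_left_mono) auto
    finally show ?thesis using True by simp
  next
    case False
    have "\<bar>Q x - Q y\<bar> \<le> 2 * L * (x - y) * (A x - A y)" using Qb[of y x] that False by simp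
    also have "\<dots> \<le> 2 * L * (x - y) * \<bar>A x - A y\<bar>" using False L0 by (intro mult_left_mono) auto
    finally show ?thesis using False by (simp add: abs_minus_commute)
  qed
  have "(Q has_real_derivative 0) (at x within {a..b})" if x: "x \<in> {a..b}" for x
    unfolding has_field_derivative_iff
  proof (rule tendsto_0_le[where K = 1])
    have "(A \<longlongrightarrow> A x) (at x within {a..b})" using Ac x by (simp add: continuous_on_def)
    then have "((\<lambda>y. 2 * L * \<bar>A y - A x\<bar>) \<longlongrightarrow> 2 * L * \<bar>A x - A x\<bar>) (at x within {a..b})"
      by (intro tendsto_intros)
    then show "((\<lambda>y. 2 * L * \<bar>A y - A x\<bar>) \<longlongrightarrow> 0) (at x within {a..b})" by simp
    show "\<forall>\<^sub>F y in at x within {a..b}. norm ((Q y - Q x) / (y - x)) \<le> norm (2 * L * \<bar>A y - A x\<bar>) * 1"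
      unfolding eventually_at_topological
      using Qb'[OF x] L0 by (intro exI[of _ UNIV]) (auto simp: abs_mult divide_le_eq mult_ac)
  qed
  then have "\<exists>c. \<forall>x\<in>{a..b}. Q x = c"
    by (intro has_field_derivative_zero_constant) auto
  then have "Q a = Q b" using ab by force
  then have "integral {a..b} (\<lambda>s. K s * deriv \<phi> s) = - integral {a..b} (\<lambda>s. h s * \<phi> s)"
    by (simp add: Q_def \<phi>0)
  then show ?thesis
    using pairing_UNIV_eq[of "{a..b}" \<phi> h] pairing_UNIV_eq[of "{a..b}" "deriv \<phi>" K]
      t test_on_deriv[OF t] by (auto simp: test_on_def)
qed

text \<open>The signed integral from 1. The second branch is required because an integral over
  {1..x} with x < 1 is taken over the empty set.\<close>

definition primitive :: "(real \<Rightarrow> real) \<Rightarrow> real \<Rightarrow> real" where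
  "primitive h x = (if 1 \<le> x then integral {1..x} h else - integral {x..1} h)"

lemma primitive_diff:
  assumes "loc_int h" "0 < a" "a \<le> b"
  shows "primitive h b - primitive h a = integral {a..b} h"
proof -
  have c: "integral {x..y} h + integral {y..t} h = integral {x..t} h" if "0 < x" "x \<le> y" "y \<le> t" for x y t
    by (rule Henstock_Kurzweil_Integration.integral_combine) (use that assms loc_int_integrable in auto)
  consider "1 \<le> a" | "a < 1" "1 \<le> b" | "b < 1" by linarith
  then show ?thesis
  proof cases
    case 1
    then show ?thesis using c[of 1 a b] assms by (simp add: primitive_def)
  next
    case 2
    then show ?thesis using c[of a 1 b] assms by (simp add: primitive_def)
  next
    case 3
    then show ?thesis using c[of a b 1] assms by (simp add: primitive_def)
  qed
qed

lemma primitive_eq: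
  assumes "loc_int h" "0 < a" "a \<le> x"
  shows "primitive h x = primitive h a + integral {a..x} h"
  using primitive_diff[OF assms] by simp

lemma primitive_continuous:
  assumes "loc_int h"
  shows "continuous_on {0<..} (primitive h)"
proof (rule continuous_at_imp_continuous_on, rule ballI)
  fix x :: real assume "x \<in> {0<..}"
  then have x: "x > 0" by simp
  have "continuous_on {x/2..x+1} (\<lambda>t. primitive h (x/2) + integral {x/2..t} h)"
    using x by (intro continuous_on_add continuous_on_const indefinite_integral_continuous_1
        loc_int_integrable[OF assms]) auto
  then have "continuous_on {x/2..x+1} (primitive h)"
    by (rule continuous_on_eq) (rule primitive_eq[OF assms, symmetric], use x in auto)
  then show "isCont (primitive h) x"
    by (rule continuous_on_interior) (use x in auto)
qed

lemma primitive_has_deriv: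
  assumes h: "continuous_on {0<..} h" and x: "0 < x"
  shows "(primitive h has_real_derivative h x) (at x)"
proof -
  have "((\<lambda>t. integral {x/2..t} h) has_real_derivative h x) (at x within {x/2..x+1})"
    by (rule integral_has_real_derivative) (use h x in \<open>auto elim: continuous_on_subset\<close>)
  then have "((\<lambda>t. integral {x/2..t} h) has_real_derivative h x) (at x)"
    using x by (simp add: at_within_Icc_at)
  then have "((\<lambda>t. primitive h (x/2) + integral {x/2..t} h) has_real_derivative h x) (at x)"
    by (auto intro!: derivative_eq_intros)
  then show ?thesis
    by (rule has_field_derivative_transform_within_open[where S = "{x/2<..}"])
      (use x in \<open>auto intro!: primitive_eq[OF loc_int_continuous[OF h], symmetric]\<close>)
qed

text \<open>Correcting \<psi> by a multiple of \<eta> to zero mean and integrating it to \<Psi>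
  shows that \<open>F\<close> pairs with the derivative of \<psi> to c times the integral of \<psi>.
  So F + c x has weak derivative zero, and the slope is -c.\<close>

lemma weak_second_deriv_zero_imp_affine:
  assumes F: "loc_int F"
    and z: "\<And>\<phi>. test_fun \<phi> \<Longrightarrow> integral UNIV (\<lambda>x. F x * deriv (deriv \<phi>) x) = 0"
  obtains \<alpha> \<beta> where "negligible {x. x > 0 \<and> F x \<noteq> \<alpha> + \<beta> * x}"
proof -
  obtain \<eta> where \<eta>: "test_fun \<eta>" "integral UNIV \<eta> = 1" using bump_fun_exists .
  define c where "c = integral UNIV (\<lambda>x. F x * deriv \<eta> x)"
  have X: "loc_int (\<lambda>x. c * x)" by (intro loc_int_continuous continuous_intros)
  have "integral UNIV (\<lambda>x. (F x + c * x) * deriv \<psi> x) = 0" if \<psi>: "test_fun \<psi>" for \<psi>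
  proof -
    define I where "I = integral UNIV \<psi>"
    have I0: "integral UNIV (\<lambda>x. \<psi> x + (- I) * \<eta> x) = 0"
      using integral_add[OF test_fun_integrable[OF \<psi>]
          integrable_on_mult_right[OF test_fun_integrable[OF \<eta>(1)], of "- I"]] \<eta>(2)
      by (simp add: I_def)
    obtain \<Psi> where P: "test_fun \<Psi>" and d: "deriv \<Psi> = (\<lambda>x. \<psi> x + (- I) * \<eta> x)"
      by (rule test_fun_antiderivative[OF test_fun_lincomb[OF \<psi> \<eta>(1)] I0])
    have dd: "deriv (deriv \<Psi>) x = deriv \<psi> x + (- I) * deriv \<eta> x" for x
      unfolding d
      by (intro DERIV_imp_deriv DERIV_add DERIV_cmult test_fun_has_deriv \<psi> \<eta>)
    have "F x * deriv (deriv \<Psi>) x = F x * deriv \<psi> x + (- I) * (F x * deriv \<eta> x)" for x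
      unfolding dd by (simp only: algebra_simps)
    then have "0 = integral UNIV (\<lambda>x. F x * deriv \<psi> x + (- I) * (F x * deriv \<eta> x))"
      using z[OF P] by (simp only:)
    also have "\<dots> = integral UNIV (\<lambda>x. F x * deriv \<psi> x) + (- I) * c"
      using integral_add[OF pairing_integrable'[OF F test_fun_deriv[OF \<psi>]]
          integrable_on_mult_right[OF pairing_integrable'[OF F test_fun_deriv[OF \<eta>(1)]], of "- I"]]
      by (simp add: c_def)
    finally have 1: "integral UNIV (\<lambda>x. F x * deriv \<psi> x) = I * c" by simp
    have "integral UNIV (\<lambda>x. (c * x) * deriv \<psi> x) = - integral UNIV (\<lambda>x. c * \<psi> x)"
      by (rule primitive_by_parts[OF loc_int_const _ \<psi>]) (simp add: algebra_simps)
    then have 2: "integral UNIV (\<lambda>x. (c * x) * deriv \<psi> x) = - (c * I)" by (simp add: I_def)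
    have "integral UNIV (\<lambda>x. F x * deriv \<psi> x + (c * x) * deriv \<psi> x) = I * c + - (c * I)"
      using integral_add[OF pairing_integrable'[OF F test_fun_deriv[OF \<psi>]]
          pairing_integrable'[OF X test_fun_deriv[OF \<psi>]]] unfolding 1 2 .
    then show ?thesis unfolding distrib_right by simp
  qed
  then obtain d where "negligible {x. x > 0 \<and> F x + c * x \<noteq> d}"
    using weak_deriv_zero_imp_const[OF loc_int_add[OF F X]] by blast
  moreover have "{x. x > 0 \<and> F x + c * x \<noteq> d} = {x. x > 0 \<and> F x \<noteq> d + (- c) * x}"
    by (auto simp: algebra_simps)
  ultimately show thesis using that by metis
qed

text \<open>The twofold primitive of h has weak second derivative h by two integrations by parts, so
  it differs from f by an affine function almost everywhere.\<close>

lemma weak_second_deriv_imp_primitive: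
  assumes f: "loc_int f" and h: "loc_int h"
    and w: "\<And>\<phi>. test_fun \<phi> \<Longrightarrow>
      integral UNIV (\<lambda>x. f x * deriv (deriv \<phi>) x) = integral UNIV (\<lambda>x. h x * \<phi> x)"
  obtains \<alpha> \<beta> where "negligible {x. x > 0 \<and> f x \<noteq> \<alpha> + \<beta> * x + primitive (primitive h) x}"
proof -
  have K: "loc_int (primitive h)" by (intro loc_int_continuous primitive_continuous h)
  have H: "loc_int (primitive (primitive h))" by (intro loc_int_continuous primitive_continuous K)
  have "integral UNIV (\<lambda>x. (f x - primitive (primitive h) x) * deriv (deriv \<phi>) x) = 0" if \<phi>: "test_fun \<phi>" for \<phi>
  proof -
    have d: "test_fun (deriv \<phi>)" "test_fun (deriv (deriv \<phi>))" using \<phi> test_fun_deriv by blast+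
    have "integral UNIV (\<lambda>x. primitive (primitive h) x * deriv (deriv \<phi>) x)
        = - integral UNIV (\<lambda>x. primitive h x * deriv \<phi> x)"
      by (rule primitive_by_parts[OF K primitive_diff[OF K] d(1)])
    also have "integral UNIV (\<lambda>x. primitive h x * deriv \<phi> x) = - integral UNIV (\<lambda>x. h x * \<phi> x)"
      by (rule primitive_by_parts[OF h primitive_diff[OF h] \<phi>])
    finally have "integral UNIV (\<lambda>x. primitive (primitive h) x * deriv (deriv \<phi>) x)
        = integral UNIV (\<lambda>x. f x * deriv (deriv \<phi>) x)" using w[OF \<phi>] by simp
    then show ?thesis
      using integral_diff[OF pairing_integrable'[OF f d(2)] pairing_integrable'[OF H d(2)]]
      by (simp add: left_diff_distrib)
  qed
  then obtain \<alpha> \<beta> where "negligible {x. x > 0 \<and> f x - primitive (primitive h) x \<noteq> \<alpha> + \<beta> * x}"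
    using weak_second_deriv_zero_imp_affine[OF loc_int_diff[OF f H]] by blast
  moreover have "{x. x > 0 \<and> f x - primitive (primitive h) x \<noteq> \<alpha> + \<beta> * x}
      = {x. x > 0 \<and> f x \<noteq> \<alpha> + \<beta> * x + primitive (primitive h) x}"
    by (auto simp: algebra_simps)
  ultimately show thesis using that by metis
qed

lemma continuous_eq_if_negligible:
  fixes f g :: "real \<Rightarrow> real"
  assumes "continuous_on {0<..} f" "continuous_on {0<..} g" "negligible {x. x > 0 \<and> f x \<noteq> g x}"
    and "x > 0"
  shows "f x = g x"
proof -
  have "open ({0<..} \<inter> (\<lambda>x. f x - g x) -` (- {0}))"
    using assms by (intro continuous_open_preimage continuous_on_diff) auto
  moreover have "{0<..} \<inter> (\<lambda>x. f x - g x) -` (- {0}) = {x. x > 0 \<and> f x \<noteq> g x}" by auto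
  ultimately have "{x. x > 0 \<and> f x \<noteq> g x} = {}" using assms(3) open_not_negligible by metis
  then show ?thesis using assms(4) by blast
qed

lemma weak_solution_continuous:
  assumes f: "continuous_on {0<..} f" and h: "continuous_on {0<..} h"
    and w: "\<And>\<phi>. test_fun \<phi> \<Longrightarrow>
      integral UNIV (\<lambda>x. f x * deriv (deriv \<phi>) x) = integral UNIV (\<lambda>x. h x * \<phi> x)"
  shows "\<exists>f'. \<forall>x>0. (f has_real_derivative f' x) (at x) \<and> (f' has_real_derivative h x) (at x)"
proof -
  obtain \<alpha> \<beta> where n: "negligible {x. x > 0 \<and> f x \<noteq> \<alpha> + \<beta> * x + primitive (primitive h) x}"
    using weak_second_deriv_imp_primitive[OF loc_int_continuous[OF f] loc_int_continuous[OF h] w] by blast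
  have pc: "continuous_on {0<..} (primitive h)" by (intro primitive_continuous loc_int_continuous h)
  have "continuous_on {0<..} (\<lambda>x. \<alpha> + \<beta> * x + primitive (primitive h) x)"
    by (intro continuous_intros primitive_continuous loc_int_continuous h)
  then have eq: "f x = \<alpha> + \<beta> * x + primitive (primitive h) x" if "x > 0" for x
    using continuous_eq_if_negligible[OF f _ n that] by simp
  show ?thesis
  proof (intro exI[of _ "\<lambda>x. \<beta> + primitive h x"] allI impI conjI)
    fix x :: real assume x: "0 < x"
    have "((\<lambda>x. \<alpha> + \<beta> * x + primitive (primitive h) x) has_real_derivative \<beta> + primitive h x) (at x)"
      using primitive_has_deriv[OF pc x] by (auto intro!: derivative_eq_intros)
    then show "(f has_real_derivative \<beta> + primitive h x) (at x)"
      by (rule has_field_derivative_transform_within_open[where S = "{0<..}"]) (use x eq in auto)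
    show "((\<lambda>x. \<beta> + primitive h x) has_real_derivative h x) (at x)"
      using primitive_has_deriv[OF h x] by (auto intro!: derivative_eq_intros)
  qed
qed

text \<open>A bootstrap in two rounds. The first gives continuous representatives of both
  components. Each right-hand side involves both, so only after both are replaced is it continuous,
  and the second round gives classical derivatives.\<close>

lemma weak_system_regular:
  assumes u: "loc_int u" and w: "loc_int w"
    and c: "continuous_on {0<..} a" "continuous_on {0<..} b" "continuous_on {0<..} c" "continuous_on {0<..} d"
    and wu: "\<And>\<phi>. test_fun \<phi> \<Longrightarrow> integral UNIV (\<lambda>x. u x * deriv (deriv \<phi>) x)
      = integral UNIV (\<lambda>x. (a x * u x + b x * w x) * \<phi> x)"
    and ww: "\<And>\<phi>. test_fun \<phi> \<Longrightarrow> integral UNIV (\<lambda>x. w x * deriv (deriv \<phi>) x)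
      = integral UNIV (\<lambda>x. (c x * u x + d x * w x) * \<phi> x)"
  shows "\<exists>U U' W W'. negligible {x. x > 0 \<and> u x \<noteq> U x} \<and> negligible {x. x > 0 \<and> w x \<noteq> W x} \<and>
    (\<forall>x>0. (U has_real_derivative U' x) (at x) \<and> (U' has_real_derivative a x * U x + b x * W x) (at x)) \<and>
    (\<forall>x>0. (W has_real_derivative W' x) (at x) \<and> (W' has_real_derivative c x * U x + d x * W x) (at x))"
proof -
  have cont: "\<exists>F. negligible {x. x > 0 \<and> f x \<noteq> F x} \<and> continuous_on {0<..} F"
    if fh: "loc_int f" "loc_int h" "\<And>\<phi>. test_fun \<phi> \<Longrightarrow>
      integral UNIV (\<lambda>x. f x * deriv (deriv \<phi>) x) = integral UNIV (\<lambda>x. h x * \<phi> x)" for f h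
  proof -
    obtain \<alpha> \<beta> where n: "negligible {x. x > 0 \<and> f x \<noteq> \<alpha> + \<beta> * x + primitive (primitive h) x}"
      using weak_second_deriv_imp_primitive[OF fh] by blast
    moreover have "continuous_on {0<..} (\<lambda>x. \<alpha> + \<beta> * x + primitive (primitive h) x)"
      by (intro continuous_intros primitive_continuous loc_int_continuous fh)
    ultimately show ?thesis by (intro exI[of _ "\<lambda>x. \<alpha> + \<beta> * x + primitive (primitive h) x"] conjI)
  qed
  have lin: "loc_int (\<lambda>x. a x * u x + b x * w x)" "loc_int (\<lambda>x. c x * u x + d x * w x)"
    by (intro loc_int_add loc_int_mult_continuous u w c)+
  obtain U where U: "negligible {x. x > 0 \<and> u x \<noteq> U x}" "continuous_on {0<..} U"
    using cont[OF u lin(1)] wu by blast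
  obtain W where W: "negligible {x. x > 0 \<and> w x \<noteq> W x}" "continuous_on {0<..} W"
    using cont[OF w lin(2)] ww by blast
  have n: "negligible {x. x > 0 \<and> p x * u x + q x * w x \<noteq> p x * U x + q x * W x}" for p q
    by (rule negligible_subset[OF negligible_Un[OF U(1) W(1)]]) auto
  have 1: "integral UNIV (\<lambda>x. U x * deriv (deriv \<phi>) x) = integral UNIV (\<lambda>x. (a x * U x + b x * W x) * \<phi> x)"
    if "test_fun \<phi>" for \<phi>
    using wu[OF that] pairing_spike[OF test_fun_deriv[OF test_fun_deriv[OF that]] U(1)]
      pairing_spike[OF that n[of a b]] by simp
  have 2: "integral UNIV (\<lambda>x. W x * deriv (deriv \<phi>) x) = integral UNIV (\<lambda>x. (c x * U x + d x * W x) * \<phi> x)"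
    if "test_fun \<phi>" for \<phi>
    using ww[OF that] pairing_spike[OF test_fun_deriv[OF test_fun_deriv[OF that]] W(1)]
      pairing_spike[OF that n[of c d]] by simp
  have hU: "continuous_on {0<..} (\<lambda>x. a x * U x + b x * W x)"
    and hW: "continuous_on {0<..} (\<lambda>x. c x * U x + d x * W x)"
    by (intro continuous_intros c U W)+
  show ?thesis
    using U(1) W(1) weak_solution_continuous[OF U(2) hU 1] weak_solution_continuous[OF W(2) hW 2]
    by blast
qed

section \<open>Reduction of the eigenvalue equation\<close>

lemma set_integrable_half_line:
  fixes f :: "real \<Rightarrow> real"
  shows "integrable half_line f \<longleftrightarrow> f absolutely_integrable_on {0<..}"
  unfolding set_integrable_def by (intro integrable_restrict_space) auto

lemma AE_half_line_negligible:
  assumes "AE x in half_line. P x"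
  shows "negligible {x. x > 0 \<and> \<not> P x}"
proof -
  have "AE x in lebesgue. x \<in> {0<..} \<longrightarrow> P x"
    using assms by (subst (asm) AE_restrict_space_iff) auto
  then obtain N where "{x \<in> space lebesgue. \<not> (x \<in> {0<..} \<longrightarrow> P x)} \<subseteq> N" "N \<in> null_sets lebesgue"
    by (auto elim!: AE_E simp: null_sets_def)
  then show ?thesis
    using negligible_subset[of N] by (auto simp: negligible_iff_null_sets)
qed

lemma negligible_AE_half_line:
  assumes "negligible {x. x > 0 \<and> \<not> P x}"
  shows "AE x in half_line. P x"
proof -
  have "AE x in lebesgue. x \<in> {0<..} \<longrightarrow> P x"
    by (rule AE_I'[of "{x. x > 0 \<and> \<not> P x}"]) (use assms in \<open>auto simp: negligible_iff_null_sets\<close>)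
  then show ?thesis by (subst AE_restrict_space_iff) auto
qed

text \<open>The complex factor lets one argument serve for real and imaginary parts. Local
  integrability comes from |t| \<le> 1 + t^2 on bounded intervals.\<close>

lemma L2_Re_mult:
  assumes "f \<in> L2"
  shows "(\<lambda>r. Re (c * f r)) \<in> borel_measurable half_line"
    and "(\<lambda>r. (Re (c * f r))\<^sup>2) absolutely_integrable_on {0<..}"
    and "loc_int (\<lambda>r. Re (c * f r))"
proof -
  have m: "f \<in> borel_measurable half_line" and i: "integrable half_line (\<lambda>r. (cmod (f r))\<^sup>2)"
    using assms by (auto simp: L2_def)
  show M: "(\<lambda>r. Re (c * f r)) \<in> borel_measurable half_line"
    using m by measurable
  have "integrable half_line (\<lambda>r. (Re (c * f r))\<^sup>2)"
  proof (rule Bochner_Integration.integrable_bound)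
    show "integrable half_line (\<lambda>r. (cmod c)\<^sup>2 * (cmod (f r))\<^sup>2)" using i by simp
    have "norm ((Re (c * f r))\<^sup>2) \<le> norm ((cmod c)\<^sup>2 * (cmod (f r))\<^sup>2)" for r
    proof -
      have "\<bar>Re (c * f r)\<bar>\<^sup>2 \<le> (cmod (c * f r))\<^sup>2" by (intro power_mono abs_Re_le_cmod) auto
      then show ?thesis by (simp add: norm_mult power_mult_distrib)
    qed
    then show "AE r in half_line. norm ((Re (c * f r))\<^sup>2) \<le> norm ((cmod c)\<^sup>2 * (cmod (f r))\<^sup>2)" by simp
  qed (use M in measurable)
  then show I: "(\<lambda>r. (Re (c * f r))\<^sup>2) absolutely_integrable_on {0<..}"
    using set_integrable_half_line by blast
  show "loc_int (\<lambda>r. Re (c * f r))"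
    unfolding loc_int_def
  proof (intro allI impI)
    fix a b :: real assume a: "0 < a"
    show "(\<lambda>r. Re (c * f r)) absolutely_integrable_on {a..b}"
    proof (rule measurable_bounded_by_integrable_imp_absolutely_integrable)
      show "(\<lambda>r. Re (c * f r)) \<in> borel_measurable (lebesgue_on {a..b})"
        by (rule measurable_restrict_mono[OF M]) (use a in auto)
      have "(\<lambda>r. (Re (c * f r))\<^sup>2) absolutely_integrable_on {a..b}"
        by (rule set_integrable_subset[OF I]) (use a in auto)
      then show "(\<lambda>r. 1 + (Re (c * f r))\<^sup>2) integrable_on {a..b}"
        by (intro integrable_add integrable_const_ivl set_lebesgue_integral_eq_integral(1))
      show "norm (Re (c * f r)) \<le> 1 + (Re (c * f r))\<^sup>2" for r
        using sum_squares_bound[of "\<bar>Re (c * f r)\<bar>" 1] abs_ge_zero[of "Re (c * f r)"]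
        unfolding real_norm_def power2_abs power_one mult_1_right by linarith
    qed auto
  qed
qed

lemma supported_integrable:
  fixes \<psi> :: "real \<Rightarrow> real"
  assumes c: "continuous_on {0<..} \<psi>" and s: "\<And>x. x \<notin> {a..b} \<Longrightarrow> \<psi> x = 0" and a: "0 < a"
  shows "integrable half_line \<psi>"
proof -
  have "\<psi> absolutely_integrable_on {a..b}"
    by (intro absolutely_integrable_continuous_real continuous_on_subset[OF c]) (use a in auto)
  then have "(\<lambda>x. indicator {a..b} x *\<^sub>R \<psi> x) = (\<lambda>x. indicator {0<..} x *\<^sub>R \<psi> x)
      \<and> integrable lebesgue (\<lambda>x. indicator {a..b} x *\<^sub>R \<psi> x)"
    using s a by (auto simp: set_integrable_def indicator_def fun_eq_iff)
  then have "\<psi> absolutely_integrable_on {0<..}" unfolding set_integrable_def by metis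
  then show ?thesis using set_integrable_half_line by blast
qed

text \<open>The passage from the complex Lebesgue integrals of \<open>L0_distrib\<close> to the real
  gauge integrals of the regularity theory. The product is integrable because it is bounded by |f|^2
  + \<psi>^2.\<close>

lemma L2_pairing:
  assumes f: "f \<in> L2" and c: "continuous_on {0<..} \<psi>" and s: "\<And>x. x \<notin> {a..b} \<Longrightarrow> \<psi> x = 0" and a: "0 < a"
  shows "Re (k * (LINT r|half_line. f r * of_real (\<psi> r))) = integral UNIV (\<lambda>r. Re (k * f r) * \<psi> r)"
proof -
  have m: "f \<in> borel_measurable half_line" and i: "integrable half_line (\<lambda>r. (cmod (f r))\<^sup>2)"
    using f by (auto simp: L2_def)
  have p: "integrable half_line \<psi>" by (rule supported_integrable[OF c s a])
  have p2: "integrable half_line (\<lambda>r. (\<psi> r)\<^sup>2)"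
    by (rule supported_integrable[where a = a and b = b]) (use c s a in \<open>auto intro!: continuous_intros\<close>)
  have I: "integrable half_line (\<lambda>r. f r * of_real (\<psi> r))"
  proof (rule Bochner_Integration.integrable_bound[OF Bochner_Integration.integrable_add[OF i p2]])
    show "(\<lambda>r. f r * complex_of_real (\<psi> r)) \<in> borel_measurable half_line"
      using m borel_measurable_integrable[OF p] by measurable
    have "norm (f r * complex_of_real (\<psi> r)) \<le> norm ((cmod (f r))\<^sup>2 + (\<psi> r)\<^sup>2)" for r
    proof -
      have "2 * (cmod (f r) * \<bar>\<psi> r\<bar>) \<le> (cmod (f r))\<^sup>2 + (\<psi> r)\<^sup>2"
        using sum_squares_bound[of "cmod (f r)" "\<bar>\<psi> r\<bar>"] by simp
      moreover have "0 \<le> cmod (f r) * \<bar>\<psi> r\<bar>" by simp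
      ultimately have "cmod (f r) * \<bar>\<psi> r\<bar> \<le> (cmod (f r))\<^sup>2 + (\<psi> r)\<^sup>2" by linarith
      then show ?thesis by (simp add: norm_mult)
    qed
    then show "AE r in half_line. norm (f r * complex_of_real (\<psi> r)) \<le> norm ((cmod (f r))\<^sup>2 + (\<psi> r)\<^sup>2)" by simp
  qed
  have "Re (k * (LINT r|half_line. f r * of_real (\<psi> r)))
      = Re (LINT r|half_line. k * (f r * of_real (\<psi> r)))" by simp
  also have "\<dots> = (LINT r|half_line. Re (k * (f r * of_real (\<psi> r))))"
    using I by (intro integral_Re[symmetric] integrable_mult_right) 
  also have "\<dots> = integral {0<..} (\<lambda>r. Re (k * (f r * of_real (\<psi> r))))"
    using I by (intro lebesgue_integral_eq_integral integrable_Re integrable_mult_right) auto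
  also have "\<dots> = integral {0<..} (\<lambda>r. Re (k * f r) * \<psi> r)"
    by (simp add: mult.assoc[symmetric])
  also have "\<dots> = integral UNIV (\<lambda>r. Re (k * f r) * \<psi> r)"
    by (rule pairing_UNIV_eq[symmetric]) (use s a in force)
  finally show ?thesis .
qed

text \<open>The equation solved for the second derivative, hence the factor 2 on the potential and
  on the right-hand side. \<open>H\<close> is an almost everywhere expression for Re (k g), later
  supplied by the eigenvalue equation.\<close>

lemma L0_distrib_real_weak:
  assumes f: "f \<in> L2" and g: "g \<in> L2" and d: "L0_distrib f g"
    and H: "negligible {r. r > 0 \<and> Re (k * g r) \<noteq> H r}" and \<phi>: "test_fun \<phi>"
  shows "integral UNIV (\<lambda>r. Re (k * f r) * deriv (deriv \<phi>) r)
    = integral UNIV (\<lambda>r. ((3 / (4 * (sinh r)\<^sup>2) + 1/4) * Re (k * f r) - 2 * H r) * \<phi> r)"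
proof -
  obtain a b where ab: "0 < a" "a \<le> b" "test_on a b \<phi>" using \<phi> test_funE by blast
  define F where "F r = Re (k * f r)" for r
  define v :: "real \<Rightarrow> real" where "v r = 3 / (8 * (sinh r)\<^sup>2) + 1/8" for r
  have vc: "continuous_on {0<..} v" unfolding v_def by (intro continuous_intros) auto
  have F: "loc_int F" unfolding F_def by (rule L2_Re_mult(3)[OF f])
  have Hi: "loc_int H" by (rule loc_int_spike[OF L2_Re_mult(3)[OF g] H])
  have dd: "test_fun (deriv (deriv \<phi>))" using \<phi> test_fun_deriv by blast
  have vF: "loc_int (\<lambda>r. v r * F r)" by (rule loc_int_mult_continuous[OF vc F])
  have z: "\<phi> x = 0" "deriv (deriv \<phi>) x = 0" if "x \<notin> {a..b}" for x
    using ab(3) test_on_deriv[OF test_on_deriv[OF ab(3)]] that by (auto simp: test_on_def)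
  have L: "L0_expr \<phi> = (\<lambda>r. - (1/2) * deriv (deriv \<phi>) r + v r * \<phi> r)"
    by (auto simp: L0_expr_def v_def)
  have "integral UNIV (\<lambda>r. F r * L0_expr \<phi> r) = Re (k * (LINT r|half_line. f r * of_real (L0_expr \<phi> r)))"
    unfolding F_def
  proof (rule L2_pairing[OF f _ _ ab(1), symmetric])
    show "continuous_on {0<..} (L0_expr \<phi>)"
      unfolding L by (intro continuous_intros vc test_fun_continuous dd \<phi>)
    show "L0_expr \<phi> x = 0" if "x \<notin> {a..b}" for x using z[OF that] by (simp add: L)
  qed
  also have "\<dots> = Re (k * (LINT r|half_line. g r * of_real (\<phi> r)))"
    using d \<phi> unfolding L0_distrib_def by simp
  also have "\<dots> = integral UNIV (\<lambda>r. Re (k * g r) * \<phi> r)"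
    by (rule L2_pairing[OF g _ _ ab(1)]) (use z \<phi> test_fun_continuous in auto)
  also have "\<dots> = integral UNIV (\<lambda>r. H r * \<phi> r)" by (rule pairing_spike[OF \<phi> H])
  finally have 1: "integral UNIV (\<lambda>r. F r * L0_expr \<phi> r) = integral UNIV (\<lambda>r. H r * \<phi> r)" .
  define X Y Z where "X r = F r * deriv (deriv \<phi>) r" and "Y r = v r * F r * \<phi> r" and "Z r = H r * \<phi> r" for r
  have i: "X integrable_on UNIV" "Y integrable_on UNIV" "Z integrable_on UNIV"
    unfolding X_def Y_def Z_def by (intro pairing_integrable' F dd vF \<phi> Hi)+
  have "(\<lambda>r. F r * L0_expr \<phi> r) = (\<lambda>r. Y r + (- (1/2)) * X r)"
    by (auto simp: L X_def Y_def algebra_simps)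
  then have 2: "integral UNIV (\<lambda>r. F r * L0_expr \<phi> r) = integral UNIV Y + (- (1/2)) * integral UNIV X"
    using integral_add[OF i(2) integrable_on_mult_right[OF i(1), of "- (1/2)"]] by simp
  have "(\<lambda>r. ((3 / (4 * (sinh r)\<^sup>2) + 1/4) * Re (k * f r) - 2 * H r) * \<phi> r) = (\<lambda>r. 2 * Y r - 2 * Z r)"
  proof
    fix r
    have "3 / (4 * (sinh r)\<^sup>2) + 1/4 = 2 * v r" by (simp add: v_def)
    then show "((3 / (4 * (sinh r)\<^sup>2) + 1/4) * Re (k * f r) - 2 * H r) * \<phi> r = 2 * Y r - 2 * Z r"
      unfolding Y_def Z_def F_def by (simp only: algebra_simps)
  qed
  then have 3: "integral UNIV (\<lambda>r. ((3 / (4 * (sinh r)\<^sup>2) + 1/4) * Re (k * f r) - 2 * H r) * \<phi> r)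
      = 2 * integral UNIV Y - 2 * integral UNIV Z"
    using integral_diff[OF integrable_on_mult_right[OF i(2), of 2] integrable_on_mult_right[OF i(3), of 2]]
    by simp
  have XZ: "X = (\<lambda>r. Re (k * f r) * deriv (deriv \<phi>) r)" "Z = (\<lambda>r. H r * \<phi> r)"
    by (auto simp: X_def F_def Z_def)
  have "integral UNIV X = 2 * integral UNIV Y - 2 * integral UNIV Z"
    using 1 2 unfolding XZ(2) by linarith
  then show ?thesis unfolding 3 XZ(1) .
qed

lemma Re_complex_of_real_mult: "Re (of_real a * z) = a * Re z"
  by simp

text \<open>The eigenvalue equation reads L2 f = \<i> lam g and L1 g = -\<i> lam f. Putting the
  factor \<i> into the second component gives L2 p = lam q and L1 q = lam p with real coefficients,
  so real parts can be taken after multiplication by any constant k.\<close>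

lemma (in vortex) eigenfunction_real_part_zero:
  assumes fg: "f \<in> L2" "g \<in> L2" "F \<in> L2" "G \<in> L2" "L0_distrib f F" "L0_distrib g G"
    and lam: "sqrt 17 / 8 \<le> \<bar>lam\<bar>"
    and F: "negligible {r. r > 0 \<and> F r \<noteq> \<i> * of_real lam * g r - of_real (3 * (\<rho> r)\<^sup>2 - 1) * f r}"
    and G: "negligible {r. r > 0 \<and> G r \<noteq> - \<i> * of_real lam * f r - of_real ((\<rho> r)\<^sup>2 - 1) * g r}"
  shows "negligible {r. r > 0 \<and> Re (k * f r) \<noteq> 0}" "negligible {r. r > 0 \<and> Re (k * \<i> * g r) \<noteq> 0}"
proof -
  define p q where "p r = Re (k * f r)" and "q r = Re (k * \<i> * g r)" for r
  have p: "loc_int p" "(\<lambda>r. (p r)\<^sup>2) absolutely_integrable_on {0<..}"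
    unfolding p_def by (rule L2_Re_mult[OF fg(1)])+
  have q: "loc_int q" "(\<lambda>r. (q r)\<^sup>2) absolutely_integrable_on {0<..}"
    unfolding q_def by (rule L2_Re_mult[OF fg(2)])+
  have n1: "negligible {r. r > 0 \<and> Re (k * F r) \<noteq> lam * q r - (3 * (\<rho> r)\<^sup>2 - 1) * p r}"
  proof (rule negligible_subset[OF F])
    have "Re (k * F r) = lam * q r - (3 * (\<rho> r)\<^sup>2 - 1) * p r"
      if "F r = \<i> * of_real lam * g r - of_real (3 * (\<rho> r)\<^sup>2 - 1) * f r" for r
    proof -
      have "k * F r = of_real lam * (k * \<i> * g r) - of_real (3 * (\<rho> r)\<^sup>2 - 1) * (k * f r)"
        unfolding that by (simp only: algebra_simps)
      then show ?thesis unfolding p_def q_def by (simp only: minus_complex.sel Re_complex_of_real_mult)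
    qed
    then show "{r. r > 0 \<and> Re (k * F r) \<noteq> lam * q r - (3 * (\<rho> r)\<^sup>2 - 1) * p r}
      \<subseteq> {r. r > 0 \<and> F r \<noteq> \<i> * of_real lam * g r - of_real (3 * (\<rho> r)\<^sup>2 - 1) * f r}" by blast
  qed
  have n2: "negligible {r. r > 0 \<and> Re (k * \<i> * G r) \<noteq> lam * p r - ((\<rho> r)\<^sup>2 - 1) * q r}"
  proof (rule negligible_subset[OF G])
    have "Re (k * \<i> * G r) = lam * p r - ((\<rho> r)\<^sup>2 - 1) * q r"
      if "G r = - \<i> * of_real lam * f r - of_real ((\<rho> r)\<^sup>2 - 1) * g r" for r
    proof -
      have "k * \<i> * (- \<i> * of_real x * y - of_real t * w) = of_real x * (k * y) - of_real t * (k * \<i> * w)"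
        for x t :: real and y w :: complex
        by (simp add: complex_eq_iff algebra_simps)
      then have "k * \<i> * G r = of_real lam * (k * f r) - of_real ((\<rho> r)\<^sup>2 - 1) * (k * \<i> * g r)"
        unfolding that .
      then show ?thesis unfolding p_def q_def
        by (simp only: minus_complex.sel Re_complex_of_real_mult)
    qed
    then show "{r. r > 0 \<and> Re (k * \<i> * G r) \<noteq> lam * p r - ((\<rho> r)\<^sup>2 - 1) * q r}
      \<subseteq> {r. r > 0 \<and> G r \<noteq> - \<i> * of_real lam * f r - of_real ((\<rho> r)\<^sup>2 - 1) * g r}" by blast
  qed
  have wp: "integral UNIV (\<lambda>r. p r * deriv (deriv \<phi>) r)
      = integral UNIV (\<lambda>r. ((V r + 4 * (\<rho> r)\<^sup>2) * p r + (- 2 * lam) * q r) * \<phi> r)" if "test_fun \<phi>" for \<phi>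
  proof -
    have "(3 / (4 * (sinh r)\<^sup>2) + 1/4) * p r - 2 * (lam * q r - (3 * (\<rho> r)\<^sup>2 - 1) * p r)
        = (V r + 4 * (\<rho> r)\<^sup>2) * p r + (- 2 * lam) * q r" for r
      by (simp add: V_def algebra_simps)
    then show ?thesis
      using L0_distrib_real_weak[OF fg(1,3,5) n1 that] unfolding p_def[symmetric] by (simp only:)
  qed
  have wq: "integral UNIV (\<lambda>r. q r * deriv (deriv \<phi>) r)
      = integral UNIV (\<lambda>r. ((- 2 * lam) * p r + V r * q r) * \<phi> r)" if "test_fun \<phi>" for \<phi>
  proof -
    have "(3 / (4 * (sinh r)\<^sup>2) + 1/4) * q r - 2 * (lam * p r - ((\<rho> r)\<^sup>2 - 1) * q r)
        = (- 2 * lam) * p r + V r * q r" for r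
      by (simp add: V_def algebra_simps)
    then show ?thesis
      using L0_distrib_real_weak[OF fg(2,4,6) n2 that] unfolding q_def[symmetric] by (simp only:)
  qed
  have "continuous_on {0<..} (\<lambda>r. V r + 4 * (\<rho> r)\<^sup>2)"
    by (intro continuous_intros V_continuous rho_continuous)
  from weak_system_regular[OF p(1) q(1) this continuous_on_const continuous_on_const V_continuous wp wq]
  obtain U U' W W' where n: "negligible {x. x > 0 \<and> p x \<noteq> U x}" "negligible {x. x > 0 \<and> q x \<noteq> W x}"
    and dU: "\<forall>x>0. (U has_real_derivative U' x) (at x) \<and>
      (U' has_real_derivative (V x + 4 * (\<rho> x)\<^sup>2) * U x + (- 2 * lam) * W x) (at x)"
    and dW: "\<forall>x>0. (W has_real_derivative W' x) (at x) \<and>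
      (W' has_real_derivative (- 2 * lam) * U x + V x * W x) (at x)"
    by blast
  have d: "(U has_real_derivative U' x) (at x)"
    "(U' has_real_derivative (V x + 4 * (\<rho> x)\<^sup>2) * U x + (- 2 * lam) * W x) (at x)"
    "(W has_real_derivative W' x) (at x)"
    "(W' has_real_derivative (- 2 * lam) * U x + V x * W x) (at x)" if "0 < x" for x
    using dU dW that by blast+
  \<comment> \<open>Both couplings are -2 lam. As \<sigma> is its own inverse and \<sigma> lam =
    -|lam|, passing from W to \<sigma> W turns both into 2 |lam|.\<close>
  define \<sigma> where "\<sigma> = - sgn lam"
  have lam0: "lam \<noteq> 0" using lam by auto
  have \<sigma>: "\<sigma> * \<sigma> = 1" "\<sigma> * lam = - \<bar>lam\<bar>" using lam0 by (auto simp: \<sigma>_def sgn_if abs_if)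
  have lW: "lam * W x = - \<bar>lam\<bar> * (\<sigma> * W x)" for x
  proof -
    have "lam * W x = (\<sigma> * \<sigma>) * (lam * W x)" using \<sigma> by simp
    also have "\<dots> = (\<sigma> * lam) * (\<sigma> * W x)" by (simp only: mult_ac)
    finally show ?thesis unfolding \<sigma>(2) .
  qed
  interpret gp_mode \<rho> "\<bar>lam\<bar>" U U' "\<lambda>x. \<sigma> * W x" "\<lambda>x. \<sigma> * W' x"
  proof unfold_locales
    show "(\<lambda>x. (U x)\<^sup>2) absolutely_integrable_on {0<..}"
      by (rule absolutely_integrable_spike[OF p(2) n(1)]) auto
    have "(\<lambda>x. (W x)\<^sup>2) absolutely_integrable_on {0<..}"
      by (rule absolutely_integrable_spike[OF q(2) n(2)]) auto
    moreover have "(\<sigma> * W x)\<^sup>2 = (W x)\<^sup>2" for x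
      using \<sigma>(1) by (simp add: power_mult_distrib power2_eq_square)
    ultimately show "(\<lambda>x. (\<sigma> * W x)\<^sup>2) absolutely_integrable_on {0<..}" by simp
    fix x :: real assume x: "0 < x"
    show "((\<lambda>x. \<sigma> * W x) has_real_derivative \<sigma> * W' x) (at x)" by (intro DERIV_cmult d x)
    show "(U' has_real_derivative (V x + 4 * (\<rho> x)\<^sup>2) * U x + 2 * \<bar>lam\<bar> * (\<sigma> * W x)) (at x)"
      using d(2)[OF x] lW[of x] by (simp add: mult.assoc)
    have "\<sigma> * ((- 2 * lam) * U x + V x * W x) = 2 * (- (\<sigma> * lam)) * U x + V x * (\<sigma> * W x)"
      by (simp add: algebra_simps)
    then show "((\<lambda>x. \<sigma> * W' x) has_real_derivative 2 * \<bar>lam\<bar> * U x + V x * (\<sigma> * W x)) (at x)"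
      using DERIV_cmult[OF d(4)[OF x], of \<sigma>] \<sigma>(2) by simp
  qed (use lam d in auto)
  have "U x = 0" "W x = 0" if "x > 0" for x
    using mode_eq_0[OF that] \<sigma>(1) by auto
  then show "negligible {r. r > 0 \<and> Re (k * f r) \<noteq> 0}" "negligible {r. r > 0 \<and> Re (k * \<i> * g r) \<noteq> 0}"
    using negligible_subset[OF n(1), of "{r. r > 0 \<and> Re (k * f r) \<noteq> 0}"]
      negligible_subset[OF n(2), of "{r. r > 0 \<and> Re (k * \<i> * g r) \<noteq> 0}"]
    by (force simp: p_def q_def)+
qed

lemma opL0_correct:
  assumes "f \<in> dom_L0"
  shows "f \<in> L2" "opL0 f \<in> L2" "L0_distrib f (opL0 f)"
  using assms someI_ex[of "\<lambda>g. g \<in> L2 \<and> L0_distrib f g"] unfolding dom_L0_def opL0_def by auto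

theorem lemma2p15:
  fixes \<rho> :: "real \<Rightarrow> real" and lam :: real
  assumes "vortex_profile \<rho>"
    and "lam \<in> {.. - (sqrt 17 / 8)} \<union> {sqrt 17 / 8 ..}"
  shows "\<not> is_eigenvalue dom_L_GP (\<lambda>u. scale_state \<i> (L_GP \<rho> u)) (of_real lam)"
proof
  interpret vortex \<rho> using assms(1) by unfold_locales
  assume "is_eigenvalue dom_L_GP (\<lambda>u. scale_state \<i> (L_GP \<rho> u)) (of_real lam)"
  then obtain f g where fg: "f \<in> dom_L0" "g \<in> dom_L0"
    and nz: "\<not> state_eq (f, g) (\<lambda>r. 0, \<lambda>r. 0)"
    and ev: "state_eq (scale_state \<i> (L_GP \<rho> (f, g))) (scale_state (of_real lam) (f, g))"
    unfolding is_eigenvalue_def dom_L_GP_def by auto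
  have lam: "sqrt 17 / 8 \<le> \<bar>lam\<bar>" using assms(2) by auto
  have e1: "AE r in half_line. \<i> * opL1 \<rho> g r = of_real lam * f r"
    and e2: "AE r in half_line. \<i> * (- opL2 \<rho> f r) = of_real lam * g r"
    using ev unfolding state_eq_def scale_state_def L_GP_def by simp_all
  have F: "negligible {r. r > 0 \<and> opL0 f r \<noteq> \<i> * of_real lam * g r - of_real (3 * (\<rho> r)\<^sup>2 - 1) * f r}"
  proof (rule negligible_subset[OF AE_half_line_negligible[OF e2]])
    have "opL0 f r = \<i> * of_real lam * g r - of_real (3 * (\<rho> r)\<^sup>2 - 1) * f r"
      if "\<i> * (- opL2 \<rho> f r) = of_real lam * g r" for r
    proof -
      have "opL2 \<rho> f r = \<i> * (\<i> * (- opL2 \<rho> f r))" by simp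
      then show ?thesis unfolding that by (simp add: opL2_def algebra_simps)
    qed
    then show "{r. r > 0 \<and> opL0 f r \<noteq> \<i> * of_real lam * g r - of_real (3 * (\<rho> r)\<^sup>2 - 1) * f r}
      \<subseteq> {r. 0 < r \<and> \<i> * (- opL2 \<rho> f r) \<noteq> of_real lam * g r}" by blast
  qed
  have G: "negligible {r. r > 0 \<and> opL0 g r \<noteq> - \<i> * of_real lam * f r - of_real ((\<rho> r)\<^sup>2 - 1) * g r}"
  proof (rule negligible_subset[OF AE_half_line_negligible[OF e1]])
    have "opL0 g r = - \<i> * of_real lam * f r - of_real ((\<rho> r)\<^sup>2 - 1) * g r"
      if "\<i> * opL1 \<rho> g r = of_real lam * f r" for r
    proof -
      have "opL1 \<rho> g r = - \<i> * (\<i> * opL1 \<rho> g r)" by simp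
      then show ?thesis unfolding that by (simp add: opL1_def algebra_simps)
    qed
    then show "{r. r > 0 \<and> opL0 g r \<noteq> - \<i> * of_real lam * f r - of_real ((\<rho> r)\<^sup>2 - 1) * g r}
      \<subseteq> {r. 0 < r \<and> \<i> * opL1 \<rho> g r \<noteq> of_real lam * f r}" by blast
  qed
  note z = eigenfunction_real_part_zero[OF opL0_correct(1)[OF fg(1)] opL0_correct(1)[OF fg(2)]
      opL0_correct(2)[OF fg(1)] opL0_correct(2)[OF fg(2)] opL0_correct(3)[OF fg(1)]
      opL0_correct(3)[OF fg(2)] lam F G]
  \<comment> \<open>The factor k = 1 removes the real part of f and k = \<i> its imaginary part; for
    g the extra \<i> interchanges the two.\<close>
  have "AE r in half_line. f r = 0"
    by (rule negligible_AE_half_line,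
        rule negligible_subset[OF negligible_Un[OF z(1)[of 1] z(1)[of "\<i>"]]])
      (auto simp: complex_eq_iff)
  moreover have "AE r in half_line. g r = 0"
    by (rule negligible_AE_half_line,
        rule negligible_subset[OF negligible_Un[OF z(2)[of 1] z(2)[of "\<i>"]]])
      (auto simp: complex_eq_iff)
  ultimately show False using nz by (simp add: state_eq_def)
qed

end
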